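(* Let $f$ be a function of $\mathcal S_d^+$. For $\widehat w=(n,m,\lambda)\in\widetilde{\mathbb H}^d$ define $$\Theta_f(\widehat w)=f\bigl(|\lambda|R(n,m),\,m-n,\,\lambda\bigr)\quad\text{with}\quad R(n,m)=(n_j+m_j+1)_{1\le j\le d}.$$ Then $\Theta_f$ belongs to $\mathcal S(\widehat{\mathbb H}^d)$ if (i) either $f$ is supported in $[0,\infty[^d\times\{0\}\times\mathbb R$, (ii) or $f$ is supported in $[r_0,\infty[^d\times\mathbb Z^d\times\mathbb R$ for some positive real number $r_0$, and satisfies $f(x,-k,\lambda)=(-1)^{|k|}f(x,k,\lambda)$ for all $(x,k,\lambda)$.
   Context: Fix an integer $d\ge1$; $\mathbb N=\{0,1,2,\dots\}$; $|k|=|k_1|+\dots+|k_d|$ for $k\in\mathbb Z^d$. $\mathcal S_d^+$ is the set of smooth functions $f$ on $[0,\infty[^d\times\mathbb Z^d\times\mathbb R$ (smooth in $(x,\lambda)$) such that for any integer $p$, $$\sup_{(x,k,\lambda)\in[0,\infty[^d\times\mathbb Z^d\times\mathbb R,\ |\alpha|\le p}(1+x_1+\dots+x_d+|k|)^p\,\bigl|\partial^\alpha_{x,\lambda}f(x,k,\lambda)\bigr|<\infty .$$ $\widetilde{\mathbb H}^d=\mathbb N^d\times\mathbb N^d\times(\mathbb R\setminus\{0\})$, with elements $\widehat w=(n,m,\lambda)$ and distance $\widehat d(\widehat w,\widehat w')=|\lambda(n+m)-\lambda'(n'+m')|_1+|(n-m)-(n'-m')|_1+|\lambda-\lambda'|$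 ($|\cdot|_1$ is the $\ell^1$ norm). Its completion is $\widehat{\mathbb H}^d=\widetilde{\mathbb H}^d\cup\widehat{\mathbb H}^d_0$, where $\widehat{\mathbb H}^d_0=\mathbb R^d_\mp\times\mathbb Z^d$, $\mathbb R^d_\mp=(\mathbb R_-)^d\cup(\mathbb R_+)^d$, with $\widehat d(\widehat w,(\dot x,k))=|\lambda(n+m)-\dot x|_1+|m-n-k|_1+|\lambda|$ and $\widehat d((\dot x,k),(\dot x',k'))=|\dot x-\dot x'|_1+|k-k'|_1$. For $\theta:\widetilde{\mathbb H}^d\to\mathbb C$ put $\widehat w_j^{\pm}=(n\pm\delta_j,m\pm\delta_j,\lambda)$, where $\delta_j$ is the $j$-th unit vector of $\mathbb N^d$ (terms with coefficient $\sqrt{n_jm_j}=0$ are read as $0$), and $$\widehat\Delta\theta(\widehat w)=-\frac{|n+m|+d}{2|\lambda|}\theta(\widehat w)+\frac1{2|\lambda|}\sum_{j=1}^d\Bigl(\sqrt{(n_j+1)(m_j+1)}\,\theta(\widehat w_j^+)+\sqrt{n_jm_j}\,\theta(\widehat w_j^-)\Bigr),$$ $$\widehat{\mathcal D}_\lambda\theta(\widehat w)=\frac{d\theta}{d\lambda}(\widehat w)+\frac d{2\lambda}\theta(\widehat w)+\frac1{2\lambda}\sum_{j=1}^d\Bigl(\sqrt{n_jm_j}\,\theta(\widehat w_j^-)-\sqrt{(n_j+1)(m_j+1)}\,\theta(\widehat w_j^+)\Bigr),$$ $$\widehat\Sigma_0\theta(\widehat w)=\frac{\theta(n,m,\lambda)-(-1)^{|n+m|}\theta(m,n,-\lambda)}{\lambda}.$$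 Let $\widehat d_0(\widehat w)=|\lambda|(|n+m|+d)+|m-n|$. $\mathcal S(\widetilde{\mathbb H}^d)$ is the set of functions $\theta$ on $\widetilde{\mathbb H}^d$ such that $\lambda\mapsto\theta(n,m,\lambda)$ is smooth on $\mathbb R\setminus\{0\}$ for all $(n,m)$, and for every integer $N\ge0$ the functions $\widehat\Delta^N\theta$, $\widehat{\mathcal D}_\lambda^N\theta$ and $\widehat\Sigma_0\widehat{\mathcal D}_\lambda^N\theta$ decay faster than any power of $\widehat d_0(\widehat w)$. Elements of $\mathcal S(\widetilde{\mathbb H}^d)$ extend continuously to $\widehat{\mathbb H}^d$, and $\mathcal S(\widehat{\mathbb H}^d)$ is the space of functions on $\widehat{\mathbb H}^d$ that are continuous extensions of elements of $\mathcal S(\widetilde{\mathbb H}^d)$; a function on $\widetilde{\mathbb H}^d$ is identified with its continuous extension, so "$\Theta_f\in\mathcal S(\widehat{\mathbb H}^d)$" means that $\Theta_f\in\mathcal S(\widetilde{\mathbb H}^d)$, extended by continuity. *)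

theory Defs
  imports "HOL-Analysis.Analysis"
begin

definition l1 :: "('a::{abs,comm_monoid_add})^'d::finite \<Rightarrow> 'a" where
  "l1 v = (\<Sum>j\<in>UNIV. \<bar>v $ j\<bar>)"

section \<open>Smooth functions on possibly non-open sets\<close>

text \<open>
  The sets of interest are the real line without the origin and the closed set of all pairs
  \<open>(x, \<lambda>)\<close> with \<open>x\<close> in the closed positive orthant.  Partial derivatives at points of the boundary
  are one-sided.  Smooth means that all iterated partial derivatives exist on \<open>S\<close> and are
  continuous on \<open>S\<close>, including the boundary.
  Only the values of \<open>f\<close> on \<open>S\<close> matter for the derivatives at points of \<open>S\<close>.
\<close>

definition partial_deriv :: "'a::euclidean_space set \<Rightarrow> 'a \<Rightarrow> ('a \<Rightarrow> complex) \<Rightarrow> 'a \<Rightarrow> complex" where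
  "partial_deriv S b f z =
     vector_derivative (\<lambda>t. f (z + t *\<^sub>R b)) (at 0 within {t. z + t *\<^sub>R b \<in> S})"

text \<open>
  A multi-index \<open>\<alpha>\<close> is given by the list of the basis directions of differentiation, so that
  \<open>|\<alpha>|\<close> is the length of the list; for smooth functions the order of the list is irrelevant.
\<close>

fun iter_partial :: "'a::euclidean_space set \<Rightarrow> 'a list \<Rightarrow> ('a \<Rightarrow> complex) \<Rightarrow> 'a \<Rightarrow> complex" where
  "iter_partial S [] f = f"
| "iter_partial S (b # bs) f = partial_deriv S b (iter_partial S bs f)"

definition smooth_on :: "'a::euclidean_space set \<Rightarrow> ('a \<Rightarrow> complex) \<Rightarrow> bool" where
  "smooth_on S f \<longleftrightarrow>
     (\<forall>bs. set bs \<subseteq> Basis \<longrightarrow>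
        continuous_on S (iter_partial S bs f) \<and>
        (\<forall>b\<in>Basis. \<forall>z\<in>S. (\<lambda>t. iter_partial S bs f (z + t *\<^sub>R b))
            differentiable (at 0 within {t. z + t *\<^sub>R b \<in> S})))"

section \<open>The space \<open>\<S>\<^sub>d\<^sup>+\<close>\<close>

definition orthant :: "(real^'d::finite) set" where
  "orthant = {x. \<forall>j. 0 \<le> x $ j}"

text \<open>
  Functions on \<open>[0,\<infinity>[\<^sup>d \<times> \<int>\<^sup>d \<times> \<real>\<close> are total functions whose values for \<open>x\<close> outside the orthant
  are ignored.
\<close>

definition schwartz_plus :: "(real^'d::finite \<Rightarrow> int^'d \<Rightarrow> real \<Rightarrow> complex) set" where
  "schwartz_plus = {f.
     (\<forall>k. smooth_on (orthant \<times> UNIV) (\<lambda>(x, lam). f x k lam)) \<and>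
     (\<forall>p::nat. \<exists>C. \<forall>x\<in>orthant. \<forall>k lam. \<forall>bs. set bs \<subseteq> Basis \<and> length bs \<le> p \<longrightarrow>
        (1 + (\<Sum>j\<in>UNIV. x $ j) + real_of_int (l1 k)) ^ p *
          cmod (iter_partial (orthant \<times> UNIV) bs (\<lambda>(x, lam). f x k lam) (x, lam)) \<le> C)}"

definition supp_plus ::
    "(real^'d::finite \<Rightarrow> int^'d \<Rightarrow> real \<Rightarrow> complex) \<Rightarrow> ((real^'d) \<times> (int^'d) \<times> real) set" where
  "supp_plus f = closure {(x, k, lam). x \<in> orthant \<and> f x k lam \<noteq> 0}"

section \<open>Operators on functions on \<open>\<nat>\<^sup>d \<times> \<nat>\<^sup>d \<times> (\<real> - {0})\<close>\<close>

text \<open>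
  Functions are total in \<open>\<lambda>\<close>; the values for \<open>\<lambda> = 0\<close> are ignored throughout.
  The subtractions of unit vectors are truncated, but the truncated terms carry the coefficient \<open>0\<close>.
\<close>

type_synonym 'd freq_fun = "nat^'d \<Rightarrow> nat^'d \<Rightarrow> real \<Rightarrow> complex"

abbreviation unit_vec :: "'d::finite \<Rightarrow> nat^'d" where
  "unit_vec j \<equiv> axis j 1"

definition size_sum :: "nat^'d::finite \<Rightarrow> nat^'d \<Rightarrow> nat" where
  "size_sum n m = (\<Sum>j\<in>UNIV. n $ j + m $ j)"

definition diff_vec :: "nat^'d::finite \<Rightarrow> nat^'d \<Rightarrow> int^'d" where
  "diff_vec m n = (\<chi> j. int (m $ j) - int (n $ j))"

definition Delta_hat :: "'d::finite freq_fun \<Rightarrow> 'd freq_fun" where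
  "Delta_hat \<theta> n m lam =
     - of_real ((real (size_sum n m) + real CARD('d)) / (2 * \<bar>lam\<bar>)) * \<theta> n m lam
     + of_real (1 / (2 * \<bar>lam\<bar>)) *
       (\<Sum>j\<in>UNIV.
          of_real (sqrt (real ((n $ j + 1) * (m $ j + 1)))) * \<theta> (n + unit_vec j) (m + unit_vec j) lam
        + of_real (sqrt (real (n $ j * m $ j))) * \<theta> (n - unit_vec j) (m - unit_vec j) lam)"

definition D_hat :: "'d::finite freq_fun \<Rightarrow> 'd freq_fun" where
  "D_hat \<theta> n m lam =
     vector_derivative (\<theta> n m) (at lam)
     + of_real (real CARD('d) / (2 * lam)) * \<theta> n m lam
     + of_real (1 / (2 * lam)) *
       (\<Sum>j\<in>UNIV.
          of_real (sqrt (real (n $ j * m $ j))) * \<theta> (n - unit_vec j) (m - unit_vec j) lam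
        - of_real (sqrt (real ((n $ j + 1) * (m $ j + 1)))) * \<theta> (n + unit_vec j) (m + unit_vec j) lam)"

definition Sigma0_hat :: "'d::finite freq_fun \<Rightarrow> 'd freq_fun" where
  "Sigma0_hat \<theta> n m lam =
     (\<theta> n m lam - (-1) ^ size_sum n m * \<theta> m n (- lam)) / of_real lam"

definition d0_hat :: "nat^'d::finite \<Rightarrow> nat^'d \<Rightarrow> real \<Rightarrow> real" where
  "d0_hat n m lam =
     \<bar>lam\<bar> * (real (size_sum n m) + real CARD('d)) + real_of_int (l1 (diff_vec m n))"

definition rapidly_decaying :: "'d::finite freq_fun \<Rightarrow> bool" where
  "rapidly_decaying \<theta> \<longleftrightarrow>
     (\<forall>p::nat. \<exists>C. \<forall>n m lam. lam \<noteq> 0 \<longrightarrow> (1 + d0_hat n m lam) ^ p * cmod (\<theta> n m lam) \<le> C)"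

definition schwartz_tilde :: "'d::finite freq_fun set" where
  "schwartz_tilde = {\<theta>.
     (\<forall>n m. smooth_on (UNIV - {0}) (\<theta> n m)) \<and>
     (\<forall>N::nat.
        rapidly_decaying ((Delta_hat ^^ N) \<theta>) \<and>
        rapidly_decaying ((D_hat ^^ N) \<theta>) \<and>
        rapidly_decaying (Sigma0_hat ((D_hat ^^ N) \<theta>)))}"

section \<open>The completed frequency space\<close>

datatype ('d::finite) freq =
    Reg "nat^'d" "nat^'d" real
  | Sing "real^'d" "int^'d"

definition freq_tilde :: "'d::finite freq set" where
  "freq_tilde = {Reg n m lam | n m lam. lam \<noteq> 0}"

definition freq_sing :: "'d::finite freq set" where
  "freq_sing = {Sing x k | x k. (\<forall>j. x $ j \<le> 0) \<or> (\<forall>j. 0 \<le> x $ j)}"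

definition freq_hat :: "'d::finite freq set" where
  "freq_hat = freq_tilde \<union> freq_sing"

definition sum_vec :: "nat^'d::finite \<Rightarrow> nat^'d \<Rightarrow> real^'d" where
  "sum_vec n m = (\<chi> j. real (n $ j + m $ j))"

fun dist_hat :: "'d::finite freq \<Rightarrow> 'd freq \<Rightarrow> real" where
  "dist_hat (Reg n m lam) (Reg n' m' lam') =
     l1 (lam *\<^sub>R sum_vec n m - lam' *\<^sub>R sum_vec n' m')
     + real_of_int (l1 (diff_vec n m - diff_vec n' m')) + \<bar>lam - lam'\<bar>"
| "dist_hat (Reg n m lam) (Sing x k) =
     l1 (lam *\<^sub>R sum_vec n m - x) + real_of_int (l1 (diff_vec m n - k)) + \<bar>lam\<bar>"
| "dist_hat (Sing x k) (Reg n m lam) =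
     l1 (lam *\<^sub>R sum_vec n m - x) + real_of_int (l1 (diff_vec m n - k)) + \<bar>lam\<bar>"
| "dist_hat (Sing x k) (Sing x' k') = l1 (x - x') + real_of_int (l1 (k - k'))"

text \<open>
  The distance is the \<open>\<ell>\<^sup>1\<close> distance of the images under the map \<open>emb\<close> below, which is injective
  on \<open>freq_hat\<close>.
\<close>

context
begin

private fun emb :: "'d::finite freq \<Rightarrow> (real^'d) \<times> (int^'d) \<times> real" where
  "emb (Reg n m lam) = (lam *\<^sub>R sum_vec n m, diff_vec m n, lam)"
| "emb (Sing x k) = (x, k, 0)"

private definition l1dist :: "(real^'d::finite) \<times> (int^'d) \<times> real \<Rightarrow> (real^'d) \<times> (int^'d) \<times> real \<Rightarrow> real" where
  "l1dist u v = (case (u, v) of ((x, k, lam), (x', k', lam')) \<Rightarrow>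
     (\<Sum>j\<in>UNIV. \<bar>x $ j - x' $ j\<bar> + \<bar>real_of_int (k $ j) - real_of_int (k' $ j)\<bar>) + \<bar>lam - lam'\<bar>)"

private lemma dist_hat_emb: "dist_hat w w' = l1dist (emb w) (emb w')"
  by (cases w; cases w')
     (auto simp: l1dist_def l1_def sum.distrib diff_vec_def algebra_simps abs_minus_commute
        intro!: arg_cong2[where f = "(+)"] sum.cong)

private lemma l1dist_zero: "l1dist u v = 0 \<longleftrightarrow> u = v"
proof -
  obtain x k a x' k' b where uv: "u = (x, k, a)" "v = (x', k', b)"
    by (metis prod_cases3)
  have "l1dist u v = 0 \<longleftrightarrow>
      (\<Sum>j\<in>UNIV. \<bar>x $ j - x' $ j\<bar> + \<bar>real_of_int (k $ j) - real_of_int (k' $ j)\<bar>) = 0 \<and> \<bar>a - b\<bar> = 0"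
    unfolding l1dist_def uv prod.case by (intro add_nonneg_eq_0_iff sum_nonneg) auto
  also have "\<dots> \<longleftrightarrow> u = v"
    by (auto simp: uv sum_nonneg_eq_0_iff add_nonneg_eq_0_iff vec_eq_iff)
  finally show ?thesis .
qed

private lemma l1dist_triangle: "l1dist u w \<le> l1dist u v + l1dist v w"
proof -
  obtain x k a x' k' b x'' k'' c where uv: "u = (x, k, a)" "v = (x', k', b)" "w = (x'', k'', c)"
    by (metis prod_cases3)
  have "(\<Sum>j\<in>UNIV. \<bar>x $ j - x'' $ j\<bar> + \<bar>real_of_int (k $ j) - real_of_int (k'' $ j)\<bar>)
      \<le> (\<Sum>j\<in>UNIV. (\<bar>x $ j - x' $ j\<bar> + \<bar>real_of_int (k $ j) - real_of_int (k' $ j)\<bar>)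
        + (\<bar>x' $ j - x'' $ j\<bar> + \<bar>real_of_int (k' $ j) - real_of_int (k'' $ j)\<bar>))"
    by (intro sum_mono) linarith
  then show ?thesis
    unfolding l1dist_def uv prod.case sum.distrib by linarith
qed

private lemma emb_inj:
  assumes "w \<in> freq_hat" "w' \<in> freq_hat" "emb w = emb w'"
  shows "w = w'"
proof (cases w; cases w')
  fix n m lam n' m' lam'
  assume w: "w = Reg n m lam" "w' = Reg n' m' lam'"
  have "lam \<noteq> 0" using assms(1) by (auto simp: w freq_hat_def freq_tilde_def freq_sing_def)
  then have "real (n $ j + m $ j) = real (n' $ j + m' $ j) \<and>
      int (m $ j) - int (n $ j) = int (m' $ j) - int (n' $ j)" for j
    using assms(3) by (auto simp: w sum_vec_def diff_vec_def vec_eq_iff)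
  then have "n $ j = n' $ j \<and> m $ j = m' $ j" for j
    by (smt (verit) of_nat_add of_nat_eq_iff)
  then show ?thesis using assms(3) by (simp add: w vec_eq_iff)
qed (use assms in \<open>auto simp: freq_hat_def freq_tilde_def freq_sing_def\<close>)

lemma Metric_space_freq_hat: "Metric_space (freq_hat :: 'd::finite freq set) dist_hat"
proof
  show "0 \<le> dist_hat x y" for x y :: "'d freq"
    by (auto simp: dist_hat_emb l1dist_def intro!: add_nonneg_nonneg sum_nonneg split: prod.split)
  show "dist_hat x y = dist_hat y x" for x y :: "'d freq"
    by (auto simp: dist_hat_emb l1dist_def abs_minus_commute split: prod.split)
  show "dist_hat x y = 0 \<longleftrightarrow> x = y" if "x \<in> freq_hat" "y \<in> freq_hat" for x y :: "'d freq"
    using emb_inj[OF that] by (auto simp: dist_hat_emb l1dist_zero)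
  show "dist_hat x z \<le> dist_hat x y + dist_hat y z" for x y z :: "'d freq"
    by (simp add: dist_hat_emb l1dist_triangle)
qed

end

text \<open>
  A function on the completed space is a total function whose values outside \<open>freq_hat\<close> are ignored.
\<close>

definition schwartz_hat :: "('d::finite freq \<Rightarrow> complex) set" where
  "schwartz_hat = {T.
     continuous_map (Metric_space.mtopology freq_hat dist_hat) euclidean T \<and>
     (\<lambda>n m lam. T (Reg n m lam)) \<in> schwartz_tilde}"

section \<open>The functions \<open>\<Theta>\<^sub>f\<close>\<close>

definition R_vec :: "nat^'d::finite \<Rightarrow> nat^'d \<Rightarrow> real^'d" where
  "R_vec n m = (\<chi> j. real (n $ j + m $ j + 1))"

definition Theta :: "(real^'d::finite \<Rightarrow> int^'d \<Rightarrow> real \<Rightarrow> complex) \<Rightarrow> 'd freq_fun" where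
  "Theta f n m lam = f (\<bar>lam\<bar> *\<^sub>R R_vec n m) (diff_vec m n) lam"

end

theory Submission
  imports Defs
begin

text \<open>
  Write \<open>x = \<bar>\<lambda>\<bar> R(n,m)\<close> and \<open>k = m - n\<close>.  The shift of \<open>(n,m)\<close> to \<open>(n \<plusminus> \<delta>\<^sub>j, m \<plusminus> \<delta>\<^sub>j)\<close> moves \<open>x\<close>
  by \<open>\<plusminus>2\<bar>\<lambda>\<bar>\<close> in the \<open>j\<close>-th direction and fixes \<open>k\<close>.  With \<open>u = 1 / R\<^sub>j = \<bar>\<lambda>\<bar> / x\<^sub>j\<close>, its coefficient
  (\<open>\<surd>((n\<^sub>j+1)(m\<^sub>j+1))\<close> for plus, \<open>\<surd>(n\<^sub>j m\<^sub>j)\<close> for minus) is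
  \<open>(R\<^sub>j / 2) \<surd>((1 \<plusminus> u)\<^sup>2 - (k\<^sub>j u)\<^sup>2)\<close>.  A Taylor expansion in \<open>x\<close> and the binomial series of the
  square root therefore give, for each order,
  \<open>\<bar>\<lambda>\<bar> \<cdot> coefficient \<cdot> shift \<Theta>\<^sub>g = \<Sum>\<^sub>i (\<plusminus>\<bar>\<lambda>\<bar>)\<^sup>i \<Theta>(P\<^sub>i g) + remainder\<close>, where the functions \<open>P\<^sub>i g\<close> do not
  depend on the sign (lemma \<open>hop_expansion\<close>).  In \<open>Delta_hat\<close> the two shifts are added: odd powers
  cancel, the term \<open>i = 0\<close> cancels the diagonal term, and what is left is divisible by \<open>\<lambda>\<^sup>2\<close>.  In
  \<open>D_hat\<close> they are subtracted: even powers cancel, and the term \<open>i = 1\<close> cancels both the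
  zeroth-order term and the derivative \<open>\<Sum>\<^sub>j x\<^sub>j \<partial>\<^sub>j g\<close> that comes from differentiating \<open>\<bar>\<lambda>\<bar> R\<close>.  So both operators map \<open>\<Theta>\<^sub>g\<close> to some
  \<open>\<Theta>\<^sub>g\<^sub>'\<close> up to a remainder of any prescribed order in \<open>\<lambda>\<close> (lemmas \<open>Delta_hat_Theta\<close> and
  \<open>D_hat_Theta\<close>), and the set \<open>approx_symbols\<close> of all \<open>\<theta>\<close> that agree with some \<open>\<Theta>\<^sub>g\<close> to each given order is
  stable under both.

  Three choices make the argument close up.
  \<^item> The functions \<open>g(x,k,\<lambda>)\<close> are measured only where \<open>\<bar>\<lambda>\<bar> \<le> x\<^sub>j\<close> for all \<open>j\<close>.  This cone contains the
    grid, multiplication by \<open>\<lambda>\<close> preserves rapid decay on it, and it contains the segments from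
    \<open>(x,\<lambda>)\<close> to \<open>(x,-\<lambda>)\<close> and from \<open>x\<close> to its shift.  The expansions use no values outside the
    open orthant: when the lower shift would leave it, its coefficient is zero.
  \<^item> A remainder of order \<open>M\<close> has all iterates of \<open>\<lambda> d/d\<lambda>\<close> bounded by \<open>\<bar>\<lambda>\<bar>\<^sup>M\<close> times each negative power of
    \<open>1 + d0_hat\<close>.  The operator \<open>\<lambda> d/d\<lambda>\<close> commutes with shifts and with functions of \<open>(n,m)\<close>, and
    \<open>\<Theta>\<close> turns it into the Euler field \<open>\<Sum>\<^sub>j x\<^sub>j \<partial>\<^sub>j + \<lambda> \<partial>\<^sub>\<lambda>\<close>, so each operator costs at most two orders.
  \<^item> The functions \<open>P\<^sub>i g\<close> contain factors \<open>c\<^sub>q(k\<^sub>j) x\<^sub>j\<^sup>1\<^sup>-\<^sup>q\<close>, singular at \<open>x\<^sub>j = 0\<close> for \<open>q \<ge> 2\<close>.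
    Since \<open>c\<^sub>q(0) = 0\<close> for \<open>q \<ge> 2\<close>, it suffices that \<open>g(x,k,\<lambda>)\<close> vanishes when \<open>k \<noteq> 0\<close> and some
    \<open>x\<^sub>j < r\<^sub>0\<close>.  Both hypotheses of the theorem imply this, and both imply the parity of \<open>g\<close> in \<open>k\<close>;
    \<open>admissible\<close> records these two facts, which differentiation and the passage to \<open>P\<^sub>i g\<close> preserve.

  The decay of \<open>Sigma0_hat\<close> then follows from parity, which reduces \<open>Sigma0_hat \<Theta>\<^sub>g\<close> to the difference
  quotient of \<open>g\<close> between \<open>\<lambda>\<close> and \<open>-\<lambda>\<close>.  The continuous extension of \<open>\<Theta>\<^sub>f\<close> is \<open>(x,k) \<mapsto> f(\<bar>x\<bar>,k,0)\<close>.
\<close>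

section \<open>Differentiability from continuous partial derivatives\<close>

text \<open>
  Move from \<open>z\<close> to \<open>z + v\<close> along one basis direction at a time.  All intermediate points are within
  \<open>norm v\<close> of \<open>z\<close>, so on each piece the mean value inequality gives an error at most \<open>e' * norm v\<close>.
\<close>

lemma continuous_partials_imp_has_derivative:
  fixes f :: "'a::euclidean_space \<Rightarrow> 'b::real_normed_vector"
  assumes "open U" "z \<in> U"
    and D: "\<And>y b. y \<in> U \<Longrightarrow> b \<in> Basis \<Longrightarrow> ((\<lambda>t. f (y + t *\<^sub>R b)) has_vector_derivative D b y) (at 0)"
    and cont: "\<And>b. b \<in> Basis \<Longrightarrow> continuous_on U (D b)"
  shows "(f has_derivative (\<lambda>v. \<Sum>b\<in>Basis. (v \<bullet> b) *\<^sub>R D b z)) (at z)"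
  unfolding has_derivative_at_alt
proof (intro conjI allI impI)
  show "bounded_linear (\<lambda>v. \<Sum>b\<in>Basis. (v \<bullet> b) *\<^sub>R D b z)"
    by (intro bounded_linear_sum bounded_linear_compose[OF bounded_linear_scaleR_left]
        bounded_linear_inner_left)
  fix e :: real assume "0 < e"
  define e' where "e' = e / real DIM('a)"
  have e': "0 < e'" using \<open>0 < e\<close> by (simp add: e'_def)
  have "\<forall>\<^sub>F y in at z. \<forall>b\<in>Basis. dist (D b y) (D b z) < e'"
    using cont \<open>open U\<close> \<open>z \<in> U\<close> e'
    by (intro eventually_ball_finite) (auto simp: continuous_on_eq_continuous_at isCont_def tendsto_iff)
  moreover have "\<forall>\<^sub>F y in at z. y \<in> U"
    using \<open>open U\<close> \<open>z \<in> U\<close> by (simp add: eventually_at_in_open')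
  ultimately have "\<forall>\<^sub>F y in at z. y \<in> U \<and> (\<forall>b\<in>Basis. dist (D b y) (D b z) < e')"
    by eventually_elim auto
  then obtain d where d: "0 < d"
    "\<And>y. y \<noteq> z \<Longrightarrow> dist y z < d \<Longrightarrow> y \<in> U \<and> (\<forall>b\<in>Basis. dist (D b y) (D b z) < e')"
    by (auto simp: eventually_at)
  have near: "z + v \<in> U \<and> (\<forall>b\<in>Basis. norm (D b (z + v) - D b z) \<le> e')" if "norm v < d" for v
    using d(2)[of "z + v"] that \<open>z \<in> U\<close> e' by (cases "v = 0") (auto simp: dist_norm less_imp_le)
  have step: "norm (f (z + v + s *\<^sub>R b) - f (z + v) - s *\<^sub>R D b z) \<le> e' * \<bar>s\<bar>"
    if b: "b \<in> Basis" and v: "\<And>t. t \<in> closed_segment 0 s \<Longrightarrow> norm (v + t *\<^sub>R b) < d" for v s b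
  proof -
    have der: "((\<lambda>t. f (z + v + t *\<^sub>R b)) has_vector_derivative D b (z + v + t *\<^sub>R b))
        (at t within closed_segment 0 s)" if "t \<in> closed_segment 0 s" for t
    proof -
      have U: "z + v + t *\<^sub>R b \<in> U"
        using near[OF v[OF that]] by (simp add: add.assoc)
      have "(((\<lambda>r. f (z + v + t *\<^sub>R b + r *\<^sub>R b)) \<circ> (\<lambda>r. r - t)) has_vector_derivative
          1 *\<^sub>R D b (z + v + t *\<^sub>R b)) (at t)"
        using D[OF U b] by (intro vector_diff_chain_at) (auto intro!: derivative_eq_intros)
      then show ?thesis
        by (simp add: o_def algebra_simps has_vector_derivative_at_within)
    qed
    have "((\<lambda>t. f (z + v + t *\<^sub>R b) - t *\<^sub>R D b z) has_derivative
        (\<lambda>h. h *\<^sub>R (D b (z + v + t *\<^sub>R b) - D b z))) (at t within closed_segment 0 s)"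
      if "t \<in> closed_segment 0 s" for t
      using der[OF that] unfolding has_vector_derivative_def
      by (auto intro!: derivative_eq_intros simp: scaleR_diff_right)
    moreover have "onorm (\<lambda>h. h *\<^sub>R (D b (z + v + t *\<^sub>R b) - D b z)) \<le> e'"
      if "t \<in> closed_segment 0 s" for t
      using near[OF v[OF that]] b
      by (intro onorm_le) (auto simp: add.assoc mult.commute[of "\<bar>_\<bar>"] intro!: mult_right_mono)
    ultimately have "norm ((f (z + v + s *\<^sub>R b) - s *\<^sub>R D b z) - (f (z + v + 0 *\<^sub>R b) - 0 *\<^sub>R D b z))
        \<le> e' * norm (s - 0)"
      by (intro differentiable_bound[where S = "closed_segment 0 s"]) auto
    then show ?thesis by (simp add: algebra_simps)
  qed
  show "\<exists>d>0. \<forall>y. norm (y - z) < d \<longrightarrow>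
      norm (f y - f z - (\<Sum>b\<in>Basis. ((y - z) \<bullet> b) *\<^sub>R D b z)) \<le> e * norm (y - z)"
  proof (intro exI conjI allI impI)
    fix y assume y: "norm (y - z) < d"
    define v where "v = y - z"
    define P where "P B = (\<Sum>b\<in>B. (v \<bullet> b) *\<^sub>R b)" for B
    have "norm (f (z + P B) - f z - (\<Sum>b\<in>B. (v \<bullet> b) *\<^sub>R D b z)) \<le> (\<Sum>b\<in>B. e' * norm v)"
      if "B \<subseteq> Basis" for B
      using finite_subset[OF that finite_Basis] that
    proof (induction B)
      case (insert b B)
      have "norm (P B + t *\<^sub>R b) < d" if t: "t \<in> closed_segment 0 (v \<bullet> b)" for t
      proof -
        have "norm (P B + t *\<^sub>R b) \<le> norm v"
        proof (rule norm_le_componentwise)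
          fix i :: 'a assume i: "i \<in> Basis"
          have "P B \<bullet> i = (\<Sum>c\<in>B. (v \<bullet> c) * (if c = i then 1 else 0))"
            unfolding P_def inner_sum_left inner_scaleR_left using insert.prems i
            by (intro sum.cong refl) (auto simp: inner_Basis)
          then have "P B \<bullet> i = (if i \<in> B then v \<bullet> i else 0)"
            using insert.hyps by (simp add: if_distrib cong: if_cong)
          moreover have "\<bar>t\<bar> \<le> \<bar>v \<bullet> b\<bar>"
            using t by (auto simp: closed_segment_eq_real_ivl split: if_splits)
          ultimately show "\<bar>(P B + t *\<^sub>R b) \<bullet> i\<bar> \<le> \<bar>v \<bullet> i\<bar>"
            using insert i by (auto simp: inner_add_left inner_Basis)
        qed
        then show ?thesis using y by (simp add: v_def)
      qed
      then have "norm (f (z + P B + (v \<bullet> b) *\<^sub>R b) - f (z + P B) - (v \<bullet> b) *\<^sub>R D b z) \<le> e' * \<bar>v \<bullet> b\<bar>"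
        using insert.prems by (intro step) auto
      also have "\<dots> \<le> e' * norm v"
        using e' insert.prems by (intro mult_left_mono) (auto simp: Basis_le_norm)
      finally have "norm (f (z + P B + (v \<bullet> b) *\<^sub>R b) - f (z + P B) - (v \<bullet> b) *\<^sub>R D b z) \<le> e' * norm v" .
      moreover have "norm (f (z + P B) - f z - (\<Sum>b\<in>B. (v \<bullet> b) *\<^sub>R D b z)) \<le> (\<Sum>b\<in>B. e' * norm v)"
        using insert by auto
      moreover have "f (z + P (insert b B)) - f z - (\<Sum>b\<in>insert b B. (v \<bullet> b) *\<^sub>R D b z) =
          (f (z + P B + (v \<bullet> b) *\<^sub>R b) - f (z + P B) - (v \<bullet> b) *\<^sub>R D b z)
          + (f (z + P B) - f z - (\<Sum>b\<in>B. (v \<bullet> b) *\<^sub>R D b z))"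
        using insert.hyps by (simp add: P_def algebra_simps)
      ultimately show ?case
        using insert.hyps by (simp only: sum.insert) (rule norm_triangle_le, simp add: distrib_right)
    qed (simp add: P_def)
    from this[of Basis] show "norm (f y - f z - (\<Sum>b\<in>Basis. ((y - z) \<bullet> b) *\<^sub>R D b z)) \<le> e * norm (y - z)"
      by (simp add: P_def euclidean_representation e'_def) (simp add: v_def)
  qed (use \<open>0 < d\<close> in simp)
qed

section \<open>Rapidly decreasing symbols\<close>

definition pos_orthant :: "(real^'d::finite) set" where
  "pos_orthant = {x. \<forall>j. 0 < x $ j}"

definition weight :: "real^'d::finite \<Rightarrow> int^'d \<Rightarrow> real" where
  "weight x k = 1 + (\<Sum>j\<in>UNIV. x $ j) + real_of_int (l1 k)"

type_synonym 'd symb = "real^'d \<Rightarrow> int^'d \<Rightarrow> real \<Rightarrow> complex"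

text \<open>
  The bound is required only in the cone \<open>\<bar>lam\<bar> \<le> x\<^sub>j\<close>, where \<open>weight\<close> also controls \<open>lam\<close>.
\<close>

definition rapid_symb :: "'d::finite symb \<Rightarrow> bool" where
  "rapid_symb g \<longleftrightarrow>
     (\<forall>p::nat. \<exists>C. \<forall>x\<in>pos_orthant. \<forall>k lam. (\<forall>j. \<bar>lam\<bar> \<le> x $ j) \<longrightarrow>
        weight x k ^ p * cmod (g x k lam) \<le> C)"

definition has_grad :: "'d::finite symb \<Rightarrow> ('d \<Rightarrow> 'd symb) \<Rightarrow> 'd symb \<Rightarrow> bool" where
  "has_grad g gx gl \<longleftrightarrow>
     (\<forall>x\<in>pos_orthant. \<forall>k lam. ((\<lambda>(x, lam). g x k lam) has_derivative
        (\<lambda>(v, s). (\<Sum>j\<in>UNIV. v $ j *\<^sub>R gx j x k lam) + s *\<^sub>R gl x k lam)) (at (x, lam)))"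

definition dx :: "'d::finite \<Rightarrow> 'd symb \<Rightarrow> 'd symb" where
  "dx j g x k lam = frechet_derivative (\<lambda>(x, lam). g x k lam) (at (x, lam)) (axis j 1, 0)"

definition dlam :: "'d::finite symb \<Rightarrow> 'd symb" where
  "dlam g x k lam = frechet_derivative (\<lambda>(x, lam). g x k lam) (at (x, lam)) (0, 1)"

text \<open>
  Rapid decay of all partial derivatives up to order \<open>N\<close>, in \<open>x\<close> and \<open>\<lambda>\<close>.  Recursion on \<open>N\<close> turns
  closure properties that involve the product rule into plain inductions.
\<close>

fun symb_upto :: "nat \<Rightarrow> 'd::finite symb \<Rightarrow> bool" where
  "symb_upto 0 g = rapid_symb g"
| "symb_upto (Suc N) g = (rapid_symb g \<and> has_grad g (\<lambda>j. dx j g) (dlam g) \<and>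
     (\<forall>j. symb_upto N (dx j g)) \<and> symb_upto N (dlam g))"

lemma open_pos_orthant: "open (pos_orthant :: (real^'d::finite) set)"
proof -
  have "pos_orthant = (\<Inter>j. {x :: real^'d. 0 < x $ j})" by (auto simp: pos_orthant_def)
  also have "open \<dots>" by (intro open_INT ballI open_Collect_less continuous_intros) simp
  finally show ?thesis .
qed

lemma l1_nonneg: "0 \<le> l1 (k :: int^'d::finite)"
  by (auto simp: l1_def intro: sum_nonneg)

lemma component_le_l1: "\<bar>k $ j\<bar> \<le> l1 (k :: int^'d::finite)"
  unfolding l1_def by (rule member_le_sum) auto

lemma component_le_weight:
  assumes "x \<in> pos_orthant"
  shows "x $ j \<le> weight x k" "1 \<le> weight x k"
proof -
  have "x $ j \<le> (\<Sum>j\<in>UNIV. x $ j)" "0 \<le> (\<Sum>j\<in>UNIV. x $ j)"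
    using assms by (auto simp: pos_orthant_def less_imp_le intro!: member_le_sum sum_nonneg)
  then show "x $ j \<le> weight x k" "1 \<le> weight x k"
    using l1_nonneg[of k] by (auto simp: weight_def)
qed

lemma rapid_symb_dominated:
  assumes "rapid_symb f"
    and g: "\<And>x k lam. x \<in> pos_orthant \<Longrightarrow> (\<And>j. \<bar>lam\<bar> \<le> x $ j) \<Longrightarrow>
      cmod (g x k lam) \<le> C * weight x k ^ q * cmod (f x k lam)"
  shows "rapid_symb g"
  unfolding rapid_symb_def
proof
  fix p :: nat
  obtain C' where C': "\<And>x k lam. x \<in> pos_orthant \<Longrightarrow> (\<And>j. \<bar>lam\<bar> \<le> x $ j) \<Longrightarrow>
      weight x k ^ (p + q) * cmod (f x k lam) \<le> C'"
    using assms(1) unfolding rapid_symb_def by blast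
  have "weight x k ^ p * cmod (g x k lam) \<le> \<bar>C\<bar> * C'"
    if x: "x \<in> pos_orthant" "\<And>j. \<bar>lam\<bar> \<le> x $ j" for x k lam
  proof -
    have w: "1 \<le> weight x k" using component_le_weight(2)[OF x(1)] .
    have "cmod (g x k lam) \<le> \<bar>C\<bar> * (weight x k ^ q * cmod (f x k lam))"
      using g[OF x, of k] w
      by (smt (verit) mult.assoc mult_right_mono norm_ge_zero zero_le_mult_iff zero_le_power)
    then have "weight x k ^ p * cmod (g x k lam) \<le>
        weight x k ^ p * (\<bar>C\<bar> * (weight x k ^ q * cmod (f x k lam)))"
      using w by (intro mult_left_mono) auto
    also have "\<dots> = \<bar>C\<bar> * (weight x k ^ (p + q) * cmod (f x k lam))"
      by (simp add: power_add)
    also have "\<dots> \<le> \<bar>C\<bar> * C'"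
      using C'[OF x] by (intro mult_left_mono) auto
    finally show ?thesis .
  qed
  then show "\<exists>C. \<forall>x\<in>pos_orthant. \<forall>k lam. (\<forall>j. \<bar>lam\<bar> \<le> x $ j) \<longrightarrow>
      weight x k ^ p * cmod (g x k lam) \<le> C" by blast
qed

lemma rapid_symb_add:
  assumes "rapid_symb f" "rapid_symb g"
  shows "rapid_symb (\<lambda>x k lam. f x k lam + g x k lam)"
  unfolding rapid_symb_def
proof
  fix p :: nat
  obtain C C' where C: "\<And>x k lam. x \<in> pos_orthant \<Longrightarrow> (\<And>j. \<bar>lam\<bar> \<le> x $ j) \<Longrightarrow>
      weight x k ^ p * cmod (f x k lam) \<le> C"
    and C': "\<And>x k lam. x \<in> pos_orthant \<Longrightarrow> (\<And>j. \<bar>lam\<bar> \<le> x $ j) \<Longrightarrow>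
      weight x k ^ p * cmod (g x k lam) \<le> C'"
    using assms unfolding rapid_symb_def by meson
  have "weight x k ^ p * cmod (f x k lam + g x k lam) \<le> C + C'"
    if x: "x \<in> pos_orthant" "\<And>j. \<bar>lam\<bar> \<le> x $ j" for x k lam
  proof -
    have "0 \<le> weight x k ^ p" using component_le_weight(2)[OF x(1), of k] by simp
    then have "weight x k ^ p * cmod (f x k lam + g x k lam) \<le>
        weight x k ^ p * (cmod (f x k lam) + cmod (g x k lam))"
      by (intro mult_left_mono norm_triangle_ineq)
    then show ?thesis using C[OF x, of k] C'[OF x, of k] by (simp add: distrib_left)
  qed
  then show "\<exists>C. \<forall>x\<in>pos_orthant. \<forall>k lam. (\<forall>j. \<bar>lam\<bar> \<le> x $ j) \<longrightarrow>
      weight x k ^ p * cmod (f x k lam + g x k lam) \<le> C" by blast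
qed

lemma grad_unique_at:
  fixes a a' :: "'d::finite \<Rightarrow> complex"
  assumes "(F has_derivative (\<lambda>(v, s). (\<Sum>j\<in>UNIV. v $ j *\<^sub>R a j) + s *\<^sub>R b)) (at (x :: real^'d, lam :: real))"
    and "(F has_derivative (\<lambda>(v, s). (\<Sum>j\<in>UNIV. v $ j *\<^sub>R a' j) + s *\<^sub>R b')) (at (x, lam))"
  shows "a j = a' j" "b = b'"
proof -
  from has_derivative_unique[OF assms] have
    eq: "(\<Sum>j\<in>UNIV. v $ j *\<^sub>R a j) + s *\<^sub>R b = (\<Sum>j\<in>UNIV. v $ j *\<^sub>R a' j) + s *\<^sub>R b'" for v :: "real^'d" and s :: real
    by (auto dest: fun_cong[of _ _ "(v, s)"])
  show "a j = a' j"
    using eq[of "axis j 1" 0] by (simp add: axis_def if_distrib[where f = "\<lambda>c. c *\<^sub>R _"] cong: if_cong)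
  show "b = b'" using eq[of 0 1] by simp
qed

lemma grad_eq_partials:
  assumes "has_grad g gx gl" "x \<in> pos_orthant"
  shows "dx j g x k lam = gx j x k lam" "dlam g x k lam = gl x k lam"
proof -
  have "((\<lambda>(x, lam). g x k lam) has_derivative
        (\<lambda>(v, s). (\<Sum>j\<in>UNIV. v $ j *\<^sub>R gx j x k lam) + s *\<^sub>R gl x k lam)) (at (x, lam))"
    using assms by (auto simp: has_grad_def)
  from frechet_derivative_at[OF this, symmetric]
  show "dx j g x k lam = gx j x k lam" "dlam g x k lam = gl x k lam"
    by (simp_all add: dx_def dlam_def axis_def if_distrib[where f = "\<lambda>c. c *\<^sub>R _"] cong: if_cong)
qed

lemma has_grad_cong:
  fixes g :: "'d::finite symb"
  assumes "has_grad g gx gl" "\<And>x k lam. x \<in> pos_orthant \<Longrightarrow> g x k lam = g' x k lam"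
    and "\<And>j x k lam. x \<in> pos_orthant \<Longrightarrow> gx j x k lam = gx' j x k lam"
    and "\<And>x k lam. x \<in> pos_orthant \<Longrightarrow> gl x k lam = gl' x k lam"
  shows "has_grad g' gx' gl'"
  unfolding has_grad_def
proof (intro ballI allI)
  fix x :: "real^'d" and k lam assume x: "x \<in> pos_orthant"
  have "((\<lambda>(x, lam). g x k lam) has_derivative
        (\<lambda>(v, s). (\<Sum>j\<in>UNIV. v $ j *\<^sub>R gx' j x k lam) + s *\<^sub>R gl' x k lam)) (at (x, lam))"
    using assms(1) x by (simp add: has_grad_def assms(3,4))
  then show "((\<lambda>(x, lam). g' x k lam) has_derivative
        (\<lambda>(v, s). (\<Sum>j\<in>UNIV. v $ j *\<^sub>R gx' j x k lam) + s *\<^sub>R gl' x k lam)) (at (x, lam))"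
    by (rule has_derivative_transform_within_open[where s = "pos_orthant \<times> UNIV"])
      (use x assms(2) in \<open>auto simp: open_Times open_pos_orthant\<close>)
qed

lemma symb_upto_cong:
  assumes "\<And>x k lam. x \<in> pos_orthant \<Longrightarrow> g x k lam = g' x k lam" "symb_upto N g"
  shows "symb_upto N g'"
  using assms
proof (induction N arbitrary: g g')
  case 0
  then show ?case by (auto simp: rapid_symb_def)
next
  case (Suc N)
  have grad: "has_grad g' (\<lambda>j. dx j g) (dlam g)"
    using Suc.prems by (auto intro: has_grad_cong)
  note eq = grad_eq_partials[OF grad]
  have "symb_upto N (dx j g')" for j
    by (rule Suc.IH[of "dx j g"]) (use Suc.prems eq in auto)
  moreover have "symb_upto N (dlam g')"
    by (rule Suc.IH[of "dlam g"]) (use Suc.prems eq in auto)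
  moreover have "has_grad g' (\<lambda>j. dx j g') (dlam g')"
    using grad by (rule has_grad_cong) (use eq in auto)
  moreover have "rapid_symb g'"
    using Suc.prems by (auto simp: rapid_symb_def)
  ultimately show ?case by simp
qed

text \<open>
  The gradient may be exhibited in any form: on the open orthant it must coincide with the canonical
  partial derivatives \<open>dx\<close> and \<open>dlam\<close>.
\<close>

lemma symb_upto_SucI:
  assumes "rapid_symb g" and grad: "has_grad g gx gl"
    and "\<And>j. symb_upto N (gx j)" "symb_upto N gl"
  shows "symb_upto (Suc N) g"
proof -
  note eq = grad_eq_partials[OF grad]
  have "symb_upto N (dx j g)" for j
    by (rule symb_upto_cong[OF _ assms(3)[of j]]) (use eq in auto)
  moreover have "symb_upto N (dlam g)"
    by (rule symb_upto_cong[OF _ assms(4)]) (use eq in auto)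
  moreover have "has_grad g (\<lambda>j. dx j g) (dlam g)"
    using grad by (rule has_grad_cong) (use eq in auto)
  ultimately show ?thesis using assms(1) by simp
qed

lemma symb_upto_Suc_le: "symb_upto (Suc N) g \<Longrightarrow> symb_upto N g"
proof (induction N arbitrary: g)
  case (Suc N)
  then have "rapid_symb g" "has_grad g (\<lambda>j. dx j g) (dlam g)"
    "\<And>j. symb_upto N (dx j g)" "symb_upto N (dlam g)"
    by (simp_all only: symb_upto.simps(2)[of "Suc N"])
  then show ?case by (simp only: symb_upto.simps(2)) blast
qed simp

lemma has_grad_add:
  assumes "has_grad f fx fl" "has_grad g gx gl"
  shows "has_grad (\<lambda>x k lam. f x k lam + g x k lam)
    (\<lambda>j x k lam. fx j x k lam + gx j x k lam) (\<lambda>x k lam. fl x k lam + gl x k lam)"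
  unfolding has_grad_def
proof (intro ballI allI)
  fix x :: "real^'a" and k lam assume "x \<in> pos_orthant"
  with assms have
    "((\<lambda>(x, lam). f x k lam) has_derivative
        (\<lambda>(v, s). (\<Sum>j\<in>UNIV. v $ j *\<^sub>R fx j x k lam) + s *\<^sub>R fl x k lam)) (at (x, lam))"
    "((\<lambda>(x, lam). g x k lam) has_derivative
        (\<lambda>(v, s). (\<Sum>j\<in>UNIV. v $ j *\<^sub>R gx j x k lam) + s *\<^sub>R gl x k lam)) (at (x, lam))"
    by (auto simp: has_grad_def)
  from has_derivative_add[OF this]
  show "((\<lambda>(x, lam). f x k lam + g x k lam) has_derivative
        (\<lambda>(v, s). (\<Sum>j\<in>UNIV. v $ j *\<^sub>R (fx j x k lam + gx j x k lam)) + s *\<^sub>R (fl x k lam + gl x k lam))) (at (x, lam))"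
    by (simp add: case_prod_unfold scaleR_add_right sum.distrib add_ac)
qed

lemma has_grad_mult:
  fixes a :: "'d::finite symb"
  assumes "has_grad a ax al" "has_grad g gx gl"
  shows "has_grad (\<lambda>x k lam. a x k lam * g x k lam)
    (\<lambda>j x k lam. a x k lam * gx j x k lam + ax j x k lam * g x k lam)
    (\<lambda>x k lam. a x k lam * gl x k lam + al x k lam * g x k lam)"
  unfolding has_grad_def
proof (intro ballI allI)
  fix x :: "real^'d" and k lam assume "x \<in> pos_orthant"
  with assms have
    "((\<lambda>(x, lam). a x k lam) has_derivative
        (\<lambda>(v, s). (\<Sum>j\<in>UNIV. v $ j *\<^sub>R ax j x k lam) + s *\<^sub>R al x k lam)) (at (x, lam))"
    "((\<lambda>(x, lam). g x k lam) has_derivative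
        (\<lambda>(v, s). (\<Sum>j\<in>UNIV. v $ j *\<^sub>R gx j x k lam) + s *\<^sub>R gl x k lam)) (at (x, lam))"
    by (auto simp: has_grad_def)
  from has_derivative_mult[OF this]
  show "((\<lambda>(x, lam). a x k lam * g x k lam) has_derivative
        (\<lambda>(v, s). (\<Sum>j\<in>UNIV. v $ j *\<^sub>R (a x k lam * gx j x k lam + ax j x k lam * g x k lam))
          + s *\<^sub>R (a x k lam * gl x k lam + al x k lam * g x k lam))) (at (x, lam))"
    by (simp add: case_prod_unfold scaleR_add_right sum.distrib sum_distrib_left sum_distrib_right
        distrib_left distrib_right add_ac)
qed

lemma has_grad_const: "has_grad (\<lambda>x k lam. c k) (\<lambda>j x k lam. 0) (\<lambda>x k lam. 0)"
  by (auto simp: has_grad_def case_prod_unfold)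

lemma has_grad_coordinate:
  "has_grad (\<lambda>x k lam. of_real (x $ i)) (\<lambda>j x k lam. if j = i then 1 else 0) (\<lambda>x k lam. 0)"
proof -
  have "((\<lambda>z :: (real^'a) \<times> real. (fst z $ i) *\<^sub>R (1 :: complex)) has_derivative
      (\<lambda>z. (fst z $ i) *\<^sub>R 1)) F" for F
    by (intro bounded_linear_imp_has_derivative bounded_linear_compose[OF bounded_linear_scaleR_left]
        bounded_linear_compose[OF bounded_linear_vec_nth] bounded_linear_fst)
  then show ?thesis
    by (simp add: has_grad_def case_prod_unfold scaleR_conv_of_real
        if_distrib[where f = "\<lambda>c. _ * c"] cong: if_cong)
qed

lemma has_grad_lam: "has_grad (\<lambda>x k lam. of_real lam) (\<lambda>j x k lam. 0) (\<lambda>x k lam. 1)"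
  by (auto simp: has_grad_def case_prod_unfold of_real_def intro!: derivative_eq_intros)

lemma has_grad_inverse_power:
  "has_grad (\<lambda>x k lam. of_real (inverse (x $ i) ^ q))
     (\<lambda>j x k lam. if j = i then - of_real (real q * inverse (x $ i) ^ Suc q) else 0) (\<lambda>x k lam. 0)"
  unfolding has_grad_def
proof (intro ballI allI)
  fix x :: "real^'a" and k :: "int^'a" and lam :: real assume "x \<in> pos_orthant"
  then have x: "x $ i \<noteq> 0" by (auto simp: pos_orthant_def dest: spec[of _ i])
  have "((\<lambda>t. inverse t ^ q) has_real_derivative - (real q * inverse (x $ i) ^ Suc q)) (at (x $ i))"
    by (rule DERIV_cong[OF DERIV_power[OF DERIV_inverse[OF x]]]) (cases q; simp add: mult.assoc)
  then have "((\<lambda>(x, lam). inverse (x $ i) ^ q) has_derivative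
      (\<lambda>(v, s). v $ i * - (real q * inverse (x $ i) ^ Suc q))) (at (x, lam :: real))"
    unfolding has_field_derivative_def case_prod_unfold
    using has_derivative_compose[where f = "\<lambda>z. fst z $ i" and f' = "\<lambda>z. fst z $ i" and x = "(x, lam)" and s = UNIV]
      bounded_linear_imp_has_derivative[OF bounded_linear_compose[OF bounded_linear_vec_nth bounded_linear_fst]]
    by (fastforce simp: mult.commute)
  from has_derivative_of_real[OF this, where ?'a = complex]
  have D: "((\<lambda>(x, lam). complex_of_real (inverse (x $ i) ^ q)) has_derivative
      (\<lambda>z. of_real (case z of (v, s) \<Rightarrow> v $ i * - (real q * inverse (x $ i) ^ Suc q)))) (at (x, lam))"
    by (simp only: case_prod_unfold)
  show "((\<lambda>(x, lam). complex_of_real (inverse (x $ i) ^ q)) has_derivative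
        (\<lambda>(v, s). (\<Sum>j\<in>UNIV. v $ j *\<^sub>R (if j = i then - of_real (real q * inverse (x $ i) ^ Suc q) else 0))
          + s *\<^sub>R 0)) (at (x, lam))"
  proof (rule has_derivative_eq_rhs[OF D ext])
    fix z :: "(real^'a) \<times> real"
    have "(\<Sum>j\<in>UNIV. fst z $ j *\<^sub>R (if j = i then - c else 0)) = fst z $ i *\<^sub>R (- c)" for c :: complex
      by (subst sum.remove[of _ i]) (auto intro: sum.neutral)
    then show "complex_of_real (case z of (v, s) \<Rightarrow> v $ i * - (real q * inverse (x $ i) ^ Suc q)) =
        (case z of (v, s) \<Rightarrow> (\<Sum>j\<in>UNIV. v $ j *\<^sub>R
        (if j = i then - of_real (real q * inverse (x $ i) ^ Suc q) else 0)) + s *\<^sub>R 0)"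
      by (simp only: case_prod_unfold of_real_mult of_real_minus scaleR_conv_of_real) simp
  qed
qed

lemma symb_upto_add:
  "symb_upto N f \<Longrightarrow> symb_upto N g \<Longrightarrow> symb_upto N (\<lambda>x k lam. f x k lam + g x k lam)"
proof (induction N arbitrary: f g)
  case (Suc N)
  then show ?case
    by (intro symb_upto_SucI[OF rapid_symb_add has_grad_add[of f "\<lambda>j. dx j f" "dlam f" g "\<lambda>j. dx j g" "dlam g"]])
      auto
qed (simp add: rapid_symb_add)

lemma symb_upto_cmult:
  assumes "symb_upto N g"
  shows "symb_upto N (\<lambda>x k lam. c * g x k lam)"
  using assms
proof (induction N arbitrary: g)
  case 0
  then show ?case
    by (auto intro!: rapid_symb_dominated[of g _ "cmod c" 0] simp: norm_mult)
next
  case (Suc N)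
  have "has_grad (\<lambda>x k lam. c * g x k lam) (\<lambda>j x k lam. c * dx j g x k lam) (\<lambda>x k lam. c * dlam g x k lam)"
    by (rule has_grad_cong[OF has_grad_mult[OF has_grad_const[of "\<lambda>_. c"]]]) (use Suc.prems in auto)
  with Suc show ?case
    by (intro symb_upto_SucI) (auto intro!: rapid_symb_dominated[of g _ "cmod c" 0] simp: norm_mult)
qed

lemma symb_upto_coordinate_mult:
  assumes "symb_upto N g"
  shows "symb_upto N (\<lambda>x k lam. of_real (x $ i) * g x k lam)"
  using assms
proof (induction N arbitrary: g)
  have rapid: "rapid_symb (\<lambda>x k lam. of_real (x $ i) * g x k lam)" if "rapid_symb g" for g :: "'a symb"
    using that
  proof (rule rapid_symb_dominated)
    fix x :: "real^'a" and k lam assume x: "x \<in> pos_orthant"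
    then have "\<bar>x $ i\<bar> \<le> weight x k"
      using component_le_weight(1)[OF x] by (auto simp: pos_orthant_def less_imp_le)
    then show "cmod (of_real (x $ i) * g x k lam) \<le> 1 * weight x k ^ 1 * cmod (g x k lam)"
      by (simp add: norm_mult mult_right_mono)
  qed
  {
    case 0
    then show ?case using rapid by simp
  next
    case (Suc N)
    have "has_grad (\<lambda>x k lam. of_real (x $ i) * g x k lam)
        (\<lambda>j x k lam. of_real (x $ i) * dx j g x k lam + (if j = i then 1 else 0) * g x k lam)
        (\<lambda>x k lam. of_real (x $ i) * dlam g x k lam)"
      by (rule has_grad_cong[OF has_grad_mult[OF has_grad_coordinate]]) (use Suc.prems in auto)
    then show ?case
      using Suc by (intro symb_upto_SucI)
        (auto intro!: rapid symb_upto_add symb_upto_cmult intro: symb_upto_Suc_le simp del: of_real_mult)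
  }
qed

text \<open>
  The factor \<open>lam\<close> is unbounded on the orthant, but at most \<open>x\<^sub>j\<close> in the cone.
\<close>

lemma symb_upto_lam_mult:
  assumes "symb_upto N g"
  shows "symb_upto N (\<lambda>x k lam. of_real lam * g x k lam)"
  using assms
proof (induction N arbitrary: g)
  have rapid: "rapid_symb (\<lambda>x k lam. of_real lam * g x k lam)" if "rapid_symb g" for g :: "'a symb"
    using that
  proof (rule rapid_symb_dominated)
    fix x :: "real^'a" and k and lam :: real
    assume x: "x \<in> pos_orthant" "\<And>j. \<bar>lam\<bar> \<le> x $ j"
    then have "\<bar>lam\<bar> \<le> weight x k"
      using component_le_weight(1)[OF x(1)] order_trans by blast
    then show "cmod (of_real lam * g x k lam) \<le> 1 * weight x k ^ 1 * cmod (g x k lam)"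
      by (simp add: norm_mult mult_right_mono)
  qed
  {
    case 0
    then show ?case using rapid by simp
  next
    case (Suc N)
    have "has_grad (\<lambda>x k lam. of_real lam * g x k lam)
        (\<lambda>j x k lam. of_real lam * dx j g x k lam)
        (\<lambda>x k lam. of_real lam * dlam g x k lam + g x k lam)"
      by (rule has_grad_cong[OF has_grad_mult[OF has_grad_lam]]) (use Suc.prems in auto)
    then show ?case
      using Suc by (intro symb_upto_SucI)
        (auto intro!: rapid symb_upto_add intro: symb_upto_Suc_le)
  }
qed

text \<open>
  The common consequence of the two support hypotheses: for \<open>k \<noteq> 0\<close> the function stays away from the
  boundary of the orthant, and its value at \<open>-k\<close> is determined by parity.
\<close>

definition admissible :: "real \<Rightarrow> 'd::finite symb \<Rightarrow> bool" where
  "admissible r0 g \<longleftrightarrow> (\<forall>x\<in>pos_orthant. \<forall>k lam.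
     g x (- k) lam = (-1) ^ nat (l1 k) * g x k lam \<and>
     (k \<noteq> 0 \<and> (\<exists>j. x $ j < r0) \<longrightarrow> g x k lam = 0))"

lemma admissible_grad:
  assumes adm: "admissible r0 g" and grad: "has_grad g gx gl"
  shows "admissible r0 (gx j)" "admissible r0 gl"
proof -
  have "gx j x (- k) lam = (-1) ^ nat (l1 k) * gx j x k lam \<and> gl x (- k) lam = (-1) ^ nat (l1 k) * gl x k lam"
    if x: "x \<in> pos_orthant" for x k lam
  proof -
    define c :: complex where "c = (-1) ^ nat (l1 k)"
    have "((\<lambda>(x, lam). c * g x k lam) has_derivative
        (\<lambda>(v, s). (\<Sum>j\<in>UNIV. v $ j *\<^sub>R (c * gx j x k lam)) + s *\<^sub>R (c * gl x k lam))) (at (x, lam))"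
      using has_derivative_mult_right[of "\<lambda>(x, lam). g x k lam" _ "at (x, lam)" c] grad x
      by (fastforce simp: has_grad_def case_prod_unfold sum_distrib_left distrib_left)
    then have D: "((\<lambda>(x, lam). g x (- k) lam) has_derivative
        (\<lambda>(v, s). (\<Sum>j\<in>UNIV. v $ j *\<^sub>R (c * gx j x k lam)) + s *\<^sub>R (c * gl x k lam))) (at (x, lam))"
      by (rule has_derivative_transform_within_open[where s = "pos_orthant \<times> UNIV"])
        (use x adm in \<open>auto simp: open_Times open_pos_orthant admissible_def c_def\<close>)
    have "((\<lambda>(x, lam). g x (- k) lam) has_derivative
        (\<lambda>(v, s). (\<Sum>j\<in>UNIV. v $ j *\<^sub>R gx j x (- k) lam) + s *\<^sub>R gl x (- k) lam)) (at (x, lam))"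
      using grad x by (auto simp: has_grad_def)
    from grad_unique_at[OF this D] show ?thesis unfolding c_def by blast
  qed
  moreover have "gx j x k lam = 0 \<and> gl x k lam = 0"
    if x: "x \<in> pos_orthant" "k \<noteq> 0" "x $ i < r0" for x k lam i
  proof -
    have "open {x :: real^'a. x $ i < r0}" by (intro open_Collect_less continuous_intros)
    then have "((\<lambda>(x, lam). g x k lam) has_derivative (\<lambda>_. 0)) (at (x, lam))"
      by (intro has_derivative_transform_within_open[OF has_derivative_const[of 0],
            where s = "(pos_orthant \<inter> {x. x $ i < r0}) \<times> UNIV"])
        (use x adm in \<open>auto simp: open_Times open_Int open_pos_orthant admissible_def\<close>)
    then have D: "((\<lambda>(x, lam). g x k lam) has_derivative
        (\<lambda>(v, s). (\<Sum>j\<in>UNIV. v $ j *\<^sub>R 0) + s *\<^sub>R 0)) (at (x, lam))"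
      by (simp add: case_prod_unfold)
    have "((\<lambda>(x, lam). g x k lam) has_derivative
        (\<lambda>(v, s). (\<Sum>j\<in>UNIV. v $ j *\<^sub>R gx j x k lam) + s *\<^sub>R gl x k lam)) (at (x, lam))"
      using grad x by (auto simp: has_grad_def)
    from grad_unique_at[OF this D] show ?thesis by blast
  qed
  ultimately show "admissible r0 (gx j)" "admissible r0 gl"
    by (auto simp: admissible_def)
qed

text \<open>
  Where the product does not vanish, \<open>b 0 = 0\<close> forces \<open>k \<noteq> 0\<close> and hence \<open>x\<^sub>i \<ge> r0\<close>, so the negative power of
  \<open>x\<^sub>i\<close> is bounded.  The power \<open>q\<close> is general in the induction since differentiation raises it.
\<close>

lemma symb_upto_quotient:
  assumes "0 < r0" and b: "b 0 = 0" "\<And>i. \<bar>b i\<bar> \<le> C * (1 + \<bar>real_of_int i\<bar>) ^ a"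
    and "admissible r0 g" "symb_upto N g"
  shows "symb_upto N (\<lambda>x k lam. of_real (b (k $ i)) * (of_real (inverse (x $ i) ^ q) * g x k lam))"
  using assms(4,5)
proof (induction N arbitrary: g q)
  have rapid: "rapid_symb (\<lambda>x k lam. of_real (b (k $ i)) * (of_real (inverse (x $ i) ^ q) * g x k lam))"
    if "rapid_symb g" and adm: "admissible r0 g" for g :: "'a symb" and q
    using that(1)
  proof (rule rapid_symb_dominated)
    fix x :: "real^'a" and k lam assume x: "x \<in> pos_orthant"
    have w: "1 \<le> weight x k" using component_le_weight(2)[OF x] .
    have C: "0 \<le> C" using b(2)[of 0] b(1) by simp
    have "cmod (of_real (b (k $ i)) * (of_real (inverse (x $ i) ^ q) * g x k lam))
        \<le> (C * weight x k ^ a) * (inverse r0 ^ q * cmod (g x k lam))"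
    proof (cases "b (k $ i) = 0 \<or> g x k lam = 0")
      case True
      then show ?thesis using C w \<open>0 < r0\<close> by auto
    next
      case False
      then have "k \<noteq> 0" using b(1) by auto
      with False adm x have "r0 \<le> x $ i" by (auto simp: admissible_def not_less[symmetric])
      then have "inverse (x $ i) ^ q \<le> inverse r0 ^ q" "0 \<le> inverse (x $ i)"
        using \<open>0 < r0\<close> by (auto intro!: power_mono le_imp_inverse_le)
      moreover have "1 + \<bar>real_of_int (k $ i)\<bar> \<le> weight x k"
      proof -
        have "\<bar>real_of_int (k $ i)\<bar> \<le> real_of_int (l1 k)"
          using component_le_l1[of k i] by linarith
        moreover have "0 \<le> (\<Sum>j\<in>UNIV. x $ j)"
          using x by (auto simp: pos_orthant_def less_imp_le intro!: sum_nonneg)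
        ultimately show ?thesis by (simp add: weight_def)
      qed
      then have "\<bar>b (k $ i)\<bar> \<le> C * weight x k ^ a"
        using b(2)[of "k $ i"] C by (smt (verit) mult_left_mono power_mono abs_ge_zero)
      ultimately show ?thesis
        using C w \<open>0 < r0\<close> by (auto simp: norm_mult norm_power norm_inverse power_inverse intro!: mult_mono)
    qed
    then show "cmod (of_real (b (k $ i)) * (of_real (inverse (x $ i) ^ q) * g x k lam))
        \<le> (C * inverse r0 ^ q) * weight x k ^ a * cmod (g x k lam)"
      by (simp add: mult_ac)
  qed
  {
    case 0
    then show ?case using rapid by simp
  next
    case (Suc N)
    let ?b = "\<lambda>k :: int^'a. complex_of_real (b (k $ i))"
    have adm: "admissible r0 (dx j g)" "admissible r0 (dlam g)" for j
      using Suc.prems admissible_grad by (fastforce simp: symb_upto.simps)+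
    have grad: "has_grad (\<lambda>x k lam. ?b k * (of_real (inverse (x $ i) ^ q) * g x k lam))
        (\<lambda>j x k lam. ?b k * (of_real (inverse (x $ i) ^ q) * dx j g x k lam) +
           (if j = i then - of_real (real q) else 0) * (?b k * (of_real (inverse (x $ i) ^ Suc q) * g x k lam)))
        (\<lambda>x k lam. ?b k * (of_real (inverse (x $ i) ^ q) * dlam g x k lam))"
      by (rule has_grad_cong[OF has_grad_mult[OF has_grad_const has_grad_mult[OF has_grad_inverse_power]]])
        (use Suc.prems in \<open>auto simp: algebra_simps\<close>)
    show ?case
      by (rule symb_upto_SucI[OF _ grad]; (intro symb_upto_add symb_upto_cmult rapid Suc.IH adm)?)
        (use Suc.prems in \<open>auto intro: symb_upto_Suc_le[of N]\<close>)
  }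
qed

section \<open>Remainders on the grid\<close>

lemma has_grad_chain:
  fixes g :: "'d::finite symb"
  assumes "has_grad g gx gl" "y t \<in> pos_orthant"
    and "(y has_vector_derivative v) (at t within T)" "(l has_real_derivative s) (at t within T)"
  shows "((\<lambda>t. g (y t) k (l t)) has_vector_derivative
    (\<Sum>j\<in>UNIV. v $ j *\<^sub>R gx j (y t) k (l t)) + s *\<^sub>R gl (y t) k (l t)) (at t within T)"
proof -
  have "((\<lambda>t. (y t, l t)) has_derivative (\<lambda>h. (h *\<^sub>R v, h * s))) (at t within T)"
    using assms(3,4) unfolding has_vector_derivative_def has_field_derivative_def
    by (auto intro!: has_derivative_Pair simp: mult_commute_abs)
  moreover have "((\<lambda>(x, lam). g x k lam) has_derivative
        (\<lambda>(v, s). (\<Sum>j\<in>UNIV. v $ j *\<^sub>R gx j (y t) k (l t)) + s *\<^sub>R gl (y t) k (l t))) (at (y t, l t))"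
    using assms(1,2) by (auto simp: has_grad_def)
  ultimately have "((\<lambda>t. (\<lambda>(x, lam). g x k lam) (y t, l t)) has_derivative
      (\<lambda>h. (\<lambda>(v, s). (\<Sum>j\<in>UNIV. v $ j *\<^sub>R gx j (y t) k (l t)) + s *\<^sub>R gl (y t) k (l t)) (h *\<^sub>R v, h * s))) (at t within T)"
    by (rule has_derivative_compose)
  then show ?thesis
    by (simp add: has_vector_derivative_def scaleR_add_right scaleR_sum_right)
qed

lemma has_real_derivative_abs:
  fixes t :: real
  assumes "t \<noteq> 0"
  shows "((\<lambda>t. \<bar>t\<bar>) has_real_derivative sgn t) (at t)"
proof (cases "t < 0")
  case True
  have "((\<lambda>t. - t) has_real_derivative sgn t) (at t)"
    using True by (auto intro!: derivative_eq_intros)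
  then show ?thesis
    by (rule has_field_derivative_transform_within_open[where S = "{..<0}"]) (use True in auto)
next
  case False
  have "((\<lambda>t. t) has_real_derivative sgn t) (at t)"
    using False assms by (auto intro!: derivative_eq_intros)
  then show ?thesis
    by (rule has_field_derivative_transform_within_open[where S = "{0<..}"]) (use False assms in auto)
qed

text \<open>
  The generator of dilations: it is what \<open>\<lambda> d/d\<lambda>\<close> becomes on functions of \<open>\<bar>\<lambda>\<bar> \<rho>\<close> and \<open>\<lambda>\<close>.
\<close>

definition euler_symb :: "'d::finite symb \<Rightarrow> 'd symb" where
  "euler_symb g x k lam = (\<Sum>j\<in>UNIV. of_real (x $ j) * dx j g x k lam) + of_real lam * dlam g x k lam"

lemma dilation_derivative:
  fixes g :: "'d::finite symb"
  assumes "has_grad g (\<lambda>j. dx j g) (dlam g)" "\<rho> \<in> pos_orthant" "lam \<noteq> 0"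
  shows "((\<lambda>lam. g (\<bar>lam\<bar> *\<^sub>R \<rho>) k lam) has_vector_derivative
    euler_symb g (\<bar>lam\<bar> *\<^sub>R \<rho>) k lam / of_real lam) (at lam)"
proof -
  have "((\<lambda>lam. \<bar>lam\<bar>) has_real_derivative sgn lam) (at lam)"
    using assms(3) by (rule has_real_derivative_abs)
  from has_vector_derivative_scaleR[OF this has_vector_derivative_const[of \<rho>]]
  have "((\<lambda>lam. \<bar>lam\<bar> *\<^sub>R \<rho>) has_vector_derivative sgn lam *\<^sub>R \<rho>) (at lam)"
    by simp
  from has_grad_chain[OF assms(1) _ this, of "\<lambda>lam. lam" 1 k]
  have "((\<lambda>lam. g (\<bar>lam\<bar> *\<^sub>R \<rho>) k lam) has_vector_derivative
     (\<Sum>j\<in>UNIV. (sgn lam *\<^sub>R \<rho>) $ j *\<^sub>R dx j g (\<bar>lam\<bar> *\<^sub>R \<rho>) k lam) + 1 *\<^sub>R dlam g (\<bar>lam\<bar> *\<^sub>R \<rho>) k lam) (at lam)"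
    using assms(2,3) by (auto simp: pos_orthant_def)
  moreover have "complex_of_real (sgn lam) = of_real \<bar>lam\<bar> / of_real lam"
    using assms(3) by (simp add: sgn_if)
  ultimately show ?thesis
    using assms(3)
    by (simp add: euler_symb_def scaleR_conv_of_real[where 'a = complex] sum_divide_distrib add_divide_distrib
)
qed

lemma symb_upto_sum:
  "(\<And>i. i \<in> I \<Longrightarrow> symb_upto N (g i)) \<Longrightarrow> symb_upto N (\<lambda>x k lam. \<Sum>i\<in>I. g i x k lam)"
proof (induction I rule: infinite_finite_induct)
  have zero: "symb_upto N (\<lambda>x k lam. 0)" for N :: nat
  proof (induction N)
    case (Suc N)
    then show ?case
      by (intro symb_upto_SucI[OF _ has_grad_const]) (auto simp: rapid_symb_def)
  qed (auto simp: rapid_symb_def)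
  {
    case (infinite A)
    then show ?case using zero by simp
  next
    case empty
    then show ?case using zero by simp
  next
    case (insert i I)
    then show ?case by (simp add: symb_upto_add)
  }
qed

lemma symb_upto_euler:
  assumes "symb_upto (Suc N) g"
  shows "symb_upto N (euler_symb g)"
proof -
  have "symb_upto N (\<lambda>x k lam. (\<Sum>j\<in>UNIV. of_real (x $ j) * dx j g x k lam) + of_real lam * dlam g x k lam)"
    using assms by (intro symb_upto_add symb_upto_sum symb_upto_coordinate_mult symb_upto_lam_mult) auto
  then show ?thesis by (simp add: euler_symb_def[abs_def])
qed

text \<open>
  The order \<open>M\<close> is an integer, since derivatives in \<open>lam\<close> of functions of order \<open>0\<close> have negative order.
  For large \<open>lam\<close> the order is immaterial, as \<open>d0_hat\<close> dominates \<open>\<bar>lam\<bar>\<close>.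
\<close>

definition grid_bound :: "int \<Rightarrow> 'd::finite freq_fun \<Rightarrow> bool" where
  "grid_bound M r \<longleftrightarrow> (\<forall>p::nat. \<exists>C. \<forall>n m lam. lam \<noteq> 0 \<longrightarrow>
     (1 + d0_hat n m lam) ^ p * cmod (r n m lam) \<le> C * \<bar>lam\<bar> powi M)"

definition has_euler :: "'d::finite freq_fun \<Rightarrow> 'd freq_fun \<Rightarrow> bool" where
  "has_euler r r' \<longleftrightarrow> (\<forall>n m lam. lam \<noteq> 0 \<longrightarrow>
     (r n m has_vector_derivative r' n m lam / of_real lam) (at lam))"

fun remainder_upto :: "nat \<Rightarrow> int \<Rightarrow> 'd::finite freq_fun \<Rightarrow> bool" where
  "remainder_upto 0 M r = grid_bound M r"
| "remainder_upto (Suc N) M r = (grid_bound M r \<and> (\<exists>r'. has_euler r r' \<and> remainder_upto N M r'))"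

definition remainders :: "int \<Rightarrow> 'd::finite freq_fun set" where
  "remainders M = {r. \<forall>N. remainder_upto N M r}"

lemma size_sum_eq: "real (size_sum n m) + real CARD('d) = (\<Sum>j\<in>UNIV. R_vec n m $ j)"
  for n m :: "nat^'d::finite"
  by (simp add: size_sum_def R_vec_def sum.distrib)

lemma weight_grid: "weight (\<bar>lam\<bar> *\<^sub>R R_vec n m) (diff_vec m n) = 1 + d0_hat n m lam"
  by (simp add: weight_def d0_hat_def size_sum_eq sum_distrib_left)

lemma R_vec_ge_1: "1 \<le> R_vec n m $ j"
  by (simp add: R_vec_def)

lemma grid_in_cone:
  assumes "\<And>j. 1 \<le> \<rho> $ j" "lam \<noteq> 0"
  shows "\<bar>lam\<bar> *\<^sub>R \<rho> \<in> pos_orthant" "\<bar>lam\<bar> \<le> (\<bar>lam\<bar> *\<^sub>R \<rho>) $ j" "\<rho> \<in> pos_orthant"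
proof -
  have "0 < \<rho> $ j" for j using assms(1)[of j] by linarith
  with assms show "\<bar>lam\<bar> *\<^sub>R \<rho> \<in> pos_orthant" "\<rho> \<in> pos_orthant" by (auto simp: pos_orthant_def)
  show "\<bar>lam\<bar> \<le> (\<bar>lam\<bar> *\<^sub>R \<rho>) $ j" using assms(1)[of j] by simp (metis abs_ge_zero mult.right_neutral mult_left_mono)
qed

lemma lam_le_d0_hat: "\<bar>lam\<bar> \<le> d0_hat n m lam" "0 \<le> d0_hat n m lam"
proof -
  have "1 * \<bar>lam\<bar> \<le> (real (size_sum n m) + real CARD('a)) * \<bar>lam\<bar>"
    by (intro mult_right_mono) (auto simp: Suc_leI add_increasing simp flip: of_nat_Suc)
  then show "\<bar>lam\<bar> \<le> d0_hat n m lam" "0 \<le> d0_hat n m lam"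
    using l1_nonneg[of "diff_vec m n"] by (auto simp: d0_hat_def mult.commute)
qed

lemma grid_bound_dominated:
  assumes "grid_bound M f"
    and g: "\<And>n m lam. lam \<noteq> 0 \<Longrightarrow>
      cmod (g n m lam) \<le> C * (1 + d0_hat n m lam) ^ q * \<bar>lam\<bar> powi i * cmod (f n m lam)"
  shows "grid_bound (M + i) g"
  unfolding grid_bound_def
proof
  fix p :: nat
  obtain C' where C': "\<And>n m lam. lam \<noteq> 0 \<Longrightarrow>
      (1 + d0_hat n m lam) ^ (p + q) * cmod (f n m lam) \<le> C' * \<bar>lam\<bar> powi M"
    using assms(1) unfolding grid_bound_def by blast
  have "(1 + d0_hat n m lam) ^ p * cmod (g n m lam) \<le> (\<bar>C\<bar> * C') * \<bar>lam\<bar> powi (M + i)"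
    if lam: "lam \<noteq> 0" for n m lam
  proof -
    let ?w = "1 + d0_hat n m lam"
    have w: "1 \<le> ?w" using lam_le_d0_hat(2)[of n m lam] by simp
    have "cmod (g n m lam) \<le> C * (?w ^ q * \<bar>lam\<bar> powi i * cmod (f n m lam))"
      using g[OF lam, of n m] by (simp add: mult_ac)
    also have "\<dots> \<le> \<bar>C\<bar> * (?w ^ q * \<bar>lam\<bar> powi i * cmod (f n m lam))"
      using w by (intro mult_right_mono) (auto simp: zero_le_power_int)
    finally have "?w ^ p * cmod (g n m lam) \<le> ?w ^ p * (\<bar>C\<bar> * (?w ^ q * \<bar>lam\<bar> powi i * cmod (f n m lam)))"
      using w by (intro mult_left_mono) auto
    also have "\<dots> = \<bar>C\<bar> * \<bar>lam\<bar> powi i * (?w ^ (p + q) * cmod (f n m lam))"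
      by (simp add: power_add mult_ac)
    also have "\<dots> \<le> \<bar>C\<bar> * \<bar>lam\<bar> powi i * (C' * \<bar>lam\<bar> powi M)"
      using C'[OF lam, of n m] by (intro mult_left_mono) (auto simp: zero_le_power_int)
    finally show ?thesis using lam by (simp add: power_int_add mult_ac)
  qed
  then show "\<exists>C. \<forall>n m lam. lam \<noteq> 0 \<longrightarrow>
      (1 + d0_hat n m lam) ^ p * cmod (g n m lam) \<le> C * \<bar>lam\<bar> powi (M + i)" by blast
qed

lemma grid_bound_add:
  assumes "grid_bound M f" "grid_bound M g"
  shows "grid_bound M (\<lambda>n m lam. f n m lam + g n m lam)"
  unfolding grid_bound_def
proof
  fix p :: nat
  obtain C C' where C: "\<And>n m lam. lam \<noteq> 0 \<Longrightarrow>
      (1 + d0_hat n m lam) ^ p * cmod (f n m lam) \<le> C * \<bar>lam\<bar> powi M"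
    and C': "\<And>n m lam. lam \<noteq> 0 \<Longrightarrow>
      (1 + d0_hat n m lam) ^ p * cmod (g n m lam) \<le> C' * \<bar>lam\<bar> powi M"
    using assms unfolding grid_bound_def by meson
  have "(1 + d0_hat n m lam) ^ p * cmod (f n m lam + g n m lam) \<le> (C + C') * \<bar>lam\<bar> powi M"
    if lam: "lam \<noteq> 0" for n m lam
  proof -
    have "(1 + d0_hat n m lam) ^ p * cmod (f n m lam + g n m lam) \<le>
        (1 + d0_hat n m lam) ^ p * (cmod (f n m lam) + cmod (g n m lam))"
      using lam_le_d0_hat(2)[of n m lam] by (intro mult_left_mono norm_triangle_ineq) simp
    then show ?thesis using C[OF lam, of n m] C'[OF lam, of n m] by (simp add: algebra_simps)
  qed
  then show "\<exists>C. \<forall>n m lam. lam \<noteq> 0 \<longrightarrow>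
      (1 + d0_hat n m lam) ^ p * cmod (f n m lam + g n m lam) \<le> C * \<bar>lam\<bar> powi M" by blast
qed

lemma has_euler_cong:
  assumes "has_euler r r'" "\<And>n m lam. lam \<noteq> 0 \<Longrightarrow> r n m lam = s n m lam"
  shows "has_euler s r'"
  unfolding has_euler_def
proof (intro allI impI)
  fix n m :: "nat^'a" and lam :: real assume lam: "lam \<noteq> 0"
  then have "(r n m has_vector_derivative r' n m lam / of_real lam) (at lam)"
    using assms(1) by (auto simp: has_euler_def)
  then show "(s n m has_vector_derivative r' n m lam / of_real lam) (at lam)"
    by (rule has_vector_derivative_transform_within_open[where S = "- {0}"]) (use lam assms(2) in auto)
qed

lemma remainder_upto_cong:
  assumes "\<And>n m lam. lam \<noteq> 0 \<Longrightarrow> r n m lam = s n m lam" "remainder_upto N M r"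
  shows "remainder_upto N M s"
proof -
  have "grid_bound M s" if "grid_bound M r"
    using that assms(1) by (simp add: grid_bound_def)
  with assms has_euler_cong[of r _ s] show ?thesis by (cases N) fastforce+
qed

lemma remainder_upto_bound: "remainder_upto N M r \<Longrightarrow> grid_bound M r"
  by (cases N) auto

lemma remainder_upto_Suc_le: "remainder_upto (Suc N) M r \<Longrightarrow> remainder_upto N M r"
proof (induction N arbitrary: r)
  case (Suc N)
  from Suc.prems obtain r' where "grid_bound M r" "has_euler r r'" "remainder_upto (Suc N) M r'"
    by (auto simp only: remainder_upto.simps(2)[of "Suc N"])
  with Suc.IH show ?case by auto
qed simp

lemma remainders_cong:
  "r \<in> remainders M \<Longrightarrow> (\<And>n m lam. lam \<noteq> 0 \<Longrightarrow> r n m lam = s n m lam) \<Longrightarrow> s \<in> remainders M"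
  using remainder_upto_cong[of r s] by (auto simp: remainders_def)

lemma remainders_euler:
  assumes "r \<in> remainders M"
  obtains r' where "has_euler r r'" "r' \<in> remainders M"
proof -
  have all: "\<exists>r'. has_euler r r' \<and> remainder_upto N M r'" for N
    using assms remainder_upto.simps(2)[of N M r] by (auto simp: remainders_def simp del: remainder_upto.simps)
  then obtain r' where r': "has_euler r r'" by blast
  have "remainder_upto N M r'" for N
  proof -
    obtain s where s: "has_euler r s" "remainder_upto N M s" using all by blast
    have "s n m lam = r' n m lam" if "lam \<noteq> 0" for n m lam
    proof -
      have "s n m lam / of_real lam = r' n m lam / of_real lam"
        using s(1) r' that unfolding has_euler_def by (meson vector_derivative_unique_at)
      then show ?thesis using that by simp
    qed
    from remainder_upto_cong[OF this s(2)] show ?thesis .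
  qed
  with r' show ?thesis by (auto simp: remainders_def intro: that)
qed

lemma has_euler_add:
  "has_euler r r' \<Longrightarrow> has_euler s s' \<Longrightarrow>
    has_euler (\<lambda>n m lam. r n m lam + s n m lam) (\<lambda>n m lam. r' n m lam + s' n m lam)"
  by (auto simp: has_euler_def add_divide_distrib intro: has_vector_derivative_add)

lemma remainder_upto_add:
  "remainder_upto N M r \<Longrightarrow> remainder_upto N M s \<Longrightarrow>
    remainder_upto N M (\<lambda>n m lam. r n m lam + s n m lam)"
proof (induction N arbitrary: r s)
  case (Suc N)
  then show ?case
    by (auto intro: grid_bound_add) (blast intro: has_euler_add)
qed (simp add: grid_bound_add)

lemma remainder_upto_cmult:
  "remainder_upto N M r \<Longrightarrow> remainder_upto N M (\<lambda>n m lam. c * r n m lam)"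
proof (induction N arbitrary: r)
  have bound: "grid_bound M (\<lambda>n m lam. c * r n m lam)" if "grid_bound M r" for r :: "'a freq_fun"
    using grid_bound_dominated[OF that, of _ "cmod c" 0 0] by (simp add: norm_mult)
  {
    case 0
    then show ?case using bound by simp
  next
    case (Suc N)
    then obtain r' where r': "has_euler r r'" "remainder_upto N M r'" by auto
    then have "has_euler (\<lambda>n m lam. c * r n m lam) (\<lambda>n m lam. c * r' n m lam)"
      by (auto simp: has_euler_def intro: has_vector_derivative_mult_right simp flip: times_divide_eq_right)
    with Suc r' bound show ?case by auto
  }
qed

text \<open>
  Shifts and multiplications by functions of \<open>(n,m)\<close> commute with \<open>\<lambda> d/d\<lambda>\<close>, so only the size matters.  The
  bounds on \<open>d0_hat\<close> are needed only where the coefficient does not vanish; this takes care of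
  truncated subtraction.
\<close>

lemma remainder_upto_reindex:
  fixes c :: "nat^'d::finite \<Rightarrow> nat^'d \<Rightarrow> real" and s t :: "nat^'d \<Rightarrow> nat^'d \<Rightarrow> nat^'d"
  assumes c: "\<And>n m lam. c n m \<noteq> 0 \<Longrightarrow> \<bar>c n m\<bar> * \<bar>lam\<bar> \<le> C * (1 + d0_hat n m lam)"
    and K: "\<And>n m lam. c n m \<noteq> 0 \<Longrightarrow> 1 + d0_hat n m lam \<le> K * (1 + d0_hat (s n m) (t n m) lam)"
  shows "remainder_upto N M r \<Longrightarrow>
    remainder_upto N (M - 1) (\<lambda>n m lam. of_real (c n m) * r (s n m) (t n m) lam)"
proof (induction N arbitrary: r)
  have bound: "grid_bound (M - 1) (\<lambda>n m lam. of_real (c n m) * r (s n m) (t n m) lam)"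
    if r: "grid_bound M r" for r :: "'d freq_fun"
    unfolding grid_bound_def
  proof
    fix p :: nat
    obtain C' where C': "\<And>n m lam. lam \<noteq> 0 \<Longrightarrow>
        (1 + d0_hat n m lam) ^ Suc p * cmod (r n m lam) \<le> C' * \<bar>lam\<bar> powi M"
      using r unfolding grid_bound_def by blast
    have "0 \<le> (1 + d0_hat (0 :: nat^'d) 0 1) ^ Suc p * cmod (r 0 0 1)"
      using lam_le_d0_hat(2)[of "0 :: nat^'d" 0 1] by (intro mult_nonneg_nonneg zero_le_power) auto
    also have "\<dots> \<le> C'" using C'[of 1 0 0] by simp
    finally have C'0: "0 \<le> C'" .
    have "(1 + d0_hat n m lam) ^ p * cmod (of_real (c n m) * r (s n m) (t n m) lam) \<le>
        (\<bar>C\<bar> * \<bar>K\<bar> ^ Suc p * C') * \<bar>lam\<bar> powi (M - 1)" if lam: "lam \<noteq> 0" for n m lam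
    proof (cases "c n m = 0")
      case False
      let ?w = "1 + d0_hat n m lam" and ?w' = "1 + d0_hat (s n m) (t n m) lam"
      let ?r = "cmod (r (s n m) (t n m) lam)"
      have w: "1 \<le> ?w" "1 \<le> ?w'"
        using lam_le_d0_hat(2)[of n m lam] lam_le_d0_hat(2)[of "s n m" "t n m" lam] by auto
      have "\<bar>c n m\<bar> * \<bar>lam\<bar> \<le> \<bar>C\<bar> * ?w"
        using c[OF False, of lam] w by (smt (verit) mult_right_mono)
      then have "\<bar>lam\<bar> * (?w ^ p * (\<bar>c n m\<bar> * ?r)) \<le> ?w ^ p * ?r * (\<bar>C\<bar> * ?w)"
        using w mult_left_mono[of "\<bar>c n m\<bar> * \<bar>lam\<bar>" "\<bar>C\<bar> * ?w" "?w ^ p * ?r"] by (simp add: mult_ac)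
      also have "\<dots> = \<bar>C\<bar> * (?w ^ Suc p * ?r)" by (simp add: mult_ac)
      also have "\<dots> \<le> \<bar>C\<bar> * ((\<bar>K\<bar> * ?w') ^ Suc p * ?r)"
      proof -
        have "?w \<le> \<bar>K\<bar> * ?w'" using K[OF False, of lam] w by (smt (verit) mult_right_mono)
        then show ?thesis using w by (intro mult_left_mono mult_right_mono power_mono) auto
      qed
      also have "\<dots> = \<bar>C\<bar> * \<bar>K\<bar> ^ Suc p * (?w' ^ Suc p * ?r)"
        by (simp add: power_mult_distrib mult_ac)
      also have "\<dots> \<le> \<bar>C\<bar> * \<bar>K\<bar> ^ Suc p * (C' * \<bar>lam\<bar> powi M)"
        by (intro mult_left_mono C' lam) auto
      finally show ?thesis
        using lam by (simp add: power_int_diff norm_mult field_simps)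
    qed (use C'0 in \<open>simp add: zero_le_power_int\<close>)
    then show "\<exists>C. \<forall>n m lam. lam \<noteq> 0 \<longrightarrow>
      (1 + d0_hat n m lam) ^ p * cmod (of_real (c n m) * r (s n m) (t n m) lam) \<le> C * \<bar>lam\<bar> powi (M - 1)" by blast
  qed
  {
    case 0
    then show ?case using bound by simp
  next
    case (Suc N)
    then obtain r' where r': "has_euler r r'" "remainder_upto N M r'" by auto
    then have "has_euler (\<lambda>n m lam. of_real (c n m) * r (s n m) (t n m) lam)
        (\<lambda>n m lam. of_real (c n m) * r' (s n m) (t n m) lam)"
      by (auto simp: has_euler_def intro: has_vector_derivative_mult_right simp flip: times_divide_eq_right)
    with Suc r' bound show ?case by auto
  }
qed

text \<open>
  A factor homogeneous of degree \<open>i\<close> in \<open>lam\<close> is an eigenfunction of \<open>\<lambda> d/d\<lambda>\<close>, so it shifts the order by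
  exactly \<open>i\<close>.
\<close>

lemma remainder_upto_homogeneous:
  assumes u: "\<And>lam. lam \<noteq> 0 \<Longrightarrow> (u has_real_derivative of_int i * u lam / lam) (at lam)"
    and abs: "\<And>lam. lam \<noteq> 0 \<Longrightarrow> \<bar>u lam\<bar> = \<bar>lam\<bar> powi i"
  shows "remainder_upto N M r \<Longrightarrow> remainder_upto N (M + i) (\<lambda>n m lam. of_real (u lam) * r n m lam)"
proof (induction N arbitrary: r)
  have bound: "grid_bound (M + i) (\<lambda>n m lam. of_real (u lam) * r n m lam)" if "grid_bound M r" for r :: "'a freq_fun"
    using that by (rule grid_bound_dominated[where C = 1 and q = 0]) (simp add: norm_mult abs)
  {
    case 0
    then show ?case using bound by simp
  next
    case (Suc N)
    then obtain r' where r': "has_euler r r'" "remainder_upto N M r'" by auto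
    have "((\<lambda>lam. of_real (u lam) * r n m lam) has_vector_derivative
        (of_real (u lam) * (of_int i * r n m lam + r' n m lam)) / of_real lam) (at lam)"
      if lam: "lam \<noteq> 0" for n m lam
    proof -
      have "((\<lambda>lam. u lam *\<^sub>R r n m lam) has_vector_derivative
          (u lam *\<^sub>R (r' n m lam / of_real lam) + (of_int i * u lam / lam) *\<^sub>R r n m lam)) (at lam)"
        using r'(1) lam by (intro has_vector_derivative_scaleR u) (auto simp: has_euler_def)
      then show ?thesis using lam by (simp add: scaleR_conv_of_real field_simps)
    qed
    then have "has_euler (\<lambda>n m lam. of_real (u lam) * r n m lam)
        (\<lambda>n m lam. of_real (u lam) * (of_int i * r n m lam + r' n m lam))"
      by (auto simp: has_euler_def)
    moreover have "remainder_upto N (M + i) (\<lambda>n m lam. of_real (u lam) * (of_int i * r n m lam + r' n m lam))"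
      using remainder_upto_Suc_le[OF Suc.prems] r'
      by (intro Suc.IH remainder_upto_add remainder_upto_cmult)
    ultimately show ?case using bound Suc.prems by auto
  }
qed

text \<open>
  This is where \<open>\<bar>lam\<bar> \<le> d0_hat\<close> is used: surplus powers of \<open>\<bar>lam\<bar>\<close> are absorbed into the decay.
\<close>

lemma remainder_upto_mono:
  assumes "M' \<le> M"
  shows "remainder_upto N M r \<Longrightarrow> remainder_upto N M' r"
proof (induction N arbitrary: r)
  have bound: "grid_bound M' r" if "grid_bound M r" for r :: "'a freq_fun"
  proof -
    have "cmod (r n m lam) \<le> 1 * (1 + d0_hat n m lam) ^ nat (M - M') * \<bar>lam\<bar> powi (M' - M) * cmod (r n m lam)"
      if lam: "lam \<noteq> 0" for n m lam
    proof -
      have "\<bar>lam\<bar> ^ nat (M - M') \<le> (1 + d0_hat n m lam) ^ nat (M - M')"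
        using lam_le_d0_hat(1)[of lam n m] by (intro power_mono) auto
      then have "1 \<le> (1 + d0_hat n m lam) ^ nat (M - M') * \<bar>lam\<bar> powi (M' - M)"
        using lam assms by (cases "M' = M") (auto simp: power_int_def field_simps)
      from mult_right_mono[OF this, of "cmod (r n m lam)"] show ?thesis by simp
    qed
    from grid_bound_dominated[OF that this] show ?thesis by simp
  qed
  {
    case 0
    then show ?case using bound by simp
  next
    case (Suc N)
    then show ?case using bound by auto
  }
qed

lemma Theta_remainder_upto: "symb_upto N g \<Longrightarrow> remainder_upto N 0 (Theta g)"
proof (induction N arbitrary: g)
  have bound: "grid_bound 0 (Theta g)" if g: "rapid_symb g" for g :: "'a symb"
    unfolding grid_bound_def
  proof
    fix p :: nat
    obtain C where C: "\<And>x k lam. x \<in> pos_orthant \<Longrightarrow> (\<And>j. \<bar>lam\<bar> \<le> x $ j) \<Longrightarrow>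
        weight x k ^ p * cmod (g x k lam) \<le> C"
      using g unfolding rapid_symb_def by blast
    have "(1 + d0_hat n m lam) ^ p * cmod (Theta g n m lam) \<le> C" if "lam \<noteq> 0" for n m lam
      using C[OF grid_in_cone(1,2)[OF R_vec_ge_1 that], of n m "diff_vec m n"]
      by (simp add: Theta_def weight_grid)
    then show "\<exists>C. \<forall>n m lam. lam \<noteq> 0 \<longrightarrow>
        (1 + d0_hat n m lam) ^ p * cmod (Theta g n m lam) \<le> C * \<bar>lam\<bar> powi 0" by auto
  qed
  {
    case 0
    then show ?case using bound by simp
  next
    case (Suc N)
    have "has_euler (Theta g) (Theta (euler_symb g))"
      unfolding has_euler_def Theta_def[abs_def]
      using Suc.prems grid_in_cone(3)[OF R_vec_ge_1] by (auto intro!: dilation_derivative)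
    with Suc bound symb_upto_euler[OF Suc.prems] show ?case by auto
  }
qed

lemma Theta_in_remainders: "(\<And>N. symb_upto N g) \<Longrightarrow> Theta g \<in> remainders 0"
  by (simp add: remainders_def Theta_remainder_upto)

lemma remainders_mono: "r \<in> remainders M \<Longrightarrow> M' \<le> M \<Longrightarrow> r \<in> remainders M'"
  using remainder_upto_mono[of M' M] by (auto simp: remainders_def)

lemma remainders_add:
  "r \<in> remainders M \<Longrightarrow> s \<in> remainders M \<Longrightarrow> (\<lambda>n m lam. r n m lam + s n m lam) \<in> remainders M"
  by (simp add: remainders_def remainder_upto_add)

lemma remainders_cmult:
  "r \<in> remainders M \<Longrightarrow> (\<lambda>n m lam. c * r n m lam) \<in> remainders M"
  by (simp add: remainders_def remainder_upto_cmult)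

lemma remainders_diff:
  "r \<in> remainders M \<Longrightarrow> s \<in> remainders M \<Longrightarrow> (\<lambda>n m lam. r n m lam - s n m lam) \<in> remainders M"
  using remainders_add[of r M "\<lambda>n m lam. (-1) * s n m lam"] remainders_cmult[of s M "-1"] by simp

lemma remainders_sum:
  fixes r :: "'a \<Rightarrow> 'b::finite freq_fun"
  shows "(\<And>i. i \<in> I \<Longrightarrow> r i \<in> remainders M) \<Longrightarrow> (\<lambda>n m lam. \<Sum>i\<in>I. r i n m lam) \<in> remainders M"
proof (induction I rule: infinite_finite_induct)
  have "remainder_upto N M ((\<lambda>n m lam. 0) :: 'b freq_fun)" for N
  proof (induction N)
    case (Suc N)
    moreover have "has_euler ((\<lambda>n m lam. 0) :: 'b freq_fun) (\<lambda>n m lam. 0)" by (simp add: has_euler_def)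
    ultimately show ?case using remainder_upto_bound by auto
  qed (auto simp: grid_bound_def intro!: exI[of _ 0])
  then have zero: "((\<lambda>n m lam. 0) :: 'b freq_fun) \<in> remainders M" by (simp add: remainders_def)
  {
    case (infinite A)
    then show ?case using zero by simp
  next
    case empty
    then show ?case using zero by simp
  next
    case (insert i I)
    then show ?case by (simp add: remainders_add)
  }
qed

lemma remainders_homogeneous:
  assumes "r \<in> remainders M"
    and "\<And>lam. lam \<noteq> 0 \<Longrightarrow> (u has_real_derivative of_int i * u lam / lam) (at lam)"
    and "\<And>lam. lam \<noteq> 0 \<Longrightarrow> \<bar>u lam\<bar> = \<bar>lam\<bar> powi i"
  shows "(\<lambda>n m lam. of_real (u lam) * r n m lam) \<in> remainders (M + i)"
  using assms(1) remainder_upto_homogeneous[OF assms(2,3)] unfolding remainders_def by blast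

lemma remainders_abs_power:
  assumes "r \<in> remainders M"
  shows "(\<lambda>n m lam. of_real (\<bar>lam\<bar> ^ i) * r n m lam) \<in> remainders (M + int i)"
proof (rule remainders_homogeneous[OF assms])
  show "((\<lambda>lam. \<bar>lam\<bar> ^ i) has_real_derivative of_int (int i) * \<bar>lam\<bar> ^ i / lam) (at lam)" if "lam \<noteq> 0" for lam :: real
    by (rule DERIV_cong[OF DERIV_power[OF has_real_derivative_abs[OF that], of i]])
      (use that in \<open>cases i; auto simp: sgn_if\<close>)
qed (simp add: power_abs)

lemma remainders_divide_lam:
  assumes "r \<in> remainders M"
  shows "(\<lambda>n m lam. of_real (1 / lam) * r n m lam) \<in> remainders (M - 1)"
    "(\<lambda>n m lam. of_real (1 / \<bar>lam\<bar>) * r n m lam) \<in> remainders (M - 1)"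
proof -
  have "((\<lambda>lam. 1 / lam) has_real_derivative of_int (- 1) * (1 / lam) / lam) (at lam)" if "lam \<noteq> 0" for lam :: real
    using that by (auto intro!: derivative_eq_intros simp: divide_simps)
  from remainders_homogeneous[OF assms this]
  show "(\<lambda>n m lam. of_real (1 / lam) * r n m lam) \<in> remainders (M - 1)"
    by (simp add: power_int_minus divide_inverse)
  have "((\<lambda>lam. 1 / \<bar>lam\<bar>) has_real_derivative of_int (- 1) * (1 / \<bar>lam\<bar>) / lam) (at lam)" if "lam \<noteq> 0" for lam :: real
    unfolding divide_inverse mult_1
    by (rule DERIV_cong[OF DERIV_inverse_fun[OF has_real_derivative_abs[OF that]]])
      (use that in \<open>auto simp: sgn_if field_simps\<close>)
  from remainders_homogeneous[OF assms this]
  show "(\<lambda>n m lam. of_real (1 / \<bar>lam\<bar>) * r n m lam) \<in> remainders (M - 1)"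
    by (simp add: power_int_minus divide_inverse)
qed

section \<open>Binomial expansion of the shift coefficients\<close>

lemma abs_gbinomial_half_le: "\<bar>(1/2 :: real) gchoose n\<bar> \<le> 1"
proof (induction n)
  case (Suc n)
  have "\<bar>((1/2 :: real) - real n) / (real n + 1)\<bar> \<le> 1"
    by (simp add: field_simps abs_le_iff)
  moreover have "(1/2 :: real) gchoose Suc n = ((1/2) gchoose n) * ((1/2 - real n) / (real n + 1))"
    by (simp add: gbinomial_rec gbinomial_mult_1 gbinomial_absorb_comp field_simps gbinomial_prod_rev)
  ultimately show ?case
    using Suc mult_mono[OF Suc, of "\<bar>(1/2 - real n) / (real n + 1)\<bar>" 1] by (simp add: abs_mult)
qed simp

text \<open>
  For \<open>\<bar>a\<bar> \<le> 1/2\<close> the tail of the binomial series is at most a geometric series.  For larger \<open>\<bar>a\<bar>\<close> the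
  left-hand side is at most \<open>2 + Q\<close>, and \<open>(2\<bar>a\<bar>)\<^sup>Q \<ge> 1\<close>.
\<close>

lemma sqrt_binomial_remainder:
  obtains C :: real where "0 \<le> C"
    "\<And>a. \<bar>a\<bar> \<le> 1 \<Longrightarrow> \<bar>sqrt (1 + a) - (\<Sum>i<Q. ((1/2) gchoose i) * a ^ i)\<bar> \<le> C * \<bar>a\<bar> ^ Q"
proof
  define C where "C = (2 + real Q) * 2 ^ Q"
  show "0 \<le> C" by (simp add: C_def)
  fix a :: real assume a: "\<bar>a\<bar> \<le> 1"
  let ?b = "\<lambda>i. ((1/2 :: real) gchoose i)"
  show "\<bar>sqrt (1 + a) - (\<Sum>i<Q. ?b i * a ^ i)\<bar> \<le> C * \<bar>a\<bar> ^ Q"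
  proof (cases "\<bar>a\<bar> \<le> 1/2")
    case True
    have "(\<lambda>i. ?b i * a ^ i) sums sqrt (1 + a)"
      using gen_binomial_real[of a "1/2"] True a by (simp add: powr_half_sqrt)
    from sums_split_initial_segment[OF this, of Q]
    have s: "(\<lambda>i. ?b (i + Q) * a ^ (i + Q)) sums (sqrt (1 + a) - (\<Sum>i<Q. ?b i * a ^ i))" by simp
    have g: "(\<lambda>i. \<bar>a\<bar> ^ Q * (1/2) ^ i) sums (\<bar>a\<bar> ^ Q * 2)"
      using geometric_sums[of "1/2 :: real"] by (intro sums_mult) simp
    have le: "norm (?b (i + Q) * a ^ (i + Q)) \<le> \<bar>a\<bar> ^ Q * (1/2) ^ i" for i
    proof -
      have "\<bar>?b (i + Q)\<bar> * (\<bar>a\<bar> ^ i * \<bar>a\<bar> ^ Q) \<le> 1 * ((1/2) ^ i * \<bar>a\<bar> ^ Q)"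
        using True abs_gbinomial_half_le by (intro mult_mono power_mono) auto
      then show ?thesis by (simp add: abs_mult power_abs power_add mult_ac)
    qed
    have "norm (\<Sum>i. ?b (i + Q) * a ^ (i + Q)) \<le> (\<Sum>i. \<bar>a\<bar> ^ Q * (1/2) ^ i)"
      using le sums_summable[OF g] by (rule norm_suminf_le)
    then have "\<bar>sqrt (1 + a) - (\<Sum>i<Q. ?b i * a ^ i)\<bar> \<le> 2 * \<bar>a\<bar> ^ Q"
      using sums_unique[OF s] sums_unique[OF g] by simp
    also have "\<dots> \<le> C * \<bar>a\<bar> ^ Q"
    proof (rule mult_right_mono)
      have "2 * 1 \<le> (2 + real Q) * 2 ^ Q" by (intro mult_mono) auto
      then show "2 \<le> C" by (simp add: C_def)
    qed simp
    finally show ?thesis .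
  next
    case False
    have "sqrt (1 + a) \<le> 2" using a by (intro real_le_lsqrt) auto
    moreover have "0 \<le> sqrt (1 + a)" using a by simp
    moreover have "\<bar>\<Sum>i<Q. ?b i * a ^ i\<bar> \<le> (\<Sum>i<Q. 1)"
      using a abs_gbinomial_half_le
      by (intro order_trans[OF sum_abs sum_mono]) (auto simp: abs_mult power_abs intro!: mult_le_one power_le_one)
    ultimately have "\<bar>sqrt (1 + a) - (\<Sum>i<Q. ?b i * a ^ i)\<bar> \<le> 2 + real Q"
      by (simp only: sum_constant card_lessThan)
    also have "\<dots> \<le> (2 + real Q) * (2 * \<bar>a\<bar>) ^ Q"
    proof -
      have "1 \<le> (2 * \<bar>a\<bar>) ^ Q" using False by (intro one_le_power) auto
      from mult_left_mono[OF this, of "2 + real Q"] show ?thesis by simp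
    qed
    also have "\<dots> = C * \<bar>a\<bar> ^ Q" by (simp add: C_def power_mult_distrib)
    finally show ?thesis .
  qed
qed

text \<open>
  The coefficient of \<open>u\<^sup>q\<close> in the power series of \<open>\<surd>((1 + u)\<^sup>2 - (k u)\<^sup>2) = \<surd>(1 + (1-k)u) \<surd>(1 + (1+k)u)\<close>.
\<close>

definition hop_coeff :: "nat \<Rightarrow> int \<Rightarrow> real" where
  "hop_coeff q k = (\<Sum>i\<le>q. ((1/2) gchoose i) * ((1/2) gchoose (q - i)) *
     (1 - real_of_int k) ^ i * (1 + real_of_int k) ^ (q - i))"

lemma hop_coeff_0: "hop_coeff 0 k = 1" and hop_coeff_1: "hop_coeff (Suc 0) k = 1"
  by (simp_all add: hop_coeff_def field_simps)

text \<open>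
  For \<open>k = 0\<close> the square root is \<open>1 + u\<close>; on coefficients this is the Vandermonde identity.
\<close>

lemma hop_coeff_zero:
  assumes "2 \<le> q"
  shows "hop_coeff q 0 = 0"
proof -
  have "hop_coeff q 0 = (1/2 + 1/2 :: real) gchoose q"
    unfolding gbinomial_Vandermonde[symmetric] by (simp add: hop_coeff_def atMost_atLeast0)
  also have "\<dots> = real (1 choose q)" by (simp add: binomial_gbinomial)
  finally show ?thesis using assms by simp
qed

lemma hop_coeff_uminus: "hop_coeff q (- k) = hop_coeff q k"
  unfolding hop_coeff_def
  by (rule sum.reindex_bij_witness[of _ "\<lambda>i. q - i" "\<lambda>i. q - i"]) (auto simp: mult_ac)

lemma abs_hop_coeff_le: "\<bar>hop_coeff q k\<bar> \<le> real (Suc q) * (1 + \<bar>real_of_int k\<bar>) ^ q"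
proof -
  have "\<bar>hop_coeff q k\<bar> \<le> (\<Sum>i\<le>q. (1 + \<bar>real_of_int k\<bar>) ^ q)"
    unfolding hop_coeff_def
  proof (intro order_trans[OF sum_abs sum_mono])
    fix i assume i: "i \<in> {..q}"
    have "\<bar>(1/2 :: real) gchoose i\<bar> * \<bar>(1/2 :: real) gchoose (q - i)\<bar> *
        \<bar>1 - real_of_int k\<bar> ^ i * \<bar>1 + real_of_int k\<bar> ^ (q - i) \<le>
        1 * 1 * (1 + \<bar>real_of_int k\<bar>) ^ i * (1 + \<bar>real_of_int k\<bar>) ^ (q - i)"
      using abs_gbinomial_half_le by (intro mult_mono power_mono) auto
    then show "\<bar>((1/2) gchoose i) * ((1/2) gchoose (q - i)) *
        (1 - real_of_int k) ^ i * (1 + real_of_int k) ^ (q - i)\<bar> \<le> (1 + \<bar>real_of_int k\<bar>) ^ q"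
      using i by (simp add: abs_mult power_abs flip: power_add)
  qed
  then show ?thesis by simp
qed

text \<open>
  With \<open>v = u (1 + \<bar>k\<bar>)\<close>, both factors have the form \<open>\<surd>(1 + a)\<close> with \<open>\<bar>a\<bar> \<le> v \<le> 1\<close>.  The product of the two
  truncated series is a sum over a square of indices \<open>(i,l)\<close>; the part with \<open>i + l < Q\<close> is the
  expansion, and each of the other terms is at most \<open>v\<^sup>Q\<close>.
\<close>

lemma sqrt_product_remainder:
  obtains C :: real where "0 \<le> C"
    "\<And>u k \<sigma>. \<bar>\<sigma>\<bar> = 1 \<Longrightarrow> 0 \<le> u \<Longrightarrow> u * (1 + \<bar>real_of_int k\<bar>) \<le> 1 \<Longrightarrow>
      \<bar>sqrt ((1 + \<sigma> * u)\<^sup>2 - (real_of_int k * u)\<^sup>2) - (\<Sum>q<Q. hop_coeff q k * (\<sigma> * u) ^ q)\<bar>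
        \<le> C * (u * (1 + \<bar>real_of_int k\<bar>)) ^ Q"
proof -
  obtain C where C: "0 \<le> C" "\<And>a. \<bar>a\<bar> \<le> 1 \<Longrightarrow>
      \<bar>sqrt (1 + a) - (\<Sum>i<Q. ((1/2) gchoose i) * a ^ i)\<bar> \<le> C * \<bar>a\<bar> ^ Q"
    by (rule sqrt_binomial_remainder) blast
  let ?b = "\<lambda>i. ((1/2 :: real) gchoose i)"
  have main: "\<bar>sqrt ((1 + \<sigma> * u)\<^sup>2 - (real_of_int k * u)\<^sup>2) - (\<Sum>q<Q. hop_coeff q k * (\<sigma> * u) ^ q)\<bar>
        \<le> (C * 2 + real Q * C + real Q * real Q) * (u * (1 + \<bar>real_of_int k\<bar>)) ^ Q"
    if \<sigma>: "\<bar>\<sigma>\<bar> = 1" and u: "0 \<le> u" and le1: "u * (1 + \<bar>real_of_int k\<bar>) \<le> 1" for u k \<sigma>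
  proof -
    define v where "v = u * (1 + \<bar>real_of_int k\<bar>)"
    define a where "a = \<sigma> * u * (1 - real_of_int k)"
    define b where "b = \<sigma> * u * (1 + real_of_int k)"
    have v: "0 \<le> v" "v \<le> 1" using u le1 by (auto simp: v_def)
    have ab: "\<bar>a\<bar> \<le> v" "\<bar>b\<bar> \<le> v"
      using u \<sigma> by (auto simp: a_def b_def v_def abs_mult intro!: mult_left_mono)
    have \<sigma>2: "\<sigma> * \<sigma> = 1" using \<sigma> by (metis abs_mult_self_eq mult_1)
    define S where "S x = sqrt (1 + x)" for x :: real
    define T where "T x = (\<Sum>i<Q. ?b i * x ^ i)" for x :: real
    have "(1 + \<sigma> * u)\<^sup>2 - (real_of_int k * u)\<^sup>2 = (1 + \<sigma> * u)\<^sup>2 - (\<sigma> * \<sigma>) * (real_of_int k * u)\<^sup>2"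
      by (simp add: \<sigma>2)
    also have "\<dots> = (1 + a) * (1 + b)"
      by (simp add: a_def b_def power2_eq_square algebra_simps)
    finally have sq: "sqrt ((1 + \<sigma> * u)\<^sup>2 - (real_of_int k * u)\<^sup>2) = S a * S b"
      by (simp add: real_sqrt_mult S_def)
    have ST: "\<bar>S x - T x\<bar> \<le> C * v ^ Q" if "\<bar>x\<bar> \<le> v" for x
    proof -
      have "\<bar>S x - T x\<bar> \<le> C * \<bar>x\<bar> ^ Q" using C(2)[of x] that v by (simp add: S_def T_def)
      also have "\<dots> \<le> C * v ^ Q" using that C(1) by (intro mult_left_mono power_mono) auto
      finally show ?thesis .
    qed
    have S2: "\<bar>S b\<bar> \<le> 2"
      using ab v unfolding S_def by (auto intro!: real_le_lsqrt)
    have term_le: "\<bar>?b i * x ^ i\<bar> \<le> v ^ i" if "\<bar>x\<bar> \<le> v" for i x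
    proof -
      have "\<bar>?b i\<bar> * \<bar>x\<bar> ^ i \<le> 1 * v ^ i"
        using abs_gbinomial_half_le that by (intro mult_mono power_mono) auto
      then show ?thesis by (simp add: abs_mult power_abs)
    qed
    have TQ: "\<bar>T a\<bar> \<le> real Q"
    proof -
      have "\<bar>T a\<bar> \<le> (\<Sum>i<Q. 1)" unfolding T_def
        using v by (intro order_trans[OF sum_abs sum_mono] order_trans[OF term_le[OF ab(1)]]) (auto intro: power_le_one)
      then show ?thesis by simp
    qed
    have 1: "\<bar>S a * S b - T a * T b\<bar> \<le> (C * 2 + real Q * C) * v ^ Q"
    proof -
      have "S a * S b - T a * T b = (S a - T a) * S b + T a * (S b - T b)" by (simp add: algebra_simps)
      also have "\<bar>\<dots>\<bar> \<le> \<bar>S a - T a\<bar> * \<bar>S b\<bar> + \<bar>T a\<bar> * \<bar>S b - T b\<bar>"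
        by (metis abs_mult abs_triangle_ineq)
      also have "\<dots> \<le> (C * v ^ Q) * 2 + real Q * (C * v ^ Q)"
        using ST ab S2 TQ C(1) v by (intro add_mono mult_mono) auto
      finally show ?thesis by (simp add: algebra_simps)
    qed
    define F where "F = (\<lambda>(i, l). (?b i * a ^ i) * (?b l * b ^ l))"
    define tri where "tri = {(i, l). i + l < Q}"
    have sub: "tri \<subseteq> {..<Q} \<times> {..<Q}" by (auto simp: tri_def)
    have prod: "T a * T b = sum F ({..<Q} \<times> {..<Q})"
      by (simp add: T_def sum_product sum.cartesian_product F_def)
    have "sum F tri = (\<Sum>q<Q. \<Sum>i\<le>q. (?b i * a ^ i) * (?b (q - i) * b ^ (q - i)))"
      unfolding F_def tri_def by (rule sum.triangle_reindex)
    also have "\<dots> = (\<Sum>q<Q. hop_coeff q k * (\<sigma> * u) ^ q)"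
    proof (intro sum.cong refl)
      fix q
      have "(?b i * a ^ i) * (?b (q - i) * b ^ (q - i)) =
          (?b i * ?b (q - i) * (1 - real_of_int k) ^ i * (1 + real_of_int k) ^ (q - i)) * (\<sigma> * u) ^ q"
        if "i \<in> {..q}" for i
      proof -
        have "(\<sigma> * u) ^ q = (\<sigma> * u) ^ i * (\<sigma> * u) ^ (q - i)"
          using that by (simp flip: power_add)
        then show ?thesis by (simp add: a_def b_def power_mult_distrib mult_ac)
      qed
      then show "(\<Sum>i\<le>q. (?b i * a ^ i) * (?b (q - i) * b ^ (q - i))) = hop_coeff q k * (\<sigma> * u) ^ q"
        unfolding hop_coeff_def sum_distrib_right by (rule sum.cong[OF refl])
    qed
    finally have tri: "sum F tri = (\<Sum>q<Q. hop_coeff q k * (\<sigma> * u) ^ q)" .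
    have "T a * T b - sum F tri = sum F ({..<Q} \<times> {..<Q} - tri)"
      unfolding prod using sum.subset_diff[OF sub, of F] by simp
    also have "\<bar>\<dots>\<bar> \<le> (\<Sum>z\<in>{..<Q} \<times> {..<Q} - tri. v ^ Q)"
    proof (intro order_trans[OF sum_abs sum_mono])
      fix z assume z: "z \<in> {..<Q} \<times> {..<Q} - tri"
      then obtain i l where il: "z = (i, l)" "Q \<le> i + l" by (cases z) (auto simp: tri_def)
      have "\<bar>F z\<bar> \<le> v ^ i * v ^ l"
        unfolding il F_def prod.case abs_mult using term_le[OF ab(1), of i] term_le[OF ab(2), of l] v
        by (intro mult_mono) (auto simp: abs_mult)
      also have "\<dots> \<le> v ^ Q" unfolding power_add[symmetric] using v il by (intro power_decreasing) auto
      finally show "\<bar>F z\<bar> \<le> v ^ Q" .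
    qed
    also have "\<dots> \<le> real Q * real Q * v ^ Q"
    proof -
      have "card ({..<Q} \<times> {..<Q} - tri) \<le> card ({..<Q} \<times> {..<Q})" by (intro card_mono) auto
      then have "real (card ({..<Q} \<times> {..<Q} - tri)) \<le> real Q * real Q"
        by (simp add: card_cartesian_product flip: of_nat_mult)
      then show ?thesis using v by (simp add: mult_right_mono)
    qed
    finally show ?thesis
      using 1 unfolding sq tri v_def[symmetric] by (simp add: algebra_simps)
  qed
  show thesis
    by (rule that[OF _ main]) (use C(1) in auto)
qed

section \<open>Admissible symbols and Taylor expansion along a shift\<close>

definition symbols :: "real \<Rightarrow> 'd::finite symb set" where
  "symbols r0 = {g. (\<forall>N. symb_upto N g) \<and> admissible r0 g}"

lemma symbols_grad:
  assumes "g \<in> symbols r0"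
  shows "has_grad g (\<lambda>j. dx j g) (dlam g)" "dx j g \<in> symbols r0" "dlam g \<in> symbols r0"
proof -
  have *: "symb_upto (Suc N) g" for N using assms by (simp add: symbols_def del: symb_upto.simps)
  show grad: "has_grad g (\<lambda>j. dx j g) (dlam g)" using *[of 0] by simp
  from admissible_grad[OF _ this] * assms
  show "dx j g \<in> symbols r0" "dlam g \<in> symbols r0" by (auto simp: symbols_def)
qed

lemma dx_power_symbols: "g \<in> symbols r0 \<Longrightarrow> (dx j ^^ s) g \<in> symbols r0"
  by (induction s) (auto intro: symbols_grad)

lemma symbols_cong:
  assumes "g \<in> symbols r0" "\<And>x k lam. x \<in> pos_orthant \<Longrightarrow> g x k lam = g' x k lam"
  shows "g' \<in> symbols r0"
  using assms symb_upto_cong[of g g'] by (fastforce simp: symbols_def admissible_def)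

lemma symbols_add:
  "f \<in> symbols r0 \<Longrightarrow> g \<in> symbols r0 \<Longrightarrow> (\<lambda>x k lam. f x k lam + g x k lam) \<in> symbols r0"
  by (simp add: symbols_def symb_upto_add admissible_def distrib_left)

lemma symbols_cmult: "g \<in> symbols r0 \<Longrightarrow> (\<lambda>x k lam. c * g x k lam) \<in> symbols r0"
  by (simp add: symbols_def symb_upto_cmult admissible_def)

lemma symbols_sum:
  "(\<And>i. i \<in> I \<Longrightarrow> g i \<in> symbols r0) \<Longrightarrow> (\<lambda>x k lam. \<Sum>i\<in>I. g i x k lam) \<in> symbols r0"
  by (auto simp: symbols_def admissible_def sum_distrib_left intro!: symb_upto_sum sum.cong sum.neutral)

lemma symbols_coordinate_mult:
  "g \<in> symbols r0 \<Longrightarrow> (\<lambda>x k lam. of_real (x $ i) * g x k lam) \<in> symbols r0"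
  by (simp add: symbols_def symb_upto_coordinate_mult admissible_def)

lemma symbols_lam_mult: "g \<in> symbols r0 \<Longrightarrow> (\<lambda>x k lam. of_real lam * g x k lam) \<in> symbols r0"
  by (simp add: symbols_def symb_upto_lam_mult admissible_def)

lemma symbols_lam_power_mult: "g \<in> symbols r0 \<Longrightarrow> (\<lambda>x k lam. of_real (lam ^ i) * g x k lam) \<in> symbols r0"
proof (induction i)
  case (Suc i)
  from symbols_lam_mult[OF Suc.IH[OF Suc.prems]] show ?case by (simp add: mult.assoc)
qed simp

lemma symbols_quotient:
  assumes "0 < r0" "b 0 = 0" "\<And>i. \<bar>b i\<bar> \<le> C * (1 + \<bar>real_of_int i\<bar>) ^ a" "\<And>i. b (- i) = b i"
    and "g \<in> symbols r0"
  shows "(\<lambda>x k lam. of_real (b (k $ i)) * (of_real (inverse (x $ i) ^ q) * g x k lam)) \<in> symbols r0"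
  using symb_upto_quotient[of r0 b C a g] assms by (simp add: symbols_def admissible_def)

lemma symbols_euler: "g \<in> symbols r0 \<Longrightarrow> euler_symb g \<in> symbols r0"
  unfolding euler_symb_def[abs_def]
  by (intro symbols_add symbols_sum symbols_coordinate_mult symbols_lam_mult symbols_grad)

lemma symbols_Theta: "g \<in> symbols r0 \<Longrightarrow> Theta g \<in> remainders 0"
  by (simp add: symbols_def Theta_in_remainders)

text \<open>
  The contribution of order \<open>q\<close> in the coefficient and order \<open>s\<close> in the Taylor expansion:
  \<open>2\<^sup>s / (2 s!) c\<^sub>q(k\<^sub>j) x\<^sub>j\<^sup>1\<^sup>-\<^sup>q \<partial>\<^sub>j\<^sup>s g\<close>.
\<close>

definition hop_term :: "nat \<Rightarrow> nat \<Rightarrow> 'd::finite \<Rightarrow> 'd symb \<Rightarrow> 'd symb" where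
  "hop_term q s j g x k lam = of_real (2 ^ s / (2 * fact s)) *
     (of_real (hop_coeff q (k $ j)) * (of_real (inverse (x $ j) ^ q) * (of_real (x $ j) * (dx j ^^ s) g x k lam)))"

lemma hop_term_symbols:
  fixes g :: "'d::finite symb"
  assumes "0 < r0" "g \<in> symbols r0"
  shows "hop_term q s j g \<in> symbols r0"
proof -
  have D: "(dx j ^^ s) g \<in> symbols r0" using assms(2) by (rule dx_power_symbols)
  consider "q = 0" | "q = Suc 0" | "2 \<le> q" by linarith
  then show ?thesis
  proof cases
    case 1
    have "(\<lambda>x k lam. of_real (2 ^ s / (2 * fact s)) * (of_real (x $ j) * (dx j ^^ s) g x k lam)) \<in> symbols r0"
      by (intro symbols_cmult symbols_coordinate_mult D)
    then show ?thesis by (rule symbols_cong) (simp add: hop_term_def 1 hop_coeff_0)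
  next
    case 2
    have "(\<lambda>x k lam. of_real (2 ^ s / (2 * fact s)) * (dx j ^^ s) g x k lam) \<in> symbols r0"
      by (intro symbols_cmult D)
    then show ?thesis
    proof (rule symbols_cong)
      fix x :: "real^'d" and k lam assume "x \<in> pos_orthant"
      then have "x $ j \<noteq> 0" by (auto simp: pos_orthant_def dest: spec[of _ j])
      then show "of_real (2 ^ s / (2 * fact s)) * (dx j ^^ s) g x k lam = hop_term q s j g x k lam"
        by (simp add: hop_term_def 2 hop_coeff_1 field_simps)
    qed
  next
    case 3
    show ?thesis
      unfolding hop_term_def[abs_def]
      by (intro symbols_cmult symbols_quotient[OF assms(1) hop_coeff_zero[OF 3] abs_hop_coeff_le hop_coeff_uminus]
          symbols_coordinate_mult D)
  qed
qed

lemma has_grad_continuous_on: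
  assumes "has_grad g gx gl"
  shows "continuous_on (pos_orthant \<times> UNIV) (\<lambda>(x, lam). g x k lam)"
proof -
  have "isCont (\<lambda>(x, lam). g x k lam) z" if "z \<in> pos_orthant \<times> UNIV" for z
    using assms that has_derivative_continuous unfolding has_grad_def by blast
  then show ?thesis by (intro continuous_at_imp_continuous_on) blast
qed

text \<open>
  Up to the factor \<open>\<bar>lam\<bar>\<close>, the point at position \<open>s \<in> [-1,1]\<close> on the segment through the two neighbours of
  \<open>(n,m)\<close> in direction \<open>j\<close>.
\<close>

definition hop_point :: "nat^'d::finite \<Rightarrow> nat^'d \<Rightarrow> 'd \<Rightarrow> real \<Rightarrow> real^'d" where
  "hop_point n m j s = R_vec n m + (2 * s) *\<^sub>R axis j 1"

lemma hop_point_nth: "hop_point n m j s $ i = R_vec n m $ i + (if i = j then 2 * s else 0)"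
  by (simp add: hop_point_def axis_def)

lemma hop_point_bounds:
  assumes "\<bar>\<sigma>\<bar> = 1" "1 \<le> R_vec n m $ j + 2 * \<sigma>" "t \<in> {0..1}"
  shows "1 \<le> hop_point n m j (\<sigma> * t) $ i" "R_vec n m $ i \<le> 3 * hop_point n m j (\<sigma> * t) $ i"
proof -
  have t: "0 \<le> t" "t \<le> 1" using assms(3) by auto
  from assms(1) have "\<sigma> = 1 \<or> \<sigma> = -1" by linarith
  then show "1 \<le> hop_point n m j (\<sigma> * t) $ i" "R_vec n m $ i \<le> 3 * hop_point n m j (\<sigma> * t) $ i"
    using assms(2) t R_vec_ge_1[of n m i] by (auto simp: hop_point_nth)
qed

text \<open>
  The integral remainder of the Taylor formula.  It is set to zero where the segment leaves
  the cone; the coefficient of the shift vanishes there.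
\<close>

definition hop_integral :: "real \<Rightarrow> 'd::finite \<Rightarrow> (real \<Rightarrow> real) \<Rightarrow> 'd symb \<Rightarrow> 'd freq_fun" where
  "hop_integral \<sigma> j \<omega> g n m lam =
     (if 1 \<le> R_vec n m $ j + 2 * \<sigma>
      then integral {0..1} (\<lambda>t. \<omega> t *\<^sub>R g (\<bar>lam\<bar> *\<^sub>R hop_point n m j (\<sigma> * t)) (diff_vec m n) lam)
      else 0)"

lemma hop_integral_continuous:
  assumes "has_grad g gx gl" "\<bar>\<sigma>\<bar> = 1" "1 \<le> R_vec n m $ j + 2 * \<sigma>" "0 \<notin> U"
  shows "continuous_on (U \<times> {0..1}) (\<lambda>(lam, t). g (\<bar>lam\<bar> *\<^sub>R hop_point n m j (\<sigma> * t)) k lam)"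
proof -
  have "continuous_on (U \<times> {0..1}) (\<lambda>z. (\<lambda>(x, lam). g x k lam)
      (\<bar>fst z\<bar> *\<^sub>R hop_point n m j (\<sigma> * snd z), fst z))"
  proof (rule continuous_on_compose2[OF has_grad_continuous_on[OF assms(1)]])
    show "continuous_on (U \<times> {0..1}) (\<lambda>z. (\<bar>fst z\<bar> *\<^sub>R hop_point n m j (\<sigma> * snd z), fst z))"
      unfolding hop_point_def by (intro continuous_intros)
    have "\<bar>lam\<bar> *\<^sub>R hop_point n m j (\<sigma> * t) \<in> pos_orthant" if "lam \<in> U" "t \<in> {0..1}" for lam t
      using that assms hop_point_bounds(1)[OF assms(2,3)] by (intro grid_in_cone(1)) auto
    then show "(\<lambda>z. (\<bar>fst z\<bar> *\<^sub>R hop_point n m j (\<sigma> * snd z), fst z)) ` (U \<times> {0..1})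
        \<subseteq> pos_orthant \<times> UNIV" by auto
  qed
  then show ?thesis by (simp add: case_prod_unfold)
qed

text \<open>
  Each point of the segment is a dilate by \<open>\<bar>lam\<bar>\<close> of a fixed point, so \<open>\<lambda> d/d\<lambda>\<close> acts under the integral
  as the Euler field.
\<close>

lemma hop_integral_euler:
  fixes g :: "'d::finite symb"
  assumes g: "g \<in> symbols r0" and \<sigma>: "\<bar>\<sigma>\<bar> = 1" and \<omega>: "continuous_on {0..1} \<omega>"
  shows "has_euler (hop_integral \<sigma> j \<omega> g) (hop_integral \<sigma> j \<omega> (euler_symb g))"
  unfolding has_euler_def
proof (intro allI impI)
  fix n m :: "nat^'d" and lam :: real assume lam: "lam \<noteq> 0"
  show "(hop_integral \<sigma> j \<omega> g n m has_vector_derivative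
      hop_integral \<sigma> j \<omega> (euler_symb g) n m lam / of_real lam) (at lam)"
  proof (cases "1 \<le> R_vec n m $ j + 2 * \<sigma>")
    case True
    define U :: "real set" where "U = (if 0 < lam then {0<..} else {..<0})"
    have U: "open U" "convex U" "lam \<in> U" "0 \<notin> U" using lam by (auto simp: U_def)
    let ?k = "diff_vec m n"
    let ?y = "\<lambda>lam t. \<bar>lam\<bar> *\<^sub>R hop_point n m j (\<sigma> * t)"
    have G: "has_grad g (\<lambda>j. dx j g) (dlam g)" and
      E: "has_grad (euler_symb g) (\<lambda>j. dx j (euler_symb g)) (dlam (euler_symb g))"
      using g symbols_euler symbols_grad by blast+
    note c1 = hop_integral_continuous[OF G \<sigma> True U(4), of ?k]
    note c2 = hop_integral_continuous[OF E \<sigma> True U(4), of ?k]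
    have "((\<lambda>lam. integral (cbox 0 1) (\<lambda>t. \<omega> t *\<^sub>R g (?y lam t) ?k lam)) has_vector_derivative
        integral (cbox 0 1) (\<lambda>t. \<omega> t *\<^sub>R (euler_symb g (?y lam t) ?k lam / of_real lam))) (at lam within U)"
    proof (rule leibniz_rule_vector_derivative[OF _ _ _ U(3,2)])
      fix x t :: real assume xt: "x \<in> U" "t \<in> cbox 0 1"
      then have "((\<lambda>lam. g (?y lam t) ?k lam) has_vector_derivative
          euler_symb g (?y x t) ?k x / of_real x) (at x within U)"
        using hop_point_bounds(1)[OF \<sigma> True, of t] U(4)
        by (intro has_vector_derivative_at_within[OF dilation_derivative[OF G]] grid_in_cone(3)[where lam = 1]) auto
      from has_vector_derivative_scaleR[OF DERIV_const[of "\<omega> t"] this]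
      show "((\<lambda>x. \<omega> t *\<^sub>R g (?y x t) ?k x) has_vector_derivative
          \<omega> t *\<^sub>R (euler_symb g (?y x t) ?k x / of_real x)) (at x within U)" by simp
    next
      fix x assume x: "x \<in> U"
      have "continuous_on {0..1} (\<lambda>t. (\<lambda>(lam, t). g (?y lam t) ?k lam) (x, t))"
        by (rule continuous_on_compose2[OF c1]) (use x in \<open>auto intro!: continuous_intros\<close>)
      then show "(\<lambda>t. \<omega> t *\<^sub>R g (?y x t) ?k x) integrable_on cbox 0 1"
        using \<omega> by (intro integrable_continuous) (auto intro!: continuous_intros)
    next
      have "continuous_on (U \<times> {0..1}) (\<lambda>z. \<omega> (snd z))"
        by (rule continuous_on_compose2[OF \<omega>]) (auto intro!: continuous_intros)
      then show "continuous_on (U \<times> cbox 0 1)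
          (\<lambda>(x, t). \<omega> t *\<^sub>R (euler_symb g (?y x t) ?k x / of_real x))"
        using c2 U(4) unfolding case_prod_unfold by (intro continuous_intros) auto
    qed
    also have "(\<lambda>t. \<omega> t *\<^sub>R (euler_symb g (?y lam t) ?k lam / of_real lam)) =
        (\<lambda>t. inverse lam *\<^sub>R (\<omega> t *\<^sub>R euler_symb g (?y lam t) ?k lam))"
      by (auto simp: fun_eq_iff scaleR_conv_of_real divide_inverse mult_ac)
    finally show ?thesis
      using True lam U
      by (simp add: hop_integral_def[abs_def] at_within_open[of lam U] scaleR_conv_of_real divide_inverse mult_ac)
  qed (simp add: hop_integral_def[abs_def])
qed

text \<open>
  Along the segment the coordinates are at least a third of those of \<open>R_vec n m\<close>, so the decay of \<open>g\<close>
  at its points gives decay in \<open>d0_hat n m lam\<close>.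
\<close>

lemma hop_integral_remainders:
  fixes g :: "'d::finite symb"
  assumes g: "g \<in> symbols r0" and \<sigma>: "\<bar>\<sigma>\<bar> = 1" and \<omega>: "continuous_on {0..1} \<omega>"
  shows "hop_integral \<sigma> j \<omega> g \<in> remainders 0"
proof -
  from compact_imp_bounded[OF compact_continuous_image[OF \<omega> compact_Icc]]
  obtain B where "\<forall>y\<in>\<omega> ` {0..1}. norm y \<le> B" unfolding bounded_iff by blast
  then have B: "\<bar>\<omega> t\<bar> \<le> B" if "t \<in> {0..1}" for t using that by auto
  have B0: "0 \<le> B" using B[of 0] by auto
  have bound: "grid_bound 0 (hop_integral \<sigma> j \<omega> g)" if g: "g \<in> symbols r0" for g :: "'d symb"
    unfolding grid_bound_def
  proof
    fix p :: nat
    have "rapid_symb g" using g symb_upto.simps(1)[of g] by (simp only: symbols_def mem_Collect_eq)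
    then obtain C where C: "\<And>x k lam. x \<in> pos_orthant \<Longrightarrow> (\<And>j. \<bar>lam\<bar> \<le> x $ j) \<Longrightarrow>
        weight x k ^ p * cmod (g x k lam) \<le> C"
      unfolding rapid_symb_def by blast
    have "(1 + d0_hat n m lam) ^ p * cmod (hop_integral \<sigma> j \<omega> g n m lam) \<le> \<bar>3 ^ p * (B * C)\<bar>"
      if lam: "lam \<noteq> 0" for n m lam
    proof (cases "1 \<le> R_vec n m $ j + 2 * \<sigma>")
      case True
      let ?k = "diff_vec m n" and ?w = "1 + d0_hat n m lam"
      let ?y = "\<lambda>t. \<bar>lam\<bar> *\<^sub>R hop_point n m j (\<sigma> * t)"
      have w: "1 \<le> ?w" using lam_le_d0_hat(2)[of n m lam] by simp
      have G: "has_grad g (\<lambda>j. dx j g) (dlam g)" using g symbols_grad by blast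
      have pt: "cmod (\<omega> t *\<^sub>R g (?y t) ?k lam) \<le> 3 ^ p * (B * C) / ?w ^ p" if t: "t \<in> {0..1}" for t
      proof -
        note y = grid_in_cone(1,2)[OF hop_point_bounds(1)[OF \<sigma> True t] lam]
        have "?w \<le> 3 * weight (?y t) ?k"
        proof -
          have "(\<Sum>i\<in>UNIV. \<bar>lam\<bar> * R_vec n m $ i) \<le> (\<Sum>i\<in>UNIV. 3 * (\<bar>lam\<bar> * hop_point n m j (\<sigma> * t) $ i))"
          proof (rule sum_mono)
            fix i
            from mult_left_mono[OF hop_point_bounds(2)[OF \<sigma> True t, of i], of "\<bar>lam\<bar>"]
            show "\<bar>lam\<bar> * R_vec n m $ i \<le> 3 * (\<bar>lam\<bar> * hop_point n m j (\<sigma> * t) $ i)"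
              by (simp add: mult_ac)
          qed
          then show ?thesis
            using l1_nonneg[of ?k] unfolding weight_grid[symmetric] weight_def
            by (simp add: sum_distrib_left)
        qed
        from power_mono[OF this, of p] w have "?w ^ p \<le> 3 ^ p * weight (?y t) ?k ^ p"
          by (simp add: power_mult_distrib)
        then have "?w ^ p * cmod (g (?y t) ?k lam) \<le> 3 ^ p * (weight (?y t) ?k ^ p * cmod (g (?y t) ?k lam))"
          using mult_right_mono[of "?w ^ p" "3 ^ p * weight (?y t) ?k ^ p" "cmod (g (?y t) ?k lam)"]
          by (simp only: mult.assoc norm_ge_zero)
        also have "\<dots> \<le> 3 ^ p * C" using C[OF y] by simp
        finally have "B * (?w ^ p * cmod (g (?y t) ?k lam)) \<le> B * (3 ^ p * C)"
          using B0 by (rule mult_left_mono)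
        moreover have "?w ^ p * cmod (\<omega> t *\<^sub>R g (?y t) ?k lam) \<le> B * (?w ^ p * cmod (g (?y t) ?k lam))"
          using mult_right_mono[OF B[OF t], of "?w ^ p * cmod (g (?y t) ?k lam)"] w by (simp add: mult_ac)
        ultimately have "?w ^ p * cmod (\<omega> t *\<^sub>R g (?y t) ?k lam) \<le> 3 ^ p * (B * C)" by (simp add: mult_ac)
        then show ?thesis using w by (simp add: pos_le_divide_eq mult.commute)
      qed
      have "continuous_on {0..1} (\<lambda>t. (\<lambda>(lam, t). g (\<bar>lam\<bar> *\<^sub>R hop_point n m j (\<sigma> * t)) ?k lam) (lam, t))"
        by (rule continuous_on_compose2[OF hop_integral_continuous[OF G \<sigma> True, of "{lam}"]])
          (use lam in \<open>auto intro!: continuous_intros\<close>)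
      then have "continuous_on {0..1} (\<lambda>t. \<omega> t *\<^sub>R g (?y t) ?k lam)"
        using \<omega> by (auto intro!: continuous_intros)
      from integral_bound[OF _ this, of "3 ^ p * (B * C) / ?w ^ p"] pt
      have "cmod (hop_integral \<sigma> j \<omega> g n m lam) \<le> 3 ^ p * (B * C) / ?w ^ p"
        using True by (simp add: hop_integral_def)
      then have "?w ^ p * cmod (hop_integral \<sigma> j \<omega> g n m lam) \<le> 3 ^ p * (B * C)"
        using w by (simp add: pos_le_divide_eq mult.commute)
      then show ?thesis by linarith
    qed (simp add: hop_integral_def)
    then show "\<exists>C. \<forall>n m lam. lam \<noteq> 0 \<longrightarrow>
      (1 + d0_hat n m lam) ^ p * cmod (hop_integral \<sigma> j \<omega> g n m lam) \<le> C * \<bar>lam\<bar> powi 0" by auto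
  qed
  have "remainder_upto N 0 (hop_integral \<sigma> j \<omega> g)" for N
    using g
  proof (induction N arbitrary: g)
    case (Suc N)
    have "euler_symb g \<in> symbols r0" using Suc.prems by (rule symbols_euler)
    from Suc.IH[OF this] bound[OF Suc.prems] hop_integral_euler[OF Suc.prems \<sigma> \<omega>]
    show ?case by auto
  qed (simp add: bound)
  then show ?thesis by (simp add: remainders_def)
qed

lemma hop_taylor:
  fixes g :: "'d::finite symb"
  assumes g: "g \<in> symbols r0" and \<sigma>: "\<bar>\<sigma>\<bar> = 1" and "0 < Q"
    and pos: "1 \<le> R_vec n m $ j + 2 * \<sigma>" and lam: "lam \<noteq> 0"
  shows "g (\<bar>lam\<bar> *\<^sub>R hop_point n m j \<sigma>) (diff_vec m n) lam =
    (\<Sum>s<Q. of_real ((2 * \<sigma> * \<bar>lam\<bar>) ^ s / fact s) * Theta ((dx j ^^ s) g) n m lam)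
    + of_real ((2 * \<sigma> * \<bar>lam\<bar>) ^ Q) *
      hop_integral \<sigma> j (\<lambda>t. (1 - t) ^ (Q - 1) / fact (Q - 1)) ((dx j ^^ Q) g) n m lam"
proof -
  let ?k = "diff_vec m n" and ?c = "2 * \<sigma> * \<bar>lam\<bar>"
  let ?y = "\<lambda>t. \<bar>lam\<bar> *\<^sub>R hop_point n m j (\<sigma> * t)"
  define Df where "Df i t = ?c ^ i *\<^sub>R (dx j ^^ i) g (?y t) ?k lam" for i t
  have der: "(Df i has_vector_derivative Df (Suc i) t) (at t within {0..1})" if t: "0 \<le> t" "t \<le> 1" for i t
  proof -
    let ?D = "(dx j ^^ i) g"
    have "has_grad ?D (\<lambda>j. dx j ?D) (dlam ?D)"
      using dx_power_symbols[OF g] symbols_grad by blast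
    moreover have "?y t \<in> pos_orthant"
      using hop_point_bounds(1)[OF \<sigma> pos, of t] t lam by (intro grid_in_cone(1)) auto
    moreover have "(?y has_vector_derivative ?c *\<^sub>R axis j 1) (at t within {0..1})"
    proof -
      have "((\<lambda>t. ?c * t) has_real_derivative ?c) (at t within {0..1})"
        by (auto intro!: derivative_eq_intros)
      from has_vector_derivative_add[OF has_vector_derivative_const[of "\<bar>lam\<bar> *\<^sub>R R_vec n m"]
          has_vector_derivative_scaleR[OF this has_vector_derivative_const[of "axis j (1 :: real)"]]]
      show ?thesis by (simp add: hop_point_def scaleR_add_right mult_ac)
    qed
    ultimately have "((\<lambda>t. ?D (?y t) ?k lam) has_vector_derivative
        (\<Sum>i\<in>UNIV. (?c *\<^sub>R axis j 1) $ i *\<^sub>R dx i ?D (?y t) ?k lam) + 0 *\<^sub>R dlam ?D (?y t) ?k lam)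
        (at t within {0..1})"
      by (intro has_grad_chain) auto
    also have "(\<Sum>i\<in>UNIV. (?c *\<^sub>R axis j 1) $ i *\<^sub>R dx i ?D (?y t) ?k lam) = ?c *\<^sub>R dx j ?D (?y t) ?k lam"
      by (subst sum.remove[of _ j]) (auto simp: axis_def intro: sum.neutral)
    finally have "((\<lambda>t. ?D (?y t) ?k lam) has_vector_derivative ?c *\<^sub>R dx j ?D (?y t) ?k lam) (at t within {0..1})"
      by simp
    from has_vector_derivative_scaleR[OF DERIV_const[of "?c ^ i"] this]
    show ?thesis by (simp add: Df_def[abs_def] mult.commute)
  qed
  have "Df 0 1 = (\<Sum>s<Q. ((1 - 0) ^ s / fact s) *\<^sub>R Df s 0)
      + integral {0..1} (\<lambda>x. ((1 - x) ^ (Q - 1) / fact (Q - 1)) *\<^sub>R Df Q x)"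
    using der by (intro Taylor_integral[OF \<open>0 < Q\<close> refl]) auto
  also have "integral {0..1} (\<lambda>x. ((1 - x) ^ (Q - 1) / fact (Q - 1)) *\<^sub>R Df Q x) =
      ?c ^ Q *\<^sub>R hop_integral \<sigma> j (\<lambda>t. (1 - t) ^ (Q - 1) / fact (Q - 1)) ((dx j ^^ Q) g) n m lam"
  proof -
    have "(\<lambda>x. ((1 - x) ^ (Q - 1) / fact (Q - 1)) *\<^sub>R Df Q x) =
        (\<lambda>x. ?c ^ Q *\<^sub>R (((1 - x) ^ (Q - 1) / fact (Q - 1)) *\<^sub>R (dx j ^^ Q) g (?y x) ?k lam))"
      by (simp add: Df_def fun_eq_iff mult.commute)
    then show ?thesis using pos by (simp only: integral_cmul hop_integral_def if_True)
  qed
  finally show ?thesis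
    by (simp add: Df_def Theta_def hop_point_def scaleR_conv_of_real)
qed

section \<open>Expansion of the shifts in powers of lambda\<close>

text \<open>
  The coefficient of the upper shift for \<open>\<sigma> = 1\<close> and of the lower shift for \<open>\<sigma> = -1\<close>, in a form in which
  \<open>\<sigma>\<close> only changes the sign of \<open>1 / R\<^sub>j\<close>.
\<close>

definition hop_weight :: "real \<Rightarrow> 'd::finite \<Rightarrow> nat^'d \<Rightarrow> nat^'d \<Rightarrow> real" where
  "hop_weight \<sigma> j n m = R_vec n m $ j / 2 *
     sqrt ((1 + \<sigma> * (1 / R_vec n m $ j))\<^sup>2 - (real_of_int (diff_vec m n $ j) * (1 / R_vec n m $ j))\<^sup>2)"

definition hop :: "real \<Rightarrow> 'd::finite \<Rightarrow> 'd symb \<Rightarrow> 'd freq_fun" where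
  "hop \<sigma> j g n m lam =
     of_real (hop_weight \<sigma> j n m) * g (\<bar>lam\<bar> *\<^sub>R hop_point n m j \<sigma>) (diff_vec m n) lam"

lemma diff_vec_R_vec: "\<bar>real_of_int (diff_vec m n $ j)\<bar> + 1 \<le> R_vec n m $ j"
  by (simp add: diff_vec_def R_vec_def)

lemma hop_weight_eq:
  "hop_weight \<sigma> j n m = sqrt (((R_vec n m $ j + \<sigma>)\<^sup>2 - (real_of_int (diff_vec m n $ j))\<^sup>2) / 4)"
proof -
  let ?R = "R_vec n m $ j" and ?k = "real_of_int (diff_vec m n $ j)"
  have R: "1 \<le> ?R" by (rule R_vec_ge_1)
  have "hop_weight \<sigma> j n m = sqrt ((?R / 2)\<^sup>2 * ((1 + \<sigma> * (1 / ?R))\<^sup>2 - (?k * (1 / ?R))\<^sup>2))"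
    using R by (simp add: hop_weight_def real_sqrt_mult)
  also have "(?R / 2)\<^sup>2 * ((1 + \<sigma> * (1 / ?R))\<^sup>2 - (?k * (1 / ?R))\<^sup>2) = ((?R + \<sigma>)\<^sup>2 - ?k\<^sup>2) / 4"
    using R by (simp add: field_simps power2_eq_square)
  finally show ?thesis .
qed

lemma hop_weight_raise: "hop_weight 1 j n m = sqrt (real ((n $ j + 1) * (m $ j + 1)))"
  and hop_weight_lower: "hop_weight (- 1) j n m = sqrt (real (n $ j * m $ j))"
  unfolding hop_weight_eq
  by (rule arg_cong[where f = sqrt], simp add: R_vec_def diff_vec_def field_simps power2_eq_square)+

lemma Theta_raise:
  "of_real (sqrt (real ((n $ j + 1) * (m $ j + 1)))) * Theta g (n + unit_vec j) (m + unit_vec j) lam =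
    hop 1 j g n m lam"
proof -
  have "R_vec (n + unit_vec j) (m + unit_vec j) = hop_point n m j 1"
    by (simp add: vec_eq_iff R_vec_def hop_point_nth axis_def)
  moreover have "diff_vec (m + unit_vec j) (n + unit_vec j) = diff_vec m n"
    by (simp add: vec_eq_iff diff_vec_def axis_def)
  ultimately show ?thesis by (simp only: Theta_def hop_def hop_weight_raise)
qed

lemma Theta_lower:
  "of_real (sqrt (real (n $ j * m $ j))) * Theta g (n - unit_vec j) (m - unit_vec j) lam =
    hop (- 1) j g n m lam"
proof (cases "n $ j * m $ j = 0")
  case False
  have "R_vec (n - unit_vec j) (m - unit_vec j) = hop_point n m j (- 1)"
    using False by (auto simp: vec_eq_iff R_vec_def hop_point_nth axis_def)
  moreover have "diff_vec (m - unit_vec j) (n - unit_vec j) = diff_vec m n"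
    using False by (auto simp: vec_eq_iff diff_vec_def axis_def)
  ultimately show ?thesis by (simp only: Theta_def hop_def hop_weight_lower)
qed (simp only: Theta_def hop_def hop_weight_lower of_nat_0 real_sqrt_zero of_real_0 mult_zero_left)

lemma hop_weight_bounds:
  assumes "\<bar>\<sigma>\<bar> = 1"
  shows "0 \<le> hop_weight \<sigma> j n m" "hop_weight \<sigma> j n m \<le> R_vec n m $ j"
    and "hop_weight \<sigma> j n m \<noteq> 0 \<Longrightarrow> 1 \<le> R_vec n m $ j + 2 * \<sigma>"
proof -
  let ?R = "R_vec n m $ j" and ?k = "real_of_int (diff_vec m n $ j)"
  from assms have \<sigma>: "\<sigma> = 1 \<or> \<sigma> = -1" by linarith
  have R: "1 \<le> ?R" by (rule R_vec_ge_1)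
  show "0 \<le> hop_weight \<sigma> j n m"
    using \<sigma> by (auto simp: hop_weight_raise hop_weight_lower)
  show "hop_weight \<sigma> j n m \<le> ?R"
  proof -
    have div: "(a - b) / 4 \<le> c" if "a \<le> 4 * c" "0 \<le> b" for a b c :: real
      using that by simp
    have "(?R + \<sigma>)\<^sup>2 \<le> (2 * ?R)\<^sup>2" using \<sigma> R by (intro power_mono) auto
    then have "((?R + \<sigma>)\<^sup>2 - ?k\<^sup>2) / 4 \<le> ?R\<^sup>2"
      by (intro div) (simp_all add: power_mult_distrib)
    then show ?thesis unfolding hop_weight_eq using R by (intro real_le_lsqrt) auto
  qed
  assume nz: "hop_weight \<sigma> j n m \<noteq> 0"
  from \<sigma> show "1 \<le> ?R + 2 * \<sigma>"
  proof
    assume "\<sigma> = - 1"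
    with nz have "1 \<le> n $ j" "1 \<le> m $ j" by (auto simp: hop_weight_lower Suc_le_eq)
    then show ?thesis using \<open>\<sigma> = - 1\<close> by (simp add: R_vec_def)
  qed (use R in simp)
qed

lemma hop_weight_lam_le:
  assumes "\<bar>\<sigma>\<bar> = 1"
  shows "\<bar>hop_weight \<sigma> j n m\<bar> * \<bar>lam\<bar> \<le> 1 * (1 + d0_hat n m lam)"
proof -
  have "hop_weight \<sigma> j n m * \<bar>lam\<bar> \<le> \<bar>lam\<bar> * R_vec n m $ j"
    using hop_weight_bounds(2)[OF assms, of j n m] by (simp add: mult.commute mult_left_mono)
  also have "\<dots> \<le> \<bar>lam\<bar> * (\<Sum>i\<in>UNIV. R_vec n m $ i)"
    using R_vec_ge_1[of n m] by (intro mult_left_mono member_le_sum) (auto intro: order_trans[of 0 1])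
  also have "\<dots> \<le> 1 + d0_hat n m lam"
    using l1_nonneg[of "diff_vec m n"] by (simp add: d0_hat_def size_sum_eq)
  finally show ?thesis using hop_weight_bounds(1)[OF assms, of j n m] by simp
qed

text \<open>
  Where \<open>\<rho>\<close> and \<open>Theta g\<close> are both nonzero, \<open>k \<noteq> 0\<close> and thus \<open>x\<^sub>j \<ge> r0\<close>, so \<open>1 / R\<^sub>j = \<bar>lam\<bar> / x\<^sub>j\<close> is at most
  \<open>\<bar>lam\<bar> / r0\<close>: powers of \<open>1 / R\<^sub>j\<close> are powers of \<open>\<bar>lam\<bar>\<close>, and powers of \<open>k\<^sub>j\<close> are absorbed by the decay.
\<close>

lemma vanishing_coefficient_remainders:
  fixes \<rho> :: "nat^'d::finite \<Rightarrow> nat^'d \<Rightarrow> real"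
  assumes "0 < r0" "0 \<le> C"
    and zero: "\<And>n m. diff_vec m n = 0 \<Longrightarrow> \<rho> n m = 0"
    and le: "\<And>n m. \<bar>\<rho> n m\<bar> \<le> C * (1 / R_vec n m $ j * (1 + \<bar>real_of_int (diff_vec m n $ j)\<bar>)) ^ Q"
    and "g \<in> symbols r0"
  shows "(\<lambda>n m lam. of_real (\<rho> n m) * Theta g n m lam) \<in> remainders (int Q)"
proof -
  have bound: "grid_bound (int Q) (\<lambda>n m lam. of_real (\<rho> n m) * Theta g n m lam)"
    if g: "g \<in> symbols r0" for g :: "'d symb"
  proof -
    have "grid_bound 0 (Theta g)"
      using symbols_Theta[OF g] remainder_upto_bound unfolding remainders_def by blast
    moreover have "cmod (of_real (\<rho> n m) * Theta g n m lam) \<le>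
        (C * (1 / r0) ^ Q) * (1 + d0_hat n m lam) ^ Q * \<bar>lam\<bar> powi (int Q) * cmod (Theta g n m lam)"
      if lam: "lam \<noteq> 0" for n m lam
    proof (cases "\<rho> n m = 0 \<or> Theta g n m lam = 0")
      case True
      then show ?thesis
        using assms(1,2) lam_le_d0_hat(2)[of n m lam] by (auto intro!: mult_nonneg_nonneg)
    next
      case False
      then have k: "diff_vec m n \<noteq> 0" using zero by blast
      note x = grid_in_cone(1)[OF R_vec_ge_1 lam, of n m]
      have "\<not> (\<bar>lam\<bar> *\<^sub>R R_vec n m) $ j < r0"
        using g x k False unfolding symbols_def admissible_def Theta_def by blast
      then have r0: "1 / R_vec n m $ j \<le> \<bar>lam\<bar> / r0"
        using R_vec_ge_1[of n m j] assms(1) lam by (simp add: field_simps)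
      have kj: "1 + \<bar>real_of_int (diff_vec m n $ j)\<bar> \<le> 1 + d0_hat n m lam"
      proof -
        have "\<bar>real_of_int (diff_vec m n $ j)\<bar> \<le> real_of_int (l1 (diff_vec m n))"
          using component_le_l1[of "diff_vec m n" j] by linarith
        then show ?thesis by (simp add: d0_hat_def add_increasing)
      qed
      have "1 / R_vec n m $ j * (1 + \<bar>real_of_int (diff_vec m n $ j)\<bar>) \<le> (\<bar>lam\<bar> / r0) * (1 + d0_hat n m lam)"
        using r0 kj assms(1) by (intro mult_mono) auto
      then have "C * (1 / R_vec n m $ j * (1 + \<bar>real_of_int (diff_vec m n $ j)\<bar>)) ^ Q
          \<le> C * ((\<bar>lam\<bar> / r0) * (1 + d0_hat n m lam)) ^ Q"
        using R_vec_ge_1[of n m j] assms(2) by (intro mult_left_mono power_mono) auto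
      with le[of n m] have "\<bar>\<rho> n m\<bar> \<le> C * ((\<bar>lam\<bar> / r0) * (1 + d0_hat n m lam)) ^ Q" by linarith
      then have "\<bar>\<rho> n m\<bar> * cmod (Theta g n m lam) \<le>
          C * ((\<bar>lam\<bar> / r0) * (1 + d0_hat n m lam)) ^ Q * cmod (Theta g n m lam)"
        by (rule mult_right_mono) simp
      then show ?thesis
        by (simp add: norm_mult power_mult_distrib power_divide mult_ac)
    qed
    ultimately have "grid_bound (0 + int Q) (\<lambda>n m lam. of_real (\<rho> n m) * Theta g n m lam)"
      by (rule grid_bound_dominated)
    then show ?thesis by simp
  qed
  have "remainder_upto N (int Q) (\<lambda>n m lam. of_real (\<rho> n m) * Theta g n m lam)" for N
    using assms(5)
  proof (induction N arbitrary: g)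
    case (Suc N)
    have "has_euler (Theta g) (Theta (euler_symb g))"
      unfolding has_euler_def Theta_def[abs_def]
      using Suc.prems symbols_grad(1) grid_in_cone(3)[OF R_vec_ge_1] by (auto intro!: dilation_derivative)
    then have "has_euler (\<lambda>n m lam. of_real (\<rho> n m) * Theta g n m lam)
        (\<lambda>n m lam. of_real (\<rho> n m) * Theta (euler_symb g) n m lam)"
      by (auto simp: has_euler_def intro: has_vector_derivative_mult_right simp flip: times_divide_eq_right)
    with Suc.IH[OF symbols_euler[OF Suc.prems]] bound[OF Suc.prems] show ?case by auto
  qed (simp add: bound)
  then show ?thesis by (simp add: remainders_def)
qed

definition hop_symb :: "nat \<Rightarrow> 'd::finite \<Rightarrow> 'd symb \<Rightarrow> 'd symb" where
  "hop_symb i j g x k lam = (\<Sum>q\<le>i. hop_term q (i - q) j g x k lam)"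

lemma hop_symb_symbols: "0 < r0 \<Longrightarrow> g \<in> symbols r0 \<Longrightarrow> hop_symb i j g \<in> symbols r0"
  unfolding hop_symb_def[abs_def] by (intro symbols_sum hop_term_symbols)

lemma hop_symb_0: "hop_symb 0 j g x k lam = of_real (x $ j) * g x k lam / 2"
  by (simp add: hop_symb_def hop_term_def hop_coeff_0)

lemma hop_symb_1:
  assumes "x \<in> pos_orthant"
  shows "hop_symb (Suc 0) j g x k lam = g x k lam / 2 + of_real (x $ j) * dx j g x k lam"
proof -
  have "x $ j \<noteq> 0" using assms by (auto simp: pos_orthant_def dest: spec[of _ j])
  then show ?thesis by (simp add: hop_symb_def hop_term_def hop_coeff_0 hop_coeff_1)
qed

text \<open>
  Multiply the Taylor formula for \<open>g\<close> by the binomial expansion of the coefficient.  The error consists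
  of the integral remainder, the binomial remainder \<open>\<rho>\<close> (which vanishes for \<open>k = 0\<close> because the
  expansion is exact from order two on), and the products of total order at least \<open>Q\<close>.
\<close>

lemma hop_expansion:
  fixes g :: "'d::finite symb"
  assumes r0: "0 < r0" and g: "g \<in> symbols r0" and \<sigma>: "\<bar>\<sigma>\<bar> = 1" and Q: "2 \<le> Q"
  shows "(\<lambda>n m lam. of_real \<bar>lam\<bar> * hop \<sigma> j g n m lam
      - (\<Sum>i<Q. of_real ((\<sigma> * \<bar>lam\<bar>) ^ i) * Theta (hop_symb i j g) n m lam)) \<in> remainders (int Q)"
proof -
  obtain C where C: "0 \<le> C"
    "\<And>u k \<sigma>. \<bar>\<sigma>\<bar> = 1 \<Longrightarrow> 0 \<le> u \<Longrightarrow> u * (1 + \<bar>real_of_int k\<bar>) \<le> 1 \<Longrightarrow>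
      \<bar>sqrt ((1 + \<sigma> * u)\<^sup>2 - (real_of_int k * u)\<^sup>2) - (\<Sum>q<Q. hop_coeff q k * (\<sigma> * u) ^ q)\<bar>
        \<le> C * (u * (1 + \<bar>real_of_int k\<bar>)) ^ Q"
    by (rule sqrt_product_remainder[of Q]) blast
  define \<rho> where "\<rho> n m = sqrt ((1 + \<sigma> * (1 / R_vec n m $ j))\<^sup>2 - (real_of_int (diff_vec m n $ j) * (1 / R_vec n m $ j))\<^sup>2)
      - (\<Sum>q<Q. hop_coeff q (diff_vec m n $ j) * (\<sigma> * (1 / R_vec n m $ j)) ^ q)" for n m :: "nat^'d"
  let ?\<omega> = "\<lambda>t :: real. (1 - t) ^ (Q - 1) / fact (Q - 1)"
  let ?D = "\<lambda>s. (dx j ^^ s) g"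
  let ?J = "hop_integral \<sigma> j ?\<omega> (?D Q)"
  let ?xD = "\<lambda>s x k lam. of_real (x $ j) * ?D s x k lam"
  have D: "?D s \<in> symbols r0" for s using g by (rule dx_power_symbols)
  have \<rho>_zero: "\<rho> n m = 0" if "diff_vec m n = 0" for n m
  proof -
    let ?u = "1 / R_vec n m $ j"
    have u: "?u \<le> 1" "0 \<le> ?u" using R_vec_ge_1[of n m j] by auto
    have "(\<Sum>q<Q. hop_coeff q 0 * (\<sigma> * ?u) ^ q) = (\<Sum>q<2. hop_coeff q 0 * (\<sigma> * ?u) ^ q)"
      using Q by (intro sum.mono_neutral_right) (auto simp: hop_coeff_zero)
    also have "\<dots> = 1 + \<sigma> * ?u" by (simp add: numeral_2_eq_2 hop_coeff_0 hop_coeff_1)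
    also have "\<dots> = sqrt ((1 + \<sigma> * ?u)\<^sup>2)"
    proof -
      from \<sigma> have "\<sigma> = 1 \<or> \<sigma> = -1" by linarith
      then have "0 \<le> 1 + \<sigma> * ?u" using u by auto
      then show ?thesis by simp
    qed
    finally show ?thesis using that by (simp add: \<rho>_def)
  qed
  have \<rho>_le: "\<bar>\<rho> n m\<bar> \<le> C * (1 / R_vec n m $ j * (1 + \<bar>real_of_int (diff_vec m n $ j)\<bar>)) ^ Q" for n m
    unfolding \<rho>_def using R_vec_ge_1[of n m j] diff_vec_R_vec[of m n j]
    by (intro C(2) \<sigma>) (auto simp: field_simps)
  \<comment> \<open>the coefficient costs one order, which the factor \<open>\<bar>lam\<bar>\<close> in front of the shift restores\<close>
  have R1: "(\<lambda>n m lam. of_real (\<bar>lam\<bar> ^ Suc Q) * (of_real (hop_weight \<sigma> j n m) * ?J n m lam)) \<in> remainders (int Q)"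
  proof -
    have "?J \<in> remainders 0"
      by (rule hop_integral_remainders[OF D \<sigma>]) (auto intro!: continuous_intros)
    then have "(\<lambda>n m lam. of_real (hop_weight \<sigma> j n m) * ?J n m lam) \<in> remainders (0 - 1)"
      using remainder_upto_reindex[OF hop_weight_lam_le[OF \<sigma>], where K = 1 and s = "\<lambda>n m. n" and t = "\<lambda>n m. m"
          and r = ?J and M = 0]
      by (simp add: remainders_def)
    from remainders_abs_power[OF this, of "Suc Q"] show ?thesis by simp
  qed
  have R2: "(\<lambda>n m lam. of_real (\<bar>lam\<bar> ^ s) * (of_real (\<rho> n m) * Theta (?xD s) n m lam)) \<in> remainders (int Q)" for s
    by (rule remainders_mono[OF remainders_abs_power[OF vanishing_coefficient_remainders[OF r0 C(1) \<rho>_zero \<rho>_le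
        symbols_coordinate_mult[OF D]]]]) auto
  have R3: "(\<lambda>n m lam. of_real (\<bar>lam\<bar> ^ (q + s)) * Theta (hop_term q s j g) n m lam) \<in> remainders (int Q)"
    if "Q \<le> q + s" for q s
    by (rule remainders_mono[OF remainders_abs_power[OF symbols_Theta[OF hop_term_symbols[OF r0 g]]]]) (use that in simp)
  define tri where "tri = {(q, s). q + s < Q}"
  have sub: "tri \<subseteq> {..<Q} \<times> {..<Q}" by (auto simp: tri_def)
  have R: "(\<lambda>n m lam.
      (\<Sum>(q, s)\<in>{..<Q} \<times> {..<Q} - tri. of_real (\<sigma> ^ (q + s)) * (of_real (\<bar>lam\<bar> ^ (q + s)) * Theta (hop_term q s j g) n m lam))
      + (\<Sum>s<Q. of_real ((2 * \<sigma>) ^ s / (2 * fact s)) * (of_real (\<bar>lam\<bar> ^ s) * (of_real (\<rho> n m) * Theta (?xD s) n m lam)))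
      + of_real ((2 * \<sigma>) ^ Q) * (of_real (\<bar>lam\<bar> ^ Suc Q) * (of_real (hop_weight \<sigma> j n m) * ?J n m lam)))
    \<in> remainders (int Q)"
    unfolding case_prod_unfold
    by (intro remainders_add remainders_sum remainders_cmult R1 R2 R3) (auto simp: tri_def)
  show ?thesis
  proof (rule remainders_cong[OF R])
    fix n m :: "nat^'d" and lam :: real assume lam: "lam \<noteq> 0"
    let ?h = "\<bar>lam\<bar>" and ?R = "R_vec n m $ j" and ?k = "diff_vec m n $ j"
    have R1: "?R \<noteq> 0" using R_vec_ge_1[of n m j] by linarith
    define A where "A s = (\<Sum>q<Q. of_real (\<sigma> ^ (q + s)) * (of_real (?h ^ (q + s)) * Theta (hop_term q s j g) n m lam))" for s
    define B where "B s = of_real ((2 * \<sigma>) ^ s / (2 * fact s)) * (of_real (?h ^ s) * (of_real (\<rho> n m) * Theta (?xD s) n m lam))" for s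
    define J where "J = of_real ((2 * \<sigma>) ^ Q) * (of_real (?h ^ Suc Q) * (of_real (hop_weight \<sigma> j n m) * ?J n m lam))"
    have taylor: "of_real ?h * hop \<sigma> j g n m lam =
      (\<Sum>s<Q. of_real (?h * hop_weight \<sigma> j n m) * (of_real ((2 * \<sigma> * ?h) ^ s / fact s) * Theta (?D s) n m lam)) + J"
    proof (cases "hop_weight \<sigma> j n m = 0")
      case False
      from hop_taylor[OF g \<sigma> _ hop_weight_bounds(3)[OF \<sigma> False] lam, of Q] Q
      show ?thesis
        unfolding hop_def J_def
        by (simp add: distrib_left sum_distrib_left power_mult_distrib mult_ac)
    qed (simp add: hop_def J_def)
    have weight: "?h * hop_weight \<sigma> j n m =
        (\<Sum>q<Q. ?h * ?R / 2 * (hop_coeff q ?k * (\<sigma> * (1 / ?R)) ^ q)) + ?h * ?R / 2 * \<rho> n m"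
      unfolding sum_distrib_left[symmetric] hop_weight_def \<rho>_def by (simp add: algebra_simps)
    have "of_real (?h * hop_weight \<sigma> j n m) * (of_real ((2 * \<sigma> * ?h) ^ s / fact s) * Theta (?D s) n m lam) = A s + B s" for s
    proof -
      have "of_real (?h * ?R / 2 * (hop_coeff q ?k * (\<sigma> * (1 / ?R)) ^ q)) *
          (of_real ((2 * \<sigma> * ?h) ^ s / fact s) * Theta (?D s) n m lam) =
          of_real (\<sigma> ^ (q + s)) * (of_real (?h ^ (q + s)) * Theta (hop_term q s j g) n m lam)" for q
        using lam R1
        by (simp add: Theta_def hop_term_def power_add power_mult_distrib power_divide power_inverse field_simps)
      moreover have "of_real (?h * ?R / 2 * \<rho> n m) *
          (of_real ((2 * \<sigma> * ?h) ^ s / fact s) * Theta (?D s) n m lam) = B s"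
        by (simp add: B_def Theta_def power_mult_distrib field_simps)
      ultimately show ?thesis
        unfolding weight A_def of_real_add of_real_sum distrib_right sum_distrib_right by simp
    qed
    with taylor have "of_real ?h * hop \<sigma> j g n m lam = (\<Sum>s<Q. A s) + (\<Sum>s<Q. B s) + J"
      by (simp add: sum.distrib)
    moreover have "(\<Sum>s<Q. A s) =
        (\<Sum>(q, s)\<in>{..<Q} \<times> {..<Q}. of_real (\<sigma> ^ (q + s)) * (of_real (?h ^ (q + s)) * Theta (hop_term q s j g) n m lam))"
      unfolding A_def by (subst sum.swap) (simp add: sum.cartesian_product)
    moreover have "\<dots> =
        (\<Sum>(q, s)\<in>{..<Q} \<times> {..<Q} - tri. of_real (\<sigma> ^ (q + s)) * (of_real (?h ^ (q + s)) * Theta (hop_term q s j g) n m lam))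
        + (\<Sum>(q, s)\<in>tri. of_real (\<sigma> ^ (q + s)) * (of_real (?h ^ (q + s)) * Theta (hop_term q s j g) n m lam))"
      by (rule sum.subset_diff[OF sub]) simp
    moreover have "(\<Sum>(q, s)\<in>tri. of_real (\<sigma> ^ (q + s)) * (of_real (?h ^ (q + s)) * Theta (hop_term q s j g) n m lam)) =
        (\<Sum>i<Q. of_real ((\<sigma> * ?h) ^ i) * Theta (hop_symb i j g) n m lam)"
      unfolding tri_def sum.triangle_reindex
    proof (intro sum.cong refl)
      fix i
      show "(\<Sum>q\<le>i. of_real (\<sigma> ^ (q + (i - q))) * (of_real (?h ^ (q + (i - q))) * Theta (hop_term q (i - q) j g) n m lam)) =
          of_real ((\<sigma> * ?h) ^ i) * Theta (hop_symb i j g) n m lam"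
        by (simp add: Theta_def hop_symb_def sum_distrib_left power_mult_distrib mult.assoc)
    qed
    ultimately show "(\<Sum>(q, s)\<in>{..<Q} \<times> {..<Q} - tri. of_real (\<sigma> ^ (q + s)) * (of_real (\<bar>lam\<bar> ^ (q + s)) * Theta (hop_term q s j g) n m lam))
      + (\<Sum>s<Q. of_real ((2 * \<sigma>) ^ s / (2 * fact s)) * (of_real (\<bar>lam\<bar> ^ s) * (of_real (\<rho> n m) * Theta (?xD s) n m lam)))
      + of_real ((2 * \<sigma>) ^ Q) * (of_real (\<bar>lam\<bar> ^ Suc Q) * (of_real (hop_weight \<sigma> j n m) * ?J n m lam)) =
      of_real \<bar>lam\<bar> * hop \<sigma> j g n m lam
      - (\<Sum>i<Q. of_real ((\<sigma> * \<bar>lam\<bar>) ^ i) * Theta (hop_symb i j g) n m lam)"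
      unfolding J_def B_def by simp
  qed
qed

section \<open>Stability under the two operators\<close>

lemma d0_hat_raise: "d0_hat (n + unit_vec j) (m + unit_vec j) lam = d0_hat n m lam + 2 * \<bar>lam\<bar>"
proof -
  have "(\<Sum>i\<in>UNIV. unit_vec j $ i) = 1"
    by (simp add: axis_def)
  then have "size_sum (n + unit_vec j) (m + unit_vec j) = size_sum n m + 2"
    by (simp add: size_sum_def sum.distrib)
  moreover have "diff_vec (m + unit_vec j) (n + unit_vec j) = diff_vec m n"
    by (simp add: vec_eq_iff diff_vec_def)
  ultimately show ?thesis by (simp add: d0_hat_def algebra_simps)
qed

lemma remainders_raise:
  assumes "r \<in> remainders M"
  shows "(\<lambda>n m lam. of_real (sqrt (real ((n $ j + 1) * (m $ j + 1)))) * r (n + unit_vec j) (m + unit_vec j) lam)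
    \<in> remainders (M - 1)"
proof -
  have "1 + d0_hat n m lam \<le> 1 * (1 + d0_hat (n + unit_vec j) (m + unit_vec j) lam)" for n m :: "nat^'a" and lam
    unfolding d0_hat_raise by simp
  from remainder_upto_reindex[OF hop_weight_lam_le[of 1 j] this, of _ M r] assms
  show ?thesis unfolding remainders_def hop_weight_raise by simp
qed

lemma remainders_lower:
  assumes "r \<in> remainders M"
  shows "(\<lambda>n m lam. of_real (sqrt (real (n $ j * m $ j))) * r (n - unit_vec j) (m - unit_vec j) lam)
    \<in> remainders (M - 1)"
proof -
  have "1 + d0_hat n m lam \<le> 3 * (1 + d0_hat (n - unit_vec j) (m - unit_vec j) lam)"
    if "hop_weight (- 1) j n m \<noteq> 0" for n m :: "nat^'a" and lam
  proof -
    have "1 \<le> n $ j" "1 \<le> m $ j" using that by (auto simp: hop_weight_lower Suc_le_eq)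
    then have "n - unit_vec j + unit_vec j = n" "m - unit_vec j + unit_vec j = m"
      by (auto simp: vec_eq_iff axis_def)
    with d0_hat_raise[of "n - unit_vec j" j "m - unit_vec j" lam]
    show ?thesis using lam_le_d0_hat(1)[of lam "n - unit_vec j" "m - unit_vec j"] by simp
  qed
  from remainder_upto_reindex[OF hop_weight_lam_le[of "-1" j] this, of _ M r] assms
  show ?thesis unfolding remainders_def hop_weight_lower by simp
qed

lemma Delta_hat_eq:
  "Delta_hat \<theta> n m lam = of_real (1 / \<bar>lam\<bar>) * (of_real (1/2) *
     (\<Sum>j\<in>UNIV. of_real (sqrt (real ((n $ j + 1) * (m $ j + 1)))) * \<theta> (n + unit_vec j) (m + unit_vec j) lam
        + of_real (sqrt (real (n $ j * m $ j))) * \<theta> (n - unit_vec j) (m - unit_vec j) lam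
        - of_real (R_vec n m $ j) * \<theta> n m lam))"
proof -
  have alg: "- of_real (s / (2 * h)) * z + of_real (1 / (2 * h)) * A =
      of_real (1 / h) * (of_real (1/2) * (A - of_real s * z))" for h s :: real and A z :: complex
    by (cases "h = 0") (simp_all add: field_simps)
  have sums: "(\<Sum>j\<in>UNIV. F j - of_real (R_vec n m $ j) * z) = sum F UNIV - of_real (\<Sum>j\<in>UNIV. R_vec n m $ j) * z"
    for F and z :: complex
    by (simp add: sum_subtractf sum_distrib_right)
  show ?thesis
    unfolding Delta_hat_def size_sum_eq sums by (rule alg)
qed

lemma D_hat_eq:
  "D_hat \<theta> n m lam = vector_derivative (\<theta> n m) (at lam) + of_real (1 / lam) * (of_real (1/2) *
     (\<Sum>j\<in>UNIV. \<theta> n m lam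
        + of_real (sqrt (real (n $ j * m $ j))) * \<theta> (n - unit_vec j) (m - unit_vec j) lam
        - of_real (sqrt (real ((n $ j + 1) * (m $ j + 1)))) * \<theta> (n + unit_vec j) (m + unit_vec j) lam))"
  by (simp add: D_hat_def sum.distrib sum_subtractf algebra_simps)

lemma Delta_hat_add:
  "Delta_hat (\<lambda>n m lam. a n m lam + b n m lam) n m lam = Delta_hat a n m lam + Delta_hat b n m lam"
  unfolding Delta_hat_def
  by (simp only: distrib_left sum.distrib) (simp only: add_ac)

lemma D_hat_add:
  assumes "(a n m has_vector_derivative a') (at lam)" "(b n m has_vector_derivative b') (at lam)"
  shows "D_hat (\<lambda>n m lam. a n m lam + b n m lam) n m lam = D_hat a n m lam + D_hat b n m lam"
  unfolding D_hat_def vector_derivative_at[OF has_vector_derivative_add[OF assms]]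
    vector_derivative_at[OF assms(1)] vector_derivative_at[OF assms(2)]
  by (simp only: distrib_left sum.distrib sum_subtractf right_diff_distrib) (simp only: diff_conv_add_uminus minus_add_distrib add_ac)

lemma remainders_R_vec_mult:
  assumes "r \<in> remainders M"
  shows "(\<lambda>n m lam. of_real (R_vec n m $ j) * r n m lam) \<in> remainders (M - 1)"
proof -
  have "\<bar>R_vec n m $ j\<bar> * \<bar>lam\<bar> \<le> 1 * (1 + d0_hat n m lam)" for n m :: "nat^'a" and lam :: real
  proof -
    have "\<bar>lam\<bar> * R_vec n m $ j \<le> \<bar>lam\<bar> * (\<Sum>i\<in>UNIV. R_vec n m $ i)"
      using R_vec_ge_1[of n m] by (intro mult_left_mono member_le_sum) (auto intro: order_trans[of 0 1])
    also have "\<dots> \<le> 1 + d0_hat n m lam"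
      using l1_nonneg[of "diff_vec m n"] by (simp add: d0_hat_def size_sum_eq)
    finally show ?thesis using R_vec_ge_1[of n m j] by (simp add: mult.commute)
  qed
  from remainder_upto_reindex[of "\<lambda>n m. R_vec n m $ j" 1 1 "\<lambda>n m. n" "\<lambda>n m. m" _ M r] this assms
  show ?thesis by (simp add: remainders_def)
qed

lemma remainders_Delta_hat:
  assumes "r \<in> remainders M"
  shows "Delta_hat r \<in> remainders (M - 2)"
proof -
  have "(\<lambda>n m lam. of_real (1 / \<bar>lam\<bar>) * (of_real (1/2) *
     (\<Sum>j\<in>UNIV. of_real (sqrt (real ((n $ j + 1) * (m $ j + 1)))) * r (n + unit_vec j) (m + unit_vec j) lam
        + of_real (sqrt (real (n $ j * m $ j))) * r (n - unit_vec j) (m - unit_vec j) lam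
        - of_real (R_vec n m $ j) * r n m lam))) \<in> remainders (M - 1 - 1)"
    by (intro remainders_divide_lam(2) remainders_cmult remainders_sum remainders_diff remainders_add
        remainders_raise remainders_lower remainders_R_vec_mult assms)
  then show ?thesis by (simp add: Delta_hat_eq[abs_def])
qed

lemma remainders_derivative:
  assumes "r \<in> remainders M"
  obtains r' where "r' \<in> remainders (M - 1)"
    "\<And>n m lam. lam \<noteq> 0 \<Longrightarrow> (r n m has_vector_derivative r' n m lam) (at lam)"
proof -
  from remainders_euler[OF assms] obtain s where s: "has_euler r s" "s \<in> remainders M" by blast
  show thesis
  proof (rule that[OF remainders_divide_lam(1)[OF s(2)]])
    show "(r n m has_vector_derivative of_real (1 / lam) * s n m lam) (at lam)" if "lam \<noteq> 0" for n m lam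
      using s(1) that by (simp add: has_euler_def divide_inverse mult.commute)
  qed
qed

lemma remainders_D_hat:
  assumes "r \<in> remainders M"
  shows "D_hat r \<in> remainders (M - 2)"
proof -
  obtain r' where r': "r' \<in> remainders (M - 1)"
    "\<And>n m lam. lam \<noteq> 0 \<Longrightarrow> (r n m has_vector_derivative r' n m lam) (at lam)"
    using remainders_derivative[OF assms] by blast
  have "(\<lambda>n m lam. of_real (1 / lam) * (of_real (1/2) *
     (\<Sum>j\<in>UNIV. r n m lam
        + of_real (sqrt (real (n $ j * m $ j))) * r (n - unit_vec j) (m - unit_vec j) lam
        - of_real (sqrt (real ((n $ j + 1) * (m $ j + 1)))) * r (n + unit_vec j) (m + unit_vec j) lam)))
    \<in> remainders (M - 1 - 1)"
    by (intro remainders_divide_lam(1) remainders_cmult remainders_sum remainders_diff remainders_add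
        remainders_raise remainders_lower remainders_mono[OF assms]) simp_all
  then have "(\<lambda>n m lam. r' n m lam + of_real (1 / lam) * (of_real (1/2) *
     (\<Sum>j\<in>UNIV. r n m lam
        + of_real (sqrt (real (n $ j * m $ j))) * r (n - unit_vec j) (m - unit_vec j) lam
        - of_real (sqrt (real ((n $ j + 1) * (m $ j + 1)))) * r (n + unit_vec j) (m + unit_vec j) lam)))
    \<in> remainders (M - 2)"
    using remainders_mono[OF r'(1)] by (intro remainders_add) auto
  then show ?thesis
    by (rule remainders_cong) (simp only: D_hat_eq vector_derivative_at[OF r'(2)] not_False_eq_True)
qed

text \<open>
  The terms of order zero and one are split off; those of order one cancel.
\<close>

lemma sum_even_part:
  fixes a :: "nat \<Rightarrow> complex" and h :: real
  shows "(\<Sum>i<M + 2. of_real ((1 * h) ^ i) * a i) + (\<Sum>i<M + 2. of_real ((- 1 * h) ^ i) * a i) =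
    2 * a 0 + of_real h * (of_real h * (\<Sum>i<M. of_real ((1 + (- 1) ^ i) * h ^ i) * a (i + 2)))"
proof -
  have "(\<Sum>i<M + 2. of_real ((1 * h) ^ i) * a i) + (\<Sum>i<M + 2. of_real ((- 1 * h) ^ i) * a i) =
      (\<Sum>i<Suc (Suc M). of_real ((1 + (-1) ^ i) * h ^ i) * a i)"
    unfolding sum.distrib[symmetric]
    by (rule sum.cong) (auto simp: power_mult_distrib[of "-1" h] power_minus[of h] algebra_simps)
  also have "\<dots> = 2 * a 0 + of_real h * (of_real h * (\<Sum>i<M. of_real ((1 + (- 1) ^ i) * h ^ i) * a (i + 2)))"
    by (subst sum.lessThan_Suc_shift, subst sum.lessThan_Suc_shift) (simp add: sum_distrib_left algebra_simps)
  finally show ?thesis .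
qed

text \<open>
  The terms of order zero and one are split off; those of order zero cancel.
\<close>

lemma sum_odd_part:
  fixes a :: "nat \<Rightarrow> complex" and h :: real
  shows "(\<Sum>i<M + 2. of_real ((- 1 * h) ^ i) * a i) - (\<Sum>i<M + 2. of_real ((1 * h) ^ i) * a i) =
    - 2 * of_real h * a (Suc 0) + of_real h * (of_real h * (\<Sum>i<M. of_real (((- 1) ^ i - 1) * h ^ i) * a (i + 2)))"
proof -
  have "(\<Sum>i<M + 2. of_real ((- 1 * h) ^ i) * a i) - (\<Sum>i<M + 2. of_real ((1 * h) ^ i) * a i) =
      (\<Sum>i<Suc (Suc M). of_real (((-1) ^ i - 1) * h ^ i) * a i)"
    unfolding sum_subtractf[symmetric]
    by (rule sum.cong) (auto simp: power_mult_distrib[of "-1" h] power_minus[of h] algebra_simps)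
  also have "\<dots> = - 2 * of_real h * a (Suc 0) + of_real h * (of_real h * (\<Sum>i<M. of_real (((- 1) ^ i - 1) * h ^ i) * a (i + 2)))"
    by (subst sum.lessThan_Suc_shift, subst sum.lessThan_Suc_shift) (simp add: sum_distrib_left algebra_simps)
  finally show ?thesis .
qed

text \<open>
  Two more orders than required are used, since the sum of the shifts is divided by \<open>lam\<^sup>2\<close>.  The term
  of order zero is \<open>x\<^sub>j g\<close>, which is the diagonal term of \<open>Delta_hat\<close>.  Only even powers of \<open>\<bar>lam\<bar>\<close> remain,
  and these are powers of \<open>lam\<close>.
\<close>

lemma Delta_hat_Theta:
  fixes g :: "'d::finite symb"
  assumes r0: "0 < r0" and g: "g \<in> symbols r0"
  shows "\<exists>g'\<in>symbols r0. (\<lambda>n m lam. Delta_hat (Theta g) n m lam - Theta g' n m lam) \<in> remainders (int M)"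
proof
  define g' where "g' x k lam = (\<Sum>j\<in>UNIV. \<Sum>i<M. of_real ((1 + (-1) ^ i) / 2) *
      (of_real (lam ^ i) * hop_symb (i + 2) j g x k lam))" for x k lam
  show "g' \<in> symbols r0"
    unfolding g'_def[abs_def]
    by (intro symbols_sum symbols_cmult symbols_lam_power_mult hop_symb_symbols r0 g)
  define E where "E \<sigma> j n m lam = of_real \<bar>lam\<bar> * hop \<sigma> j g n m lam
      - (\<Sum>i<M + 2. of_real ((\<sigma> * \<bar>lam\<bar>) ^ i) * Theta (hop_symb i j g) n m lam)" for \<sigma> j n m lam
  have E: "E 1 j \<in> remainders (int (M + 2))" "E (- 1) j \<in> remainders (int (M + 2))" for j
    unfolding E_def[abs_def] by (rule hop_expansion[OF r0 g]; simp)+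
  have "(\<lambda>n m lam. of_real (1 / \<bar>lam\<bar>) * (of_real (1 / \<bar>lam\<bar>) * (of_real (1/2) *
      (\<Sum>j\<in>UNIV. E 1 j n m lam + E (- 1) j n m lam)))) \<in> remainders (int (M + 2) - 1 - 1)"
    by (intro remainders_divide_lam(2) remainders_cmult remainders_sum remainders_add E)
  then have R: "(\<lambda>n m lam. of_real (1 / \<bar>lam\<bar>) * (of_real (1 / \<bar>lam\<bar>) * (of_real (1/2) *
      (\<Sum>j\<in>UNIV. E 1 j n m lam + E (- 1) j n m lam)))) \<in> remainders (int M)" by simp
  show "(\<lambda>n m lam. Delta_hat (Theta g) n m lam - Theta g' n m lam) \<in> remainders (int M)"
  proof (rule remainders_cong[OF R])
    fix n m :: "nat^'d" and lam :: real assume lam: "lam \<noteq> 0"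
    define h where "h = \<bar>lam\<bar>"
    have h: "h \<noteq> 0" using lam by (simp add: h_def)
    define T where "T j = hop 1 j g n m lam + hop (- 1) j g n m lam - of_real (R_vec n m $ j) * Theta g n m lam" for j
    define S where "S j = (\<Sum>i<M. of_real ((1 + (-1) ^ i) * h ^ i) * Theta (hop_symb (i + 2) j g) n m lam)" for j
    have pair: "E 1 j n m lam + E (- 1) j n m lam =
        of_real h * T j
        - of_real h * (of_real h * S j)" for j
    proof -
      have "2 * Theta (hop_symb 0 j g) n m lam = of_real h * (of_real (R_vec n m $ j) * Theta g n m lam)"
        by (simp add: Theta_def hop_symb_0 h_def)
      with sum_even_part[where h = h and a = "\<lambda>i. Theta (hop_symb i j g) n m lam" and M = M]
      show ?thesis unfolding E_def h_def[symmetric] S_def T_def by (simp only: algebra_simps)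
    qed
    have g'_eq: "Theta g' n m lam = of_real (1/2) * (\<Sum>j\<in>UNIV. S j)"
    proof -
      have "of_real ((1 + (-1) ^ i) / 2) * (of_real (lam ^ i) * z) =
          of_real (1/2) * (of_real ((1 + (-1) ^ i) * h ^ i) * z)" for i and z :: complex
        by (cases "even i") (simp_all add: h_def power_even_abs)
      then show ?thesis
        by (simp only: Theta_def g'_def S_def sum_distrib_left)
    qed
    have "Delta_hat (Theta g) n m lam = of_real (1 / h) * (of_real (1/2) *
        (\<Sum>j\<in>UNIV. T j))"
      by (simp only: Delta_hat_eq Theta_raise Theta_lower h_def T_def)
    moreover have "(\<Sum>j\<in>UNIV. E 1 j n m lam + E (- 1) j n m lam) =
        of_real h * (\<Sum>j\<in>UNIV. T j)
        - of_real h * (of_real h * (\<Sum>j\<in>UNIV. S j))"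
      by (simp only: pair sum_subtractf sum_distrib_left)
    ultimately show "of_real (1 / \<bar>lam\<bar>) * (of_real (1 / \<bar>lam\<bar>) * (of_real (1/2) *
        (\<Sum>j\<in>UNIV. E 1 j n m lam + E (- 1) j n m lam))) = Delta_hat (Theta g) n m lam - Theta g' n m lam"
      using h unfolding h_def[symmetric] g'_eq by (simp add: field_simps)
  qed
qed

lemma Theta_has_vector_derivative:
  assumes "g \<in> symbols r0" "lam \<noteq> 0"
  shows "(Theta g n m has_vector_derivative Theta (euler_symb g) n m lam / of_real lam) (at lam)"
  unfolding Theta_def[abs_def]
  using assms symbols_grad(1) grid_in_cone(3)[OF R_vec_ge_1] by (auto intro!: dilation_derivative)

text \<open>
  The term of order one is \<open>-\<bar>lam\<bar> (g + 2 x\<^sub>j \<partial>\<^sub>j g)\<close>.  Its first part cancels the zeroth-order term of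
  \<open>D_hat\<close>, its second part the derivative of \<open>g\<close> along \<open>\<bar>lam\<bar> R\<close>.  The remaining odd powers of \<open>\<bar>lam\<bar>\<close>,
  times \<open>\<bar>lam\<bar> / lam\<close>, are powers of \<open>lam\<close>.
\<close>

lemma D_hat_Theta:
  fixes g :: "'d::finite symb"
  assumes r0: "0 < r0" and g: "g \<in> symbols r0"
  shows "\<exists>g'\<in>symbols r0. (\<lambda>n m lam. D_hat (Theta g) n m lam - Theta g' n m lam) \<in> remainders (int M)"
proof
  define g' where "g' x k lam = dlam g x k lam + (\<Sum>j\<in>UNIV. \<Sum>i<M. of_real (((-1) ^ i - 1) / 2) *
      (of_real (lam ^ i) * hop_symb (i + 2) j g x k lam))" for x k lam
  show "g' \<in> symbols r0"
    unfolding g'_def[abs_def]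
    by (intro symbols_add symbols_sum symbols_cmult symbols_lam_power_mult hop_symb_symbols symbols_grad r0 g)
  define E where "E \<sigma> j n m lam = of_real \<bar>lam\<bar> * hop \<sigma> j g n m lam
      - (\<Sum>i<M + 2. of_real ((\<sigma> * \<bar>lam\<bar>) ^ i) * Theta (hop_symb i j g) n m lam)" for \<sigma> j n m lam
  have E: "E 1 j \<in> remainders (int (M + 2))" "E (- 1) j \<in> remainders (int (M + 2))" for j
    unfolding E_def[abs_def] by (rule hop_expansion[OF r0 g]; simp)+
  have "(\<lambda>n m lam. of_real (1 / lam) * (of_real (1 / \<bar>lam\<bar>) * (of_real (1/2) *
      (\<Sum>j\<in>UNIV. E (- 1) j n m lam - E 1 j n m lam)))) \<in> remainders (int (M + 2) - 1 - 1)"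
    by (intro remainders_divide_lam remainders_cmult remainders_sum remainders_diff E)
  then have R: "(\<lambda>n m lam. of_real (1 / lam) * (of_real (1 / \<bar>lam\<bar>) * (of_real (1/2) *
      (\<Sum>j\<in>UNIV. E (- 1) j n m lam - E 1 j n m lam)))) \<in> remainders (int M)" by simp
  show "(\<lambda>n m lam. D_hat (Theta g) n m lam - Theta g' n m lam) \<in> remainders (int M)"
  proof (rule remainders_cong[OF R])
    fix n m :: "nat^'d" and lam :: real assume lam: "lam \<noteq> 0"
    define h where "h = \<bar>lam\<bar>"
    have h: "h \<noteq> 0" using lam by (simp add: h_def)
    have x: "h *\<^sub>R R_vec n m \<in> pos_orthant"
      unfolding h_def by (rule grid_in_cone(1)[OF R_vec_ge_1 lam])
    define X where "X j = Theta (\<lambda>x k lam. of_real (x $ j) * dx j g x k lam) n m lam" for j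
    define T where "T j = Theta g n m lam + hop (- 1) j g n m lam - hop 1 j g n m lam" for j
    define S where "S j = (\<Sum>i<M. of_real (((-1) ^ i - 1) * h ^ i) * Theta (hop_symb (i + 2) j g) n m lam)" for j
    have pair: "E (- 1) j n m lam - E 1 j n m lam =
        of_real h * T j + of_real h * (2 * X j)
        - of_real h * (of_real h * S j)" for j
    proof -
      have "2 * Theta (hop_symb (Suc 0) j g) n m lam = Theta g n m lam + 2 * X j"
        using hop_symb_1[OF x, of j g "diff_vec m n" lam] by (simp add: Theta_def X_def h_def)
      then have "- 2 * of_real h * Theta (hop_symb (Suc 0) j g) n m lam = - of_real h * (Theta g n m lam + 2 * X j)"
        by (metis (no_types, lifting) mult.assoc mult.left_commute mult_minus_left)
      with sum_odd_part[where h = h and a = "\<lambda>i. Theta (hop_symb i j g) n m lam" and M = M]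
      show ?thesis unfolding E_def h_def[symmetric] S_def T_def by (simp only: algebra_simps) (simp add: algebra_simps)
    qed
    have g'_eq: "Theta g' n m lam = Theta (dlam g) n m lam + of_real (h / lam) * (of_real (1/2) * (\<Sum>j\<in>UNIV. S j))"
    proof -
      have "of_real (((-1) ^ i - 1) / 2) * (of_real (lam ^ i) * z) =
          of_real (h / lam) * (of_real (1/2) * (of_real (((-1) ^ i - 1) * h ^ i) * z))" for i and z :: complex
      proof (cases "even i")
        case False
        then have "h * h ^ i = lam * lam ^ i"
          unfolding h_def using power_even_abs[of "Suc i" lam] by simp
        from arg_cong[OF this, of complex_of_real]
        have "of_real h * of_real h ^ i = (of_real lam * of_real lam ^ i :: complex)" by simp
        then show ?thesis using lam False by (simp add: field_simps)
      qed simp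
      then show ?thesis
        by (simp only: Theta_def g'_def S_def sum_distrib_left)
    qed
    have "vector_derivative (Theta g n m) (at lam) = of_real (1 / lam) * (\<Sum>j\<in>UNIV. X j) + Theta (dlam g) n m lam"
      unfolding vector_derivative_at[OF Theta_has_vector_derivative[OF g lam]]
      using lam by (simp add: X_def Theta_def euler_symb_def field_simps)
    then have D: "D_hat (Theta g) n m lam = of_real (1 / lam) * (\<Sum>j\<in>UNIV. X j) + Theta (dlam g) n m lam +
        of_real (1 / lam) * (of_real (1/2) *
        (\<Sum>j\<in>UNIV. T j))"
      by (simp only: D_hat_eq Theta_raise Theta_lower T_def)
    have sumE: "(\<Sum>j\<in>UNIV. E (- 1) j n m lam - E 1 j n m lam) =
        of_real h * (\<Sum>j\<in>UNIV. T j)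
        + of_real h * (2 * (\<Sum>j\<in>UNIV. X j)) - of_real h * (of_real h * (\<Sum>j\<in>UNIV. S j))"
      by (simp only: pair sum_subtractf sum.distrib sum_distrib_left)
    show "of_real (1 / lam) * (of_real (1 / \<bar>lam\<bar>) * (of_real (1/2) *
        (\<Sum>j\<in>UNIV. E (- 1) j n m lam - E 1 j n m lam))) = D_hat (Theta g) n m lam - Theta g' n m lam"
      unfolding h_def[symmetric] g'_eq D sumE using h lam by (simp add: field_simps)
  qed
qed

text \<open>
  The function \<open>g\<close> may depend on the order \<open>M\<close>, so that no summation of an asymptotic series is needed.
\<close>

definition approx_symbols :: "real \<Rightarrow> 'd::finite freq_fun set" where
  "approx_symbols r0 = {\<theta>. \<forall>M. \<exists>g\<in>symbols r0. (\<lambda>n m lam. \<theta> n m lam - Theta g n m lam) \<in> remainders (int M)}"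

lemma approx_symbols_split:
  assumes "\<theta> \<in> approx_symbols r0"
  obtains g r where "g \<in> symbols r0" "r \<in> remainders (int M)" "\<theta> = (\<lambda>n m lam. Theta g n m lam + r n m lam)"
proof -
  from assms obtain g where "g \<in> symbols r0" "(\<lambda>n m lam. \<theta> n m lam - Theta g n m lam) \<in> remainders (int M)"
    by (auto simp: approx_symbols_def)
  from that[OF this] show thesis by simp
qed

lemma approx_symbols_remainders:
  assumes "\<theta> \<in> approx_symbols r0"
  shows "\<theta> \<in> remainders 0"
proof -
  obtain g r where gr: "g \<in> symbols r0" "r \<in> remainders (int 0)" "\<theta> = (\<lambda>n m lam. Theta g n m lam + r n m lam)"
    using approx_symbols_split[OF assms] by blast
  have "(\<lambda>n m lam. Theta g n m lam + r n m lam) \<in> remainders 0"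
    using symbols_Theta[OF gr(1)] gr(2) by (intro remainders_add) simp_all
  then show ?thesis by (simp add: gr(3))
qed

lemma Theta_approx_symbols: "g \<in> symbols r0 \<Longrightarrow> Theta g \<in> approx_symbols r0"
  using remainders_sum[of "{} :: nat set"] by (auto simp: approx_symbols_def intro!: bexI[of _ g])

lemma approx_symbols_Delta_hat:
  fixes \<theta> :: "'d::finite freq_fun"
  assumes r0: "0 < r0" and "\<theta> \<in> approx_symbols r0"
  shows "Delta_hat \<theta> \<in> approx_symbols r0"
  unfolding approx_symbols_def
proof (intro CollectI allI)
  fix M
  obtain g r where g: "g \<in> symbols r0" and r: "r \<in> remainders (int (M + 2))"
    and \<theta>: "\<theta> = (\<lambda>n m lam. Theta g n m lam + r n m lam)"
    using approx_symbols_split[OF assms(2)] by blast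
  obtain g' where g': "g' \<in> symbols r0" "(\<lambda>n m lam. Delta_hat (Theta g) n m lam - Theta g' n m lam) \<in> remainders (int M)"
    using Delta_hat_Theta[OF r0 g] by blast
  have "Delta_hat r \<in> remainders (int M)" using remainders_Delta_hat[OF r] by simp
  from remainders_add[OF g'(2) this]
  have "(\<lambda>n m lam. Delta_hat \<theta> n m lam - Theta g' n m lam) \<in> remainders (int M)"
    by (rule remainders_cong) (simp add: \<theta> Delta_hat_add)
  with g'(1) show "\<exists>g\<in>symbols r0. (\<lambda>n m lam. Delta_hat \<theta> n m lam - Theta g n m lam) \<in> remainders (int M)" by blast
qed

lemma approx_symbols_D_hat:
  fixes \<theta> :: "'d::finite freq_fun"
  assumes r0: "0 < r0" and "\<theta> \<in> approx_symbols r0"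
  shows "D_hat \<theta> \<in> approx_symbols r0"
  unfolding approx_symbols_def
proof (intro CollectI allI)
  fix M
  obtain g r where g: "g \<in> symbols r0" and r: "r \<in> remainders (int (M + 2))"
    and \<theta>: "\<theta> = (\<lambda>n m lam. Theta g n m lam + r n m lam)"
    using approx_symbols_split[OF assms(2)] by blast
  obtain g' where g': "g' \<in> symbols r0" "(\<lambda>n m lam. D_hat (Theta g) n m lam - Theta g' n m lam) \<in> remainders (int M)"
    using D_hat_Theta[OF r0 g] by blast
  obtain r' where "r' \<in> remainders (int (M + 2) - 1)" and r': "\<And>n m lam. lam \<noteq> 0 \<Longrightarrow> (r n m has_vector_derivative r' n m lam) (at lam)"
    using remainders_derivative[OF r] by blast
  have "D_hat r \<in> remainders (int M)" using remainders_D_hat[OF r] by simp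
  from remainders_add[OF g'(2) this]
  have "(\<lambda>n m lam. D_hat \<theta> n m lam - Theta g' n m lam) \<in> remainders (int M)"
  proof (rule remainders_cong)
    fix n m :: "nat^'d" and lam :: real assume lam: "lam \<noteq> 0"
    show "D_hat (Theta g) n m lam - Theta g' n m lam + D_hat r n m lam = D_hat \<theta> n m lam - Theta g' n m lam"
      unfolding \<theta> D_hat_add[OF Theta_has_vector_derivative[OF g lam] r'[OF lam]] by simp
  qed
  with g'(1) show "\<exists>g\<in>symbols r0. (\<lambda>n m lam. D_hat \<theta> n m lam - Theta g n m lam) \<in> remainders (int M)" by blast
qed

section \<open>Membership in the Schwartz space\<close>

lemma schwartz_plus_has_grad:
  fixes F :: "(real^'d::finite) \<times> real \<Rightarrow> complex"
  assumes F: "smooth_on (orthant \<times> UNIV) F" and bs: "set bs \<subseteq> Basis" and x: "x \<in> pos_orthant"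
  shows "(iter_partial (orthant \<times> UNIV) bs F has_derivative
    (\<lambda>(v, s). (\<Sum>j\<in>UNIV. v $ j *\<^sub>R iter_partial (orthant \<times> UNIV) ((axis j 1, 0) # bs) F (x, lam))
      + s *\<^sub>R iter_partial (orthant \<times> UNIV) ((0, 1) # bs) F (x, lam))) (at (x, lam))"
proof -
  let ?S = "orthant \<times> UNIV :: ((real^'d) \<times> real) set" and ?U = "pos_orthant \<times> UNIV :: ((real^'d) \<times> real) set"
  have sub: "?U \<subseteq> ?S" by (auto simp: pos_orthant_def orthant_def less_imp_le)
  have U: "open ?U" by (simp add: open_Times open_pos_orthant)
  let ?D = "\<lambda>b. iter_partial ?S (b # bs) F"
  have "(iter_partial ?S bs F has_derivative (\<lambda>v. \<Sum>b\<in>Basis. (v \<bullet> b) *\<^sub>R ?D b (x, lam))) (at (x, lam))"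
  proof (rule continuous_partials_imp_has_derivative[OF U])
    show "(x, lam) \<in> ?U" using x by simp
  next
    fix y b :: "(real^'d) \<times> real" assume y: "y \<in> ?U" and b: "b \<in> Basis"
    have "open ((\<lambda>t. y + t *\<^sub>R b) -` ?U)"
      using U by (rule open_vimage) (intro continuous_intros)
    then have "0 \<in> interior {t. y + t *\<^sub>R b \<in> ?S}"
      using y sub by (intro interiorI[of "(\<lambda>t. y + t *\<^sub>R b) -` ?U"]) auto
    then have "at 0 within {t. y + t *\<^sub>R b \<in> ?S} = at 0" by (rule at_within_interior)
    moreover have "(\<lambda>t. iter_partial ?S bs F (y + t *\<^sub>R b)) differentiable (at 0 within {t. y + t *\<^sub>R b \<in> ?S})"
      using F bs b y sub unfolding smooth_on_def by blast
    ultimately show "((\<lambda>t. iter_partial ?S bs F (y + t *\<^sub>R b)) has_vector_derivative ?D b y) (at 0)"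
      by (simp add: partial_deriv_def vector_derivative_works)
  next
    fix b :: "(real^'d) \<times> real" assume "b \<in> Basis"
    then have "set (b # bs) \<subseteq> Basis" using bs by simp
    then have "continuous_on ?S (?D b)" using F unfolding smooth_on_def by blast
    then show "continuous_on ?U (?D b)" using sub by (rule continuous_on_subset)
  qed
  moreover have "(\<Sum>b\<in>Basis. (z \<bullet> b) *\<^sub>R ?D b (x, lam)) =
      (\<Sum>j\<in>UNIV. fst z $ j *\<^sub>R ?D (axis j 1, 0) (x, lam)) + snd z *\<^sub>R ?D (0, 1) (x, lam)" for z
  proof -
    have Basis: "(Basis :: ((real^'d) \<times> real) set) = insert (0, 1) (range (\<lambda>j. (axis j 1, 0)))"
      by (auto simp: Basis_prod_def Basis_vec_def)
    have inj: "inj (\<lambda>j :: 'd. (axis j (1 :: real), 0 :: real))" by (auto simp: inj_def axis_eq_axis)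
    have "(0, 1) \<notin> range (\<lambda>j :: 'd. (axis j (1 :: real), 0 :: real))" by auto
    then show ?thesis
      unfolding Basis
      by (cases z) (simp add: sum.reindex[OF inj] inner_axis add.commute del: iter_partial.simps)
  qed
  ultimately show ?thesis by (simp add: case_prod_unfold del: iter_partial.simps)
qed

lemma schwartz_plus_symb_upto:
  fixes f :: "real^'d::finite \<Rightarrow> int^'d \<Rightarrow> real \<Rightarrow> complex"
  assumes f: "f \<in> schwartz_plus"
  shows "symb_upto N f"
proof -
  let ?S = "orthant \<times> UNIV :: ((real^'d) \<times> real) set"
  let ?P = "\<lambda>bs x k lam. iter_partial ?S bs (\<lambda>(x, lam). f x k lam) (x, lam)"
  have "symb_upto N (?P bs)" if "set bs \<subseteq> Basis" for bs
    using that
  proof (induction N arbitrary: bs)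
    have rapid: "rapid_symb (?P bs)" if bs: "set bs \<subseteq> Basis" for bs
      unfolding rapid_symb_def
    proof
      fix p :: nat
      obtain C where C: "\<And>x k lam bs'. x \<in> orthant \<Longrightarrow> set bs' \<subseteq> Basis \<Longrightarrow> length bs' \<le> max p (length bs) \<Longrightarrow>
          (1 + (\<Sum>j\<in>UNIV. x $ j) + real_of_int (l1 k)) ^ max p (length bs) * cmod (?P bs' x k lam) \<le> C"
        using f unfolding schwartz_plus_def by blast
      have "weight x k ^ p * cmod (?P bs x k lam) \<le> C" if x: "x \<in> pos_orthant" for x k lam
      proof -
        have "x \<in> orthant" using x by (auto simp: pos_orthant_def orthant_def less_imp_le)
        then have le: "weight x k ^ max p (length bs) * cmod (?P bs x k lam) \<le> C"
          using C[of x bs k lam] bs by (simp add: weight_def)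
        have "weight x k ^ p \<le> weight x k ^ max p (length bs)"
          using component_le_weight(2)[OF x, of k] by (intro power_increasing) auto
        from mult_right_mono[OF this norm_ge_zero] le show ?thesis by (rule order_trans)
      qed
      then show "\<exists>C. \<forall>x\<in>pos_orthant. \<forall>k lam. (\<forall>j. \<bar>lam\<bar> \<le> x $ j) \<longrightarrow>
        weight x k ^ p * cmod (?P bs x k lam) \<le> C" by blast
    qed
    {
      case 0
      then show ?case using rapid by simp
    next
      case (Suc N)
      have "has_grad (?P bs) (\<lambda>j. ?P ((axis j 1, 0) # bs)) (?P ((0, 1) # bs))"
        unfolding has_grad_def
      proof (intro ballI allI)
        fix x :: "real^'d" and k lam assume x: "x \<in> pos_orthant"
        have "smooth_on ?S (\<lambda>(x, lam). f x k lam)" using f by (simp add: schwartz_plus_def)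
        from schwartz_plus_has_grad[OF this Suc.prems x, of lam]
        show "((\<lambda>(x, lam). ?P bs x k lam) has_derivative
          (\<lambda>(v, s). (\<Sum>j\<in>UNIV. v $ j *\<^sub>R ?P ((axis j 1, 0) # bs) x k lam) + s *\<^sub>R ?P ((0, 1) # bs) x k lam))
          (at (x, lam))" by (simp only: case_prod_eta)
      qed
      then show ?case
      proof (rule symb_upto_SucI[OF rapid[OF Suc.prems]])
        have "(axis j 1, 0) \<in> (Basis :: ((real^'d) \<times> real) set)" "(0, 1) \<in> (Basis :: ((real^'d) \<times> real) set)" for j
          by (auto simp: Basis_prod_def Basis_vec_def)
        then show "symb_upto N (?P ((axis j 1, 0) # bs))" "symb_upto N (?P ((0, 1) # bs))" for j
          using Suc.prems by (auto intro!: Suc.IH simp del: iter_partial.simps)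
      qed
    }
  qed
  from this[of "[]"] show ?thesis by simp
qed

lemma grid_bound_rapidly_decaying: "grid_bound 0 r \<Longrightarrow> rapidly_decaying r"
  by (simp add: grid_bound_def rapidly_decaying_def)

lemma remainders_rapidly_decaying: "r \<in> remainders 0 \<Longrightarrow> rapidly_decaying r"
  using remainder_upto_bound grid_bound_rapidly_decaying unfolding remainders_def by blast

text \<open>
  Differentiation in \<open>lam\<close> maps remainders to remainders of one order less, so it can be iterated.
\<close>

lemma remainders_iter_partial:
  fixes r :: "'d::finite freq_fun"
  assumes "r \<in> remainders M" "set bs \<subseteq> Basis"
  shows "\<exists>K. \<exists>s\<in>remainders K. \<forall>n m. \<forall>lam\<in>UNIV - {0}. iter_partial (UNIV - {0}) bs (r n m) lam = s n m lam"
  using assms(2)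
proof (induction bs)
  case Nil
  then show ?case using assms(1) by auto
next
  case (Cons b bs)
  then have b: "b = 1" by simp
  from Cons obtain K s where s: "s \<in> remainders K"
    "\<And>n m lam. lam \<noteq> 0 \<Longrightarrow> iter_partial (UNIV - {0}) bs (r n m) lam = s n m lam"
    by auto
  obtain s' where s': "s' \<in> remainders (K - 1)"
    "\<And>n m lam. lam \<noteq> 0 \<Longrightarrow> (s n m has_vector_derivative s' n m lam) (at lam)"
    using remainders_derivative[OF s(1)] by blast
  have "iter_partial (UNIV - {0}) (b # bs) (r n m) lam = s' n m lam" if lam: "lam \<noteq> 0" for n m lam
  proof -
    let ?T = "{t. lam + t *\<^sub>R b \<in> UNIV - {0}}"
    have T: "?T = - {- lam}" by (auto simp: b add_eq_0_iff2)
    have at: "at 0 within ?T = at 0" unfolding T using lam by (intro at_within_open) auto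
    have "(iter_partial (UNIV - {0}) bs (r n m) has_vector_derivative s' n m lam) (at lam)"
      using s'(2)[OF lam] by (rule has_vector_derivative_transform_within_open[where S = "- {0}"]) (use s(2) lam in auto)
    then have "((iter_partial (UNIV - {0}) bs (r n m) \<circ> (\<lambda>t. lam + t)) has_vector_derivative 1 *\<^sub>R s' n m lam) (at 0)"
      by (intro vector_diff_chain_at) (auto intro!: derivative_eq_intros)
    then have "((\<lambda>t. iter_partial (UNIV - {0}) bs (r n m) (lam + t *\<^sub>R b)) has_vector_derivative s' n m lam) (at 0)"
      by (simp add: o_def b)
    then show ?thesis
      by (simp only: iter_partial.simps partial_deriv_def at vector_derivative_at)
  qed
  with s'(1) show ?case by blast
qed

lemma remainders_smooth_on:
  assumes r: "r \<in> remainders M"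
  shows "smooth_on (UNIV - {0}) (r n m)"
  unfolding smooth_on_def
proof (intro allI impI conjI ballI)
  fix bs :: "real list" assume bs: "set bs \<subseteq> Basis"
  obtain K s where s: "s \<in> remainders K"
    "\<And>lam. lam \<noteq> 0 \<Longrightarrow> iter_partial (UNIV - {0}) bs (r n m) lam = s n m lam"
    using remainders_iter_partial[OF r bs] by auto
  obtain s' where s': "s' \<in> remainders (K - 1)"
    "\<And>n m lam. lam \<noteq> 0 \<Longrightarrow> (s n m has_vector_derivative s' n m lam) (at lam)"
    using remainders_derivative[OF s(1)] by blast
  have der: "(iter_partial (UNIV - {0}) bs (r n m) has_vector_derivative s' n m lam) (at lam)" if lam: "lam \<noteq> 0" for lam
    using s'(2)[OF lam] by (rule has_vector_derivative_transform_within_open[where S = "- {0}"]) (use s(2) lam in auto)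
  then show "continuous_on (UNIV - {0}) (iter_partial (UNIV - {0}) bs (r n m))"
    by (intro continuous_at_imp_continuous_on ballI has_vector_derivative_continuous) auto
  fix b z :: real assume b: "b \<in> Basis" and z: "z \<in> UNIV - {0}"
  have "((iter_partial (UNIV - {0}) bs (r n m) \<circ> (\<lambda>t. z + t *\<^sub>R b)) has_vector_derivative b *\<^sub>R s' n m z) (at 0)"
    using der[of z] z by (intro vector_diff_chain_at) (auto intro!: derivative_eq_intros)
  then show "(\<lambda>t. iter_partial (UNIV - {0}) bs (r n m) (z + t *\<^sub>R b)) differentiable (at 0 within {t. z + t *\<^sub>R b \<in> UNIV - {0}})"
    unfolding o_def by (rule differentiable_at_withinI[OF differentiableI_vector])
qed

lemma parity_size_sum: "(- 1 :: complex) ^ size_sum n m = (- 1) ^ nat (l1 (diff_vec m n))"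
proof -
  have "int (\<Sum>j\<in>UNIV. nat \<bar>diff_vec m n $ j\<bar>) = l1 (diff_vec m n)"
    by (simp add: l1_def)
  from arg_cong[OF this, of nat, symmetric]
  have "nat (l1 (diff_vec m n)) = (\<Sum>j\<in>UNIV. nat \<bar>diff_vec m n $ j\<bar>)"
    by (simp only: nat_int)
  then have "(- 1 :: complex) ^ nat (l1 (diff_vec m n)) = (\<Prod>j\<in>UNIV. (- 1) ^ nat \<bar>diff_vec m n $ j\<bar>)"
    by (simp only: power_sum)
  also have "\<dots> = (\<Prod>j\<in>UNIV. (- 1) ^ (n $ j + m $ j))"
    by (intro prod.cong refl) (auto simp: minus_one_power_iff diff_vec_def even_nat_iff)
  also have "\<dots> = (- 1) ^ size_sum n m"
    by (simp only: size_sum_def power_sum)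
  finally show ?thesis by simp
qed

lemma l1_diff_vec_commute: "l1 (diff_vec n m) = l1 (diff_vec m n)"
  by (simp add: l1_def diff_vec_def abs_minus_commute)

lemma d0_hat_swap: "d0_hat m n (- lam) = d0_hat n m lam"
  by (simp add: d0_hat_def l1_diff_vec_commute[of m n] size_sum_def add.commute)

lemma rapidly_decaying_add:
  assumes "rapidly_decaying a" "rapidly_decaying b"
  shows "rapidly_decaying (\<lambda>n m lam. a n m lam + b n m lam)"
  using grid_bound_add[of 0 a b] assms by (simp add: grid_bound_def rapidly_decaying_def)

text \<open>
  One order of vanishing compensates the division by \<open>lam\<close>.
\<close>

lemma Sigma0_hat_remainder:
  assumes "r \<in> remainders 1"
  shows "rapidly_decaying (Sigma0_hat r)"
  unfolding rapidly_decaying_def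
proof
  fix p :: nat
  have "grid_bound 1 r" using assms remainder_upto_bound unfolding remainders_def by blast
  then obtain C where C: "\<And>n m lam. lam \<noteq> 0 \<Longrightarrow> (1 + d0_hat n m lam) ^ p * cmod (r n m lam) \<le> C * \<bar>lam\<bar>"
    unfolding grid_bound_def by (metis power_int_1_right)
  have "(1 + d0_hat n m lam) ^ p * cmod (Sigma0_hat r n m lam) \<le> 2 * C" if lam: "lam \<noteq> 0" for n m lam
  proof -
    let ?w = "(1 + d0_hat n m lam) ^ p"
    have w: "0 \<le> ?w" using lam_le_d0_hat(2)[of n m lam] by simp
    have "cmod (r n m lam - (- 1) ^ size_sum n m * r m n (- lam)) \<le> cmod (r n m lam) + cmod (r m n (- lam))"
      by (rule order_trans[OF norm_triangle_ineq4]) (simp add: norm_mult norm_power)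
    from mult_left_mono[OF this w] C[OF lam, of n m] C[of "- lam" m n] lam
    have "?w * cmod (r n m lam - (- 1) ^ size_sum n m * r m n (- lam)) \<le> 2 * C * \<bar>lam\<bar>"
      by (simp add: d0_hat_swap distrib_left)
    then show ?thesis using lam by (simp add: Sigma0_hat_def norm_divide field_simps)
  qed
  then show "\<exists>C. \<forall>n m lam. lam \<noteq> 0 \<longrightarrow> (1 + d0_hat n m lam) ^ p * cmod (Sigma0_hat r n m lam) \<le> C" by blast
qed

text \<open>
  By parity the second term is \<open>g(x,k,-lam)\<close>, with the same \<open>x\<close> and \<open>k\<close>.  The mean value inequality
  applies on the segment from \<open>-lam\<close> to \<open>lam\<close>, which lies in the cone.
\<close>

lemma Sigma0_hat_Theta:
  fixes g :: "'d::finite symb"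
  assumes g: "g \<in> symbols r0"
  shows "rapidly_decaying (Sigma0_hat (Theta g))"
  unfolding rapidly_decaying_def
proof
  fix p :: nat
  have "rapid_symb (dlam g)"
    using symbols_grad(3)[OF g] symb_upto.simps(1)[of "dlam g"] unfolding symbols_def by blast
  then obtain C where C: "\<And>x k lam. x \<in> pos_orthant \<Longrightarrow> (\<And>j. \<bar>lam\<bar> \<le> x $ j) \<Longrightarrow>
      weight x k ^ p * cmod (dlam g x k lam) \<le> C"
    unfolding rapid_symb_def by blast
  have "(1 + d0_hat n m lam) ^ p * cmod (Sigma0_hat (Theta g) n m lam) \<le> 2 * C" if lam: "lam \<noteq> 0" for n m lam
  proof -
    let ?x = "\<bar>lam\<bar> *\<^sub>R R_vec n m" and ?k = "diff_vec m n" and ?w = "(1 + d0_hat n m lam) ^ p"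
    have w: "0 < ?w" using lam_le_d0_hat(2)[of n m lam] by simp
    note x = grid_in_cone(1,2)[OF R_vec_ge_1 lam, of n m]
    have k: "diff_vec n m = - ?k" by (simp add: vec_eq_iff diff_vec_def)
    have R: "R_vec m n = R_vec n m" by (simp add: vec_eq_iff R_vec_def)
    have "Theta g m n (- lam) = (- 1) ^ size_sum n m * g ?x ?k (- lam)"
      using g x(1) by (simp add: Theta_def k R symbols_def admissible_def parity_size_sum)
    then have "Sigma0_hat (Theta g) n m lam = (g ?x ?k lam - g ?x ?k (- lam)) / of_real lam"
      by (simp add: Sigma0_hat_def Theta_def minus_one_power_iff)
    moreover
    have "cmod (g ?x ?k lam - g ?x ?k (- lam)) \<le> (C / ?w) * norm (lam - (- lam))"
    proof (rule differentiable_bound)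
      show "convex {- \<bar>lam\<bar>..\<bar>lam\<bar>}" by simp
      show "lam \<in> {- \<bar>lam\<bar>..\<bar>lam\<bar>}" "- lam \<in> {- \<bar>lam\<bar>..\<bar>lam\<bar>}" by auto
      fix s assume s: "s \<in> {- \<bar>lam\<bar>..\<bar>lam\<bar>}"
      have "((\<lambda>s. g ?x ?k s) has_vector_derivative
          (\<Sum>j\<in>UNIV. 0 $ j *\<^sub>R dx j g ?x ?k s) + 1 *\<^sub>R dlam g ?x ?k s) (at s within {- \<bar>lam\<bar>..\<bar>lam\<bar>})"
        by (rule has_grad_chain[where y = "\<lambda>_. ?x" and l = "\<lambda>s. s", OF symbols_grad(1)[OF g] x(1)]) (auto intro!: derivative_eq_intros)
      then show "(g ?x ?k has_derivative (\<lambda>h. h *\<^sub>R dlam g ?x ?k s)) (at s within {- \<bar>lam\<bar>..\<bar>lam\<bar>})"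
        by (simp add: has_vector_derivative_def)
      have "\<bar>s\<bar> \<le> ?x $ j" for j using s x(2)[of j] by auto
      from C[OF x(1) this, of ?k] have le: "cmod (dlam g ?x ?k s) \<le> C / ?w"
        using w by (simp add: weight_grid field_simps)
      show "onorm (\<lambda>h. h *\<^sub>R dlam g ?x ?k s) \<le> C / ?w"
      proof (rule onorm_le)
        fix h :: real
        from mult_right_mono[OF le abs_ge_zero[of h]]
        show "norm (h *\<^sub>R dlam g ?x ?k s) \<le> C / ?w * norm h"
          by (simp only: norm_scaleR real_norm_def mult.commute[of "\<bar>h\<bar>"])
      qed
    qed
    then have "?w * cmod (g ?x ?k lam - g ?x ?k (- lam)) \<le> 2 * C * \<bar>lam\<bar>"
      using w by (simp add: field_simps abs_mult)
    ultimately show ?thesis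
      using lam by (simp add: norm_divide pos_divide_le_eq)
  qed
  then show "\<exists>C. \<forall>n m lam. lam \<noteq> 0 \<longrightarrow>
      (1 + d0_hat n m lam) ^ p * cmod (Sigma0_hat (Theta g) n m lam) \<le> C" by blast
qed

lemma approx_symbols_Sigma0_hat:
  assumes "\<theta> \<in> approx_symbols r0"
  shows "rapidly_decaying (Sigma0_hat \<theta>)"
proof -
  obtain g r where gr: "g \<in> symbols r0" "r \<in> remainders (int 1)" "\<theta> = (\<lambda>n m lam. Theta g n m lam + r n m lam)"
    using approx_symbols_split[OF assms] by blast
  have "Sigma0_hat \<theta> = (\<lambda>n m lam. Sigma0_hat (Theta g) n m lam + Sigma0_hat r n m lam)"
    by (simp add: fun_eq_iff Sigma0_hat_def gr(3) algebra_simps add_divide_distrib diff_divide_distrib)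
  moreover have "rapidly_decaying (Sigma0_hat r)" using gr(2) by (simp add: Sigma0_hat_remainder)
  ultimately show ?thesis
    using rapidly_decaying_add[OF Sigma0_hat_Theta[OF gr(1)]] by simp
qed

lemma approx_symbols_schwartz_tilde:
  assumes r0: "0 < r0" and "\<theta> \<in> approx_symbols r0"
  shows "\<theta> \<in> schwartz_tilde"
proof -
  have "(Delta_hat ^^ N) \<theta> \<in> approx_symbols r0" "(D_hat ^^ N) \<theta> \<in> approx_symbols r0" for N
    by (induction N) (auto simp: assms(2) intro: approx_symbols_Delta_hat[OF r0] approx_symbols_D_hat[OF r0])
  then show ?thesis
    unfolding schwartz_tilde_def
    using remainders_smooth_on[OF approx_symbols_remainders[OF assms(2)]]
      remainders_rapidly_decaying approx_symbols_remainders approx_symbols_Sigma0_hat by blast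
qed

section \<open>Continuous extension to the completion\<close>

text \<open>
  The arguments at which \<open>f\<close> is evaluated to define the extension.  A limit point \<open>(x,k)\<close> has coordinates
  of one sign, and \<open>\<bar>lam\<bar> R(n,m)\<close> tends to the vector of absolute values of \<open>x\<close>.
\<close>

definition freq_abs :: "'d::finite freq \<Rightarrow> real^'d" where
  "freq_abs w = (case w of Reg n m lam \<Rightarrow> \<bar>lam\<bar> *\<^sub>R R_vec n m | Sing x k \<Rightarrow> (\<chi> j. \<bar>x $ j\<bar>))"

definition freq_index :: "'d::finite freq \<Rightarrow> int^'d" where
  "freq_index w = (case w of Reg n m lam \<Rightarrow> diff_vec m n | Sing x k \<Rightarrow> k)"

definition freq_lam :: "'d::finite freq \<Rightarrow> real" where
  "freq_lam w = (case w of Reg n m lam \<Rightarrow> lam | Sing x k \<Rightarrow> 0)"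

lemma component_le_l1_real: "\<bar>v $ j\<bar> \<le> l1 (v :: real^'d::finite)"
  unfolding l1_def by (rule member_le_sum) auto

text \<open>
  All three arguments are Lipschitz for \<open>dist_hat\<close>.  In the first, \<open>R\<close> exceeds \<open>n + m\<close> by one in each
  coordinate; the difference this makes is at most the term \<open>\<bar>lam - lam'\<bar>\<close> of the distance.
\<close>

lemma freq_dist_bounds:
  shows "\<bar>freq_abs w $ j - freq_abs w' $ j\<bar> \<le> dist_hat w w'"
    and "\<bar>freq_lam w - freq_lam w'\<bar> \<le> dist_hat w w'"
    and "real_of_int (l1 (freq_index w - freq_index w')) \<le> dist_hat w w'"
proof -
  have l1k: "l1 (diff_vec n m - diff_vec n' m') = l1 (diff_vec m n - diff_vec m' n')"
    for n m n' m' :: "nat^'a"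
    by (simp add: l1_def diff_vec_def) (rule sum.cong, auto)
  have l1c: "l1 (k - k') = l1 (k' - k)" for k k' :: "int^'a"
    by (simp add: l1_def abs_minus_commute)
  have l1r: "0 \<le> l1 v" for v :: "real^'a" by (auto simp: l1_def intro: sum_nonneg)
  have abs: "\<bar>\<bar>lam\<bar> * (a + 1) - \<bar>lam'\<bar> * (b + 1)\<bar> \<le> \<bar>lam * a - lam' * b\<bar> + \<bar>lam - lam'\<bar>"
    if "0 \<le> a" "0 \<le> b" for lam lam' a b :: real
  proof -
    have "\<bar>lam\<bar> * a = \<bar>lam * a\<bar>" "\<bar>lam'\<bar> * b = \<bar>lam' * b\<bar>" using that by (simp_all add: abs_mult)
    then show ?thesis unfolding distrib_left by linarith
  qed
  have lin: "\<bar>lam * (real a + real b)\<bar> = \<bar>lam\<bar> * (real a + real b)" for lam a b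
    by (simp add: abs_mult)
  note l1pos = l1_nonneg[THEN of_int_0_le_iff[where 'a = real, THEN iffD2]]
  show "\<bar>freq_lam w - freq_lam w'\<bar> \<le> dist_hat w w'"
    "real_of_int (l1 (freq_index w - freq_index w')) \<le> dist_hat w w'"
    by (cases w; cases w'; use l1r l1pos in \<open>auto simp: freq_lam_def freq_index_def l1k l1c intro!: add_nonneg_nonneg add_increasing add_increasing2\<close>)+
  show "\<bar>freq_abs w $ j - freq_abs w' $ j\<bar> \<le> dist_hat w w'"
  proof (cases w; cases w')
    fix n m lam n' m' lam' assume w: "w = Reg n m lam" "w' = Reg n' m' lam'"
    have "\<bar>lam * real (n $ j + m $ j) - lam' * real (n' $ j + m' $ j)\<bar> \<le> l1 (lam *\<^sub>R sum_vec n m - lam' *\<^sub>R sum_vec n' m')"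
      using component_le_l1_real[of "lam *\<^sub>R sum_vec n m - lam' *\<^sub>R sum_vec n' m'" j] by (simp add: sum_vec_def)
    with abs[of "real (n $ j + m $ j)" "real (n' $ j + m' $ j)" lam lam'] l1pos[of "diff_vec n m - diff_vec n' m'"]
    show ?thesis by (simp add: w freq_abs_def R_vec_def add_ac)
  next
    fix n m lam x k assume w: "w = Reg n m lam" "w' = Sing x k"
    have "\<bar>lam * real (n $ j + m $ j) - x $ j\<bar> \<le> l1 (lam *\<^sub>R sum_vec n m - x)"
      using component_le_l1_real[of "lam *\<^sub>R sum_vec n m - x" j] by (simp add: sum_vec_def)
    with abs[of "real (n $ j + m $ j)" "\<bar>x $ j\<bar>" lam 0] l1pos[of "diff_vec m n - k"]
    have "\<bar>\<bar>lam * real (n $ j + m $ j)\<bar> - \<bar>x $ j\<bar>\<bar> + \<bar>lam\<bar> \<le> dist_hat w w'"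
      by (simp add: w)
    moreover have "freq_abs w $ j - freq_abs w' $ j = \<bar>lam * real (n $ j + m $ j)\<bar> + \<bar>lam\<bar> - \<bar>x $ j\<bar>"
      by (simp add: w freq_abs_def R_vec_def lin distrib_left[of "\<bar>lam\<bar>"])
    ultimately show ?thesis by linarith
  next
    fix n m lam x k assume w: "w = Sing x k" "w' = Reg n m lam"
    have "\<bar>lam * real (n $ j + m $ j) - x $ j\<bar> \<le> l1 (lam *\<^sub>R sum_vec n m - x)"
      using component_le_l1_real[of "lam *\<^sub>R sum_vec n m - x" j] by (simp add: sum_vec_def)
    with l1pos[of "diff_vec m n - k"]
    have "\<bar>\<bar>lam * real (n $ j + m $ j)\<bar> - \<bar>x $ j\<bar>\<bar> + \<bar>lam\<bar> \<le> dist_hat w w'"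
      by (simp add: w)
    moreover have "freq_abs w $ j - freq_abs w' $ j = \<bar>x $ j\<bar> - (\<bar>lam * real (n $ j + m $ j)\<bar> + \<bar>lam\<bar>)"
      by (simp add: w freq_abs_def R_vec_def lin distrib_left[of "\<bar>lam\<bar>"])
    ultimately show ?thesis by linarith
  next
    fix x k x' k' assume w: "w = Sing x k" "w' = Sing x' k'"
    show ?thesis
      using component_le_l1_real[of "x - x'" j] l1pos[of "k - k'"] by (simp add: w freq_abs_def)
  qed
qed

text \<open>
  At distance less than one the integer vectors agree, so only the continuity of \<open>f\<close> in \<open>(x,lam)\<close> for
  fixed \<open>k\<close> is needed.
\<close>

lemma continuous_map_freq_hat:
  fixes f :: "real^'d::finite \<Rightarrow> int^'d \<Rightarrow> real \<Rightarrow> complex"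
  assumes "\<And>k. continuous_on (orthant \<times> UNIV) (\<lambda>(x, lam). f x k lam)"
  shows "continuous_map (Metric_space.mtopology freq_hat dist_hat) euclidean
    (\<lambda>w. f (freq_abs w) (freq_index w) (freq_lam w))"
proof -
  interpret freq: Metric_space "freq_hat :: 'd freq set" dist_hat by (rule Metric_space_freq_hat)
  let ?T = "\<lambda>w. f (freq_abs w) (freq_index w) (freq_lam w)"
  have orth: "freq_abs w \<in> orthant" for w :: "'d freq"
    by (cases w) (auto simp: freq_abs_def orthant_def R_vec_def)
  have "\<exists>\<delta>>0. \<forall>w. w \<in> freq_hat \<and> dist_hat a w < \<delta> \<longrightarrow> dist (?T a) (?T w) < \<epsilon>" if "0 < \<epsilon>" for a \<epsilon>
  proof -
    have "continuous (at (freq_abs a, freq_lam a) within orthant \<times> UNIV) (\<lambda>(x, lam). f x (freq_index a) lam)"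
      using assms orth[of a] by (auto simp: continuous_on_eq_continuous_within)
    then obtain d where d: "0 < d" "\<And>x lam. x \<in> orthant \<Longrightarrow> dist (x, lam) (freq_abs a, freq_lam a) < d \<Longrightarrow>
        dist (f x (freq_index a) lam) (f (freq_abs a) (freq_index a) (freq_lam a)) < \<epsilon>"
      unfolding continuous_within_eps_delta using \<open>0 < \<epsilon>\<close> by fastforce
    define \<delta> where "\<delta> = min 1 (d / (real CARD('d) + 1))"
    show ?thesis
    proof (intro exI conjI allI impI)
      show "0 < \<delta>" using d(1) by (simp add: \<delta>_def)
      fix w assume w: "w \<in> freq_hat \<and> dist_hat a w < \<delta>"
      have "real_of_int (l1 (freq_index a - freq_index w)) < 1"
        using freq_dist_bounds(3)[of a w] w by (simp add: \<delta>_def)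
      then have "l1 (freq_index a - freq_index w) = 0"
        using l1_nonneg[of "freq_index a - freq_index w"] by linarith
      then have k: "freq_index w = freq_index a"
        by (simp add: l1_def sum_nonneg_eq_0_iff vec_eq_iff)
      have "norm (freq_abs w - freq_abs a) \<le> (\<Sum>j\<in>UNIV. \<bar>(freq_abs w - freq_abs a) $ j\<bar>)"
        by (rule norm_le_l1_cart)
      also have "\<dots> \<le> (\<Sum>j\<in>(UNIV :: 'd set). dist_hat a w)"
        using freq_dist_bounds(1)[of a _ w] by (intro sum_mono) (simp add: abs_minus_commute)
      finally have "dist (freq_abs w) (freq_abs a) \<le> real CARD('d) * dist_hat a w"
        by (simp add: dist_norm)
      moreover have "dist (freq_lam w) (freq_lam a) \<le> dist_hat a w"
        using freq_dist_bounds(2)[of a w] by (simp add: dist_real_def abs_minus_commute)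
      moreover have "dist (freq_abs w, freq_lam w) (freq_abs a, freq_lam a) \<le>
          dist (freq_abs w) (freq_abs a) + dist (freq_lam w) (freq_lam a)"
        unfolding dist_prod_def by (simp add: sqrt_sum_squares_le_sum)
      ultimately have "dist (freq_abs w, freq_lam w) (freq_abs a, freq_lam a) \<le> (real CARD('d) + 1) * dist_hat a w"
        by (simp add: algebra_simps)
      also have "\<dots> < d"
        using w by (simp add: \<delta>_def field_simps)
      finally have "dist (f (freq_abs w) (freq_index a) (freq_lam w)) (?T a) < \<epsilon>"
        by (intro d(2) orth)
      then show "dist (?T a) (?T w) < \<epsilon>" by (simp add: k dist_commute)
    qed
  qed
  then have "continuous_map freq.mtopology (Metric_space.mtopology UNIV dist) ?T"
    by (subst freq.metric_continuous_map[OF Met_TC.Metric_space_axioms]) auto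
  then show ?thesis by simp
qed

text \<open>
  Under either hypothesis \<open>f\<close> is admissible: in the first case any \<open>r0 > 0\<close> will do, and parity is trivial
  since only \<open>k = 0\<close> contributes.
\<close>

theorem theorem2p3:
  fixes f :: "real^'d::finite \<Rightarrow> int^'d \<Rightarrow> real \<Rightarrow> complex"
  assumes "f \<in> schwartz_plus"
    and "supp_plus f \<subseteq> orthant \<times> {0} \<times> UNIV \<or>
         ((\<exists>r0>0. supp_plus f \<subseteq> {x. \<forall>j. r0 \<le> x $ j} \<times> UNIV \<times> UNIV) \<and>
          (\<forall>x\<in>orthant. \<forall>k lam. f x (- k) lam = (-1) ^ nat (l1 k) * f x k lam))"
  shows "Theta f \<in> schwartz_tilde \<and>
         (\<exists>T\<in>schwartz_hat. \<forall>n m lam. lam \<noteq> 0 \<longrightarrow> T (Reg n m lam) = Theta f n m lam)"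
proof -
  have pos: "x \<in> orthant" if "x \<in> pos_orthant" for x :: "real^'d"
    using that by (auto simp: pos_orthant_def orthant_def less_imp_le)
  have supp: "(x, k, lam) \<in> supp_plus f" if "x \<in> pos_orthant" "f x k lam \<noteq> 0" for x k lam
    unfolding supp_plus_def using that pos closure_subset[of "{(x, k, lam). x \<in> orthant \<and> f x k lam \<noteq> 0}"] by blast
  have "\<exists>r0>0. admissible r0 f"
    using assms(2)
  proof (elim disjE conjE exE)
    assume *: "supp_plus f \<subseteq> orthant \<times> {0} \<times> UNIV"
    have "f x k lam = 0" if "x \<in> pos_orthant" "k \<noteq> 0" for x k lam
      using supp[of x k lam] that * by blast
    moreover have "f x (- k) lam = (-1) ^ nat (l1 k) * f x k lam" if "x \<in> pos_orthant" for x k lam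
      using calculation[OF that, of k lam] calculation[OF that, of "- k" lam] by (cases "k = 0") (auto simp: l1_def)
    ultimately have "admissible 1 f" by (auto simp: admissible_def)
    then show ?thesis by (intro exI[of _ 1]) simp
  next
    fix r0 :: real
    assume r0: "0 < r0" and *: "supp_plus f \<subseteq> {x. \<forall>j. r0 \<le> x $ j} \<times> UNIV \<times> UNIV"
      and parity: "\<forall>x\<in>orthant. \<forall>k lam. f x (- k) lam = (-1) ^ nat (l1 k) * f x k lam"
    have "f x k lam = 0" if "x \<in> pos_orthant" "x $ j < r0" for x k lam j
    proof (rule ccontr)
      assume "f x k lam \<noteq> 0"
      with supp that(1) * have "r0 \<le> x $ j" by blast
      with that(2) show False by simp
    qed
    with parity pos r0 show ?thesis by (auto simp: admissible_def)
  qed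
  then obtain r0 where r0: "0 < r0" "admissible r0 f" by blast
  then have "f \<in> symbols r0"
    using schwartz_plus_symb_upto[OF assms(1)] by (simp add: symbols_def)
  then have tilde: "Theta f \<in> schwartz_tilde"
    using r0(1) by (intro approx_symbols_schwartz_tilde Theta_approx_symbols)
  define T where "T w = f (freq_abs w) (freq_index w) (freq_lam w)" for w
  have T: "T (Reg n m lam) = Theta f n m lam" for n m lam
    by (simp add: T_def freq_abs_def freq_index_def freq_lam_def Theta_def)
  have "continuous_on (orthant \<times> UNIV) (\<lambda>(x, lam). f x k lam)" for k
  proof -
    have "smooth_on (orthant \<times> UNIV) (\<lambda>(x, lam). f x k lam)"
      using assms(1) by (simp add: schwartz_plus_def)
    then show ?thesis unfolding smooth_on_def by (force dest: spec[of _ "[]"])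
  qed
  from continuous_map_freq_hat[of f, OF this] tilde have "T \<in> schwartz_hat"
    unfolding schwartz_hat_def T[abs_def] by (simp add: T T_def[abs_def] freq_abs_def freq_index_def freq_lam_def Theta_def[abs_def])
  with tilde T show ?thesis by blast
qed

end
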